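(* For a finite poset $\mathcal{P}$, the following matrix $K$-algebra is basic and Morita equivalent to the left Burt-Butler algebra $\mathcal{L}$ of the bocs associated to $\mathcal{P}$: \[ \mathcal{L}' = \begin{pmatrix} R'' & 0 \\ \begin{pmatrix} R''\\ Z_{\mathcal{P}}\end{pmatrix} & K^{\mathbf{1}}\mathcal{P}\end{pmatrix}\subseteq\mathbb{M}_{n''+n}(K), \] where $R''$ is the set of diagonal $n''\times n''$-matrices with $n''=|\min(\mathcal{P})|$, and $Z_{\mathcal{P}}=\{M\in\mathbb{M}_{n'\times n''}(K)\mid M_{ji}\neq0\text{ implies }i\preceq j+n''\text{ in }\mathcal{P}\}$ with $n'=|\mathcal{P}-\min(\mathcal{P})|$.
   Context: $K$ is an arbitrary field. $\mathcal{P}=(\{1,\ldots,n\},\preceq)$, $n\geq1$, is a finite poset such that $i\preceq j$ implies $i\leq j$, and the elements are numbered so that the minimal elements of $\mathcal{P}$ are $1,\ldots,n''$. The lower left block of $\mathcal{L}'$ consists of $n\times n''$ matrices whose first $n''$ rows lie in $R''$ and whose last $n'$ rows lie in $Z_{\mathcal{P}}$. $K\mathcal{P}=\{M\in\mathbb{M}_n(K)\mid M_{ji}\neq0\text{ implies }i\preceq j\}$ is the incidence algebra; with $\mathbf{1}=[1,\ldots,1]^{\mathrm{tr}}\in K^n$, $K^{\mathbf{1}}\mathcal{P}=\{M\in K\mathcal{P}\mid M\mathbf{1}\in K\mathbf{1}\}$. The bocs $(A,U)$ associated to $\mathcal{P}$: let $T=KQ$ be the path algebra (arrows composed from right to left)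 of the quiver $Q$ with vertices $0,1,\ldots,n$, arrows $\alpha_i:i\to 0$ for $i\in\mathcal{P}$ and arrows $v_{ij}:j\to i$ for each $i\prec j$; $e_0,\ldots,e_n$ are the trivial paths. Grade $T$ by $|e_i|=|\alpha_i|=0$, $|v_{ij}|=1$. Let $A:=T_0$ (with basis $e_0,\ldots,e_n,\alpha_1,\ldots,\alpha_n$) and $V:=T_1$ (with basis $v_{ij},\alpha_iv_{ij}$, $i\prec j$); then $T_2\cong V\otimes_AV$. Let $\delta:T\to T$ be the degree one linear map with $\delta(ab)=\delta(a)b+(-1)^{|a|}a\delta(b)$ for homogeneous $a,b$, determined by $\delta(e_i)=0$, $\delta(\alpha_i)=-\sum_{h\prec i}\alpha_hv_{hi}$, $\delta(v_{ij})=\sum_{i\prec k\prec j}v_{ik}v_{kj}$. Put $U:=\omega A\oplus V$, an $A$-$A$-bimodule via $a(\omega b+v)=\omega ab+\delta(a)b+av$ and $(\omega b+v)a=\omega ba+va$, with counit $\epsilon(\omega b+v)=b$ and comultiplication $\mu(\omega b+v)=\omega\otimes\omega b+\delta(v)+\omega\otimes v+v\otimes\omega$. The left Burt-Butler algebra $\mathcal{L}$ is $\mathrm{Hom}_A(U_A,A_A)$ with product $(\psi\varphi)(u)=\sum_t\psi(\varphi(u^1_t)u^2_t)$ where $\mu(u)=\sum_tu^1_t\otimes u^2_t$, and identity $\epsilon$. *)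

theory Defs
  imports
    "Jordan_Normal_Form.Matrix"
    "HOL-Library.Poly_Mapping"
    "HOL-Library.FuncSet"
begin

section \<open>Algebras over a field and their left modules\<close>

text \<open>
  The field is a type \<open>'k\<close> of class \<open>field\<close>. A (not necessarily commutative) \<open>'k\<close>-algebra is
  carried by the record type \<open>module\<close> of \<open>HOL-Algebra\<close>, whose locale \<open>algebra\<close> only covers
  commutative algebras.
\<close>

locale k_algebra = ring B for B :: "('k::field, 'b) module" (structure) +
  assumes smult_closed: "x \<in> carrier B \<Longrightarrow> c \<odot> x \<in> carrier B"
    and smult_add_scalar: "x \<in> carrier B \<Longrightarrow> (c + d) \<odot> x = c \<odot> x \<oplus> d \<odot> x"
    and smult_add: "x \<in> carrier B \<Longrightarrow> y \<in> carrier B \<Longrightarrow> c \<odot> (x \<oplus> y) = c \<odot> x \<oplus> c \<odot> y"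
    and smult_smult: "x \<in> carrier B \<Longrightarrow> (c * d) \<odot> x = c \<odot> (d \<odot> x)"
    and smult_one: "x \<in> carrier B \<Longrightarrow> 1 \<odot> x = x"
    and smult_mult_left: "x \<in> carrier B \<Longrightarrow> y \<in> carrier B \<Longrightarrow> c \<odot> (x \<otimes> y) = (c \<odot> x) \<otimes> y"
    and smult_mult_right: "x \<in> carrier B \<Longrightarrow> y \<in> carrier B \<Longrightarrow> c \<odot> (x \<otimes> y) = x \<otimes> (c \<odot> y)"

text \<open>
  Unital left modules. As in \<open>HOL-Algebra\<close>, the fields \<open>mult\<close> and \<open>one\<close> of the record \<open>M\<close> are
  not used.
\<close>

locale left_module = B?: ring B + M?: abelian_group M
  for B :: "('k, 'b) module" and M :: "('b, 'm) module" +
  assumes act_closed: "a \<in> carrier B \<Longrightarrow> x \<in> carrier M \<Longrightarrow> a \<odot>\<^bsub>M\<^esub> x \<in> carrier M"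
    and act_add_scalar: "a \<in> carrier B \<Longrightarrow> b \<in> carrier B \<Longrightarrow> x \<in> carrier M \<Longrightarrow>
          (a \<oplus>\<^bsub>B\<^esub> b) \<odot>\<^bsub>M\<^esub> x = a \<odot>\<^bsub>M\<^esub> x \<oplus>\<^bsub>M\<^esub> b \<odot>\<^bsub>M\<^esub> x"
    and act_add: "a \<in> carrier B \<Longrightarrow> x \<in> carrier M \<Longrightarrow> y \<in> carrier M \<Longrightarrow>
          a \<odot>\<^bsub>M\<^esub> (x \<oplus>\<^bsub>M\<^esub> y) = a \<odot>\<^bsub>M\<^esub> x \<oplus>\<^bsub>M\<^esub> a \<odot>\<^bsub>M\<^esub> y"
    and act_mult: "a \<in> carrier B \<Longrightarrow> b \<in> carrier B \<Longrightarrow> x \<in> carrier M \<Longrightarrow>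
          (a \<otimes>\<^bsub>B\<^esub> b) \<odot>\<^bsub>M\<^esub> x = a \<odot>\<^bsub>M\<^esub> (b \<odot>\<^bsub>M\<^esub> x)"
    and act_one: "x \<in> carrier M \<Longrightarrow> \<one>\<^bsub>B\<^esub> \<odot>\<^bsub>M\<^esub> x = x"

definition mod_hom ::
  "('k, 'b) module \<Rightarrow> ('b, 'm) module \<Rightarrow> ('b, 'n) module \<Rightarrow> ('m \<Rightarrow> 'n) set" where
  "mod_hom B M N = {f \<in> carrier M \<rightarrow>\<^sub>E carrier N.
     (\<forall>x\<in>carrier M. \<forall>y\<in>carrier M. f (x \<oplus>\<^bsub>M\<^esub> y) = f x \<oplus>\<^bsub>N\<^esub> f y) \<and>
     (\<forall>a\<in>carrier B. \<forall>x\<in>carrier M. f (a \<odot>\<^bsub>M\<^esub> x) = a \<odot>\<^bsub>N\<^esub> f x)}"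

definition mod_iso ::
  "('k, 'b) module \<Rightarrow> ('b, 'm) module \<Rightarrow> ('b, 'n) module \<Rightarrow> ('m \<Rightarrow> 'n) set" where
  "mod_iso B M N = {f \<in> mod_hom B M N. bij_betw f (carrier M) (carrier N)}"


section \<open>Morita equivalence\<close>

text \<open>
  The category of left \<open>B\<close>-modules whose underlying sets are subsets of the type \<open>'m\<close>: objects are
  the records \<open>M\<close> with \<open>left_module B M\<close>, morphisms the extensional maps in \<open>mod_hom B M N\<close>.
  Homomorphisms form a \<open>'k\<close>-vector space, with \<open>'k\<close> acting through \<open>c \<odot> \<one>\<close>.
\<close>

definition k_linear_functor ::
  "('k::field, 'b) module \<Rightarrow> ('k, 'c) module \<Rightarrow> (('b, 'm) module \<Rightarrow> ('c, 'm) module) \<Rightarrow>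
   (('b, 'm) module \<Rightarrow> ('b, 'm) module \<Rightarrow> ('m \<Rightarrow> 'm) \<Rightarrow> ('m \<Rightarrow> 'm)) \<Rightarrow> bool" where
  "k_linear_functor B C F\<^sub>o F\<^sub>m \<longleftrightarrow>
     (\<forall>M. left_module B M \<longrightarrow> left_module C (F\<^sub>o M)) \<and>
     (\<forall>M N. left_module B M \<longrightarrow> left_module B N \<longrightarrow>
        (\<forall>f\<in>mod_hom B M N. F\<^sub>m M N f \<in> mod_hom C (F\<^sub>o M) (F\<^sub>o N))) \<and>
     (\<forall>M. left_module B M \<longrightarrow>
        F\<^sub>m M M (\<lambda>x\<in>carrier M. x) = (\<lambda>x\<in>carrier (F\<^sub>o M). x)) \<and>
     (\<forall>L M N. left_module B L \<longrightarrow> left_module B M \<longrightarrow> left_module B N \<longrightarrow>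
        (\<forall>f\<in>mod_hom B L M. \<forall>g\<in>mod_hom B M N.
           F\<^sub>m L N (compose (carrier L) g f) =
           compose (carrier (F\<^sub>o L)) (F\<^sub>m M N g) (F\<^sub>m L M f))) \<and>
     (\<forall>M N. left_module B M \<longrightarrow> left_module B N \<longrightarrow>
        (\<forall>f\<in>mod_hom B M N. \<forall>g\<in>mod_hom B M N.
           F\<^sub>m M N (\<lambda>x\<in>carrier M. f x \<oplus>\<^bsub>N\<^esub> g x) =
           (\<lambda>x\<in>carrier (F\<^sub>o M). F\<^sub>m M N f x \<oplus>\<^bsub>F\<^sub>o N\<^esub> F\<^sub>m M N g x))) \<and>
     (\<forall>M N. left_module B M \<longrightarrow> left_module B N \<longrightarrow>
        (\<forall>c. \<forall>f\<in>mod_hom B M N.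
           F\<^sub>m M N (\<lambda>x\<in>carrier M. (c \<odot>\<^bsub>B\<^esub> \<one>\<^bsub>B\<^esub>) \<odot>\<^bsub>N\<^esub> f x) =
           (\<lambda>x\<in>carrier (F\<^sub>o M). (c \<odot>\<^bsub>C\<^esub> \<one>\<^bsub>C\<^esub>) \<odot>\<^bsub>F\<^sub>o N\<^esub> F\<^sub>m M N f x)))"

text \<open>\<open>\<eta>\<close> is a natural isomorphism from the identity of the category of \<open>B\<close>-modules to \<open>(H\<^sub>o, H\<^sub>m)\<close>.\<close>

definition natural_iso_from_id ::
  "('k, 'b) module \<Rightarrow> (('b, 'm) module \<Rightarrow> ('b, 'm) module) \<Rightarrow>
   (('b, 'm) module \<Rightarrow> ('b, 'm) module \<Rightarrow> ('m \<Rightarrow> 'm) \<Rightarrow> ('m \<Rightarrow> 'm)) \<Rightarrow>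
   (('b, 'm) module \<Rightarrow> 'm \<Rightarrow> 'm) \<Rightarrow> bool" where
  "natural_iso_from_id B H\<^sub>o H\<^sub>m \<eta> \<longleftrightarrow>
     (\<forall>M. left_module B M \<longrightarrow> \<eta> M \<in> mod_iso B M (H\<^sub>o M)) \<and>
     (\<forall>M N. left_module B M \<longrightarrow> left_module B N \<longrightarrow>
        (\<forall>f\<in>mod_hom B M N.
           compose (carrier M) (\<eta> N) f = compose (carrier M) (H\<^sub>m M N f) (\<eta> M)))"

text \<open>
  HOL has no type of all sets, so the category of all modules is replaced by the categories of
  modules with carriers in a type \<open>'m\<close>. For small \<open>'m\<close> (finite, or of smaller cardinality than
  the algebra) the condition can degenerate, so it has to be imposed for every infinite \<open>'m\<close>; a
  statement has to leave \<open>'m\<close> as a type variable.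
\<close>

definition morita_equivalent ::
  "'m itself \<Rightarrow> ('k::field, 'b) module \<Rightarrow> ('k, 'c) module \<Rightarrow> bool" where
  "morita_equivalent (_ :: 'm itself) B C \<longleftrightarrow>
     k_algebra B \<and> k_algebra C \<and>
     (\<exists>(F\<^sub>o :: ('b, 'm) module \<Rightarrow> ('c, 'm) module) F\<^sub>m
       (G\<^sub>o :: ('c, 'm) module \<Rightarrow> ('b, 'm) module) G\<^sub>m \<eta> \<theta>.
        k_linear_functor B C F\<^sub>o F\<^sub>m \<and> k_linear_functor C B G\<^sub>o G\<^sub>m \<and>
        natural_iso_from_id B (\<lambda>M. G\<^sub>o (F\<^sub>o M)) (\<lambda>M N f. G\<^sub>m (F\<^sub>o M) (F\<^sub>o N) (F\<^sub>m M N f)) \<eta> \<and>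
        natural_iso_from_id C (\<lambda>M. F\<^sub>o (G\<^sub>o M)) (\<lambda>M N f. F\<^sub>m (G\<^sub>o M) (G\<^sub>o N) (G\<^sub>m M N f)) \<theta>)"


section \<open>Basic algebras\<close>

definition idempotent :: "('k, 'b) module \<Rightarrow> 'b \<Rightarrow> bool" where
  "idempotent B e \<longleftrightarrow> e \<in> carrier B \<and> e \<otimes>\<^bsub>B\<^esub> e = e"

definition orthogonal :: "('k, 'b) module \<Rightarrow> 'b \<Rightarrow> 'b \<Rightarrow> bool" where
  "orthogonal B e f \<longleftrightarrow> e \<otimes>\<^bsub>B\<^esub> f = \<zero>\<^bsub>B\<^esub> \<and> f \<otimes>\<^bsub>B\<^esub> e = \<zero>\<^bsub>B\<^esub>"

definition primitive_idempotent :: "('k, 'b) module \<Rightarrow> 'b \<Rightarrow> bool" where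
  "primitive_idempotent B e \<longleftrightarrow> idempotent B e \<and> e \<noteq> \<zero>\<^bsub>B\<^esub> \<and>
     \<not> (\<exists>f g. idempotent B f \<and> idempotent B g \<and> f \<noteq> \<zero>\<^bsub>B\<^esub> \<and> g \<noteq> \<zero>\<^bsub>B\<^esub> \<and>
          orthogonal B f g \<and> e = f \<oplus>\<^bsub>B\<^esub> g)"

text \<open>The left ideal \<open>B e\<close> as a left \<open>B\<close>-module.\<close>

definition left_ideal_module :: "('k, 'b) module \<Rightarrow> 'b \<Rightarrow> ('b, 'b) module" where
  "left_ideal_module B e =
     \<lparr>carrier = (\<lambda>x. x \<otimes>\<^bsub>B\<^esub> e) ` carrier B, mult = mult B, one = one B,
      zero = zero B, add = add B, smult = mult B\<rparr>"

definition basic_algebra :: "('k::field, 'b) module \<Rightarrow> bool" where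
  "basic_algebra B \<longleftrightarrow> k_algebra B \<and>
     (\<exists>E. finite E \<and>
        (\<forall>e\<in>E. primitive_idempotent B e) \<and>
        (\<forall>e\<in>E. \<forall>f\<in>E. e \<noteq> f \<longrightarrow> orthogonal B e f) \<and>
        finsum B (\<lambda>e. e) E = \<one>\<^bsub>B\<^esub> \<and>
        (\<forall>e\<in>E. \<forall>f\<in>E. e \<noteq> f \<longrightarrow>
           mod_iso B (left_ideal_module B e) (left_ideal_module B f) = {}))"


section \<open>The path algebra of the quiver of a poset\<close>

text \<open>
  The poset is a relation \<open>r\<close> on \<open>{1..n}\<close>, with \<open>(i, j) \<in> r\<close> for \<open>i \<preceq> j\<close>. The arrow \<open>Alpha i\<close> goes
  from \<open>i\<close> to \<open>0\<close>, the arrow \<open>Vee i j\<close> goes from \<open>j\<close> to \<open>i\<close>.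
\<close>

definition strictly_below :: "nat rel \<Rightarrow> nat \<Rightarrow> nat \<Rightarrow> bool" where
  "strictly_below r i j \<longleftrightarrow> (i, j) \<in> r \<and> i \<noteq> j"

datatype arrow = Alpha nat | Vee nat nat

fun arrow_source :: "arrow \<Rightarrow> nat" where
  "arrow_source (Alpha i) = i"
| "arrow_source (Vee i j) = j"

fun arrow_target :: "arrow \<Rightarrow> nat" where
  "arrow_target (Alpha i) = 0"
| "arrow_target (Vee i j) = i"

fun arrow_degree :: "arrow \<Rightarrow> nat" where
  "arrow_degree (Alpha i) = 0"
| "arrow_degree (Vee i j) = 1"

fun is_arrow :: "nat \<Rightarrow> nat rel \<Rightarrow> arrow \<Rightarrow> bool" where
  "is_arrow n r (Alpha i) \<longleftrightarrow> i \<in> {1..n}"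
| "is_arrow n r (Vee i j) \<longleftrightarrow> i \<in> {1..n} \<and> j \<in> {1..n} \<and> strictly_below r i j"

text \<open>
  A path is a pair of its arrows, the one traversed last standing first, and its starting vertex;
  \<open>([], i)\<close> is the trivial path \<open>e\<^sub>i\<close>.
\<close>

type_synonym path = "arrow list \<times> nat"

fun path_target :: "path \<Rightarrow> nat" where
  "path_target ([], s) = s"
| "path_target (a # as, s) = arrow_target a"

fun is_path :: "nat \<Rightarrow> nat rel \<Rightarrow> path \<Rightarrow> bool" where
  "is_path n r ([], s) \<longleftrightarrow> s \<in> {0..n}"
| "is_path n r (a # as, s) \<longleftrightarrow>
     is_arrow n r a \<and> arrow_source a = path_target (as, s) \<and> is_path n r (as, s)"

definition path_degree :: "path \<Rightarrow> nat" where
  "path_degree p = sum_list (map arrow_degree (fst p))"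

text \<open>Elements of the path algebra are finitely supported functions from paths to \<open>'k\<close>.\<close>

type_synonym 'k path_alg = "path \<Rightarrow>\<^sub>0 'k"

definition scale :: "'k::field \<Rightarrow> 'k path_alg \<Rightarrow> 'k path_alg" where
  "scale c x = Poly_Mapping.map (\<lambda>a. c * a) x"

definition path_mult :: "'k::field path_alg \<Rightarrow> 'k path_alg \<Rightarrow> 'k path_alg" (infixl \<open>\<cdot>\<^sub>T\<close> 70) where
  "x \<cdot>\<^sub>T y = (\<Sum>p\<in>Poly_Mapping.keys x. \<Sum>q\<in>Poly_Mapping.keys y.
     if snd p = path_target q
     then Poly_Mapping.single (fst p @ fst q, snd q)
            (Poly_Mapping.lookup x p * Poly_Mapping.lookup y q)
     else 0)"

definition path_one :: "nat \<Rightarrow> 'k::field path_alg" where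
  "path_one n = (\<Sum>i=0..n. Poly_Mapping.single ([], i) 1)"

definition T_deg :: "nat \<Rightarrow> nat rel \<Rightarrow> nat \<Rightarrow> 'k::field path_alg set" where
  "T_deg n r d = {x. \<forall>p\<in>Poly_Mapping.keys x. is_path n r p \<and> path_degree p = d}"

abbreviation A_alg :: "nat \<Rightarrow> nat rel \<Rightarrow> 'k::field path_alg set" where
  "A_alg n r \<equiv> T_deg n r 0"

abbreviation V_bimod :: "nat \<Rightarrow> nat rel \<Rightarrow> 'k::field path_alg set" where
  "V_bimod n r \<equiv> T_deg n r 1"

text \<open>
  The differential: prescribed on arrows, extended to paths by the graded Leibniz rule and then
  linearly.
\<close>

fun delta_arrow :: "nat \<Rightarrow> nat rel \<Rightarrow> arrow \<Rightarrow> 'k::field path_alg" where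
  "delta_arrow n r (Alpha i) =
     - (\<Sum>h | h \<in> {1..n} \<and> strictly_below r h i.
          Poly_Mapping.single ([Alpha h, Vee h i], i) 1)"
| "delta_arrow n r (Vee i j) =
     (\<Sum>k | k \<in> {1..n} \<and> strictly_below r i k \<and> strictly_below r k j.
          Poly_Mapping.single ([Vee i k, Vee k j], j) 1)"

fun delta_path :: "nat \<Rightarrow> nat rel \<Rightarrow> path \<Rightarrow> 'k::field path_alg" where
  "delta_path n r ([], s) = 0"
| "delta_path n r (a # as, s) =
     delta_arrow n r a \<cdot>\<^sub>T Poly_Mapping.single (as, s) 1 +
     scale ((- 1) ^ arrow_degree a)
       (Poly_Mapping.single ([a], arrow_source a) 1 \<cdot>\<^sub>T delta_path n r (as, s))"

definition delta :: "nat \<Rightarrow> nat rel \<Rightarrow> 'k::field path_alg \<Rightarrow> 'k path_alg" where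
  "delta n r x =
     (\<Sum>p\<in>Poly_Mapping.keys x. scale (Poly_Mapping.lookup x p) (delta_path n r p))"


section \<open>The bocs and its left Burt-Butler algebra\<close>

text \<open>The pair \<open>(b, v)\<close> stands for \<open>\<omega>b + v\<close>.\<close>

type_synonym 'k bocs_elem = "'k path_alg \<times> 'k path_alg"

definition U_bimod :: "nat \<Rightarrow> nat rel \<Rightarrow> 'k::field bocs_elem set" where
  "U_bimod n r = A_alg n r \<times> V_bimod n r"

definition omega :: "nat \<Rightarrow> 'k::field bocs_elem" where
  "omega n = (path_one n, 0)"

fun U_add :: "'k::field bocs_elem \<Rightarrow> 'k bocs_elem \<Rightarrow> 'k bocs_elem" where
  "U_add (b, v) (b', v') = (b + b', v + v')"

fun U_left :: "nat \<Rightarrow> nat rel \<Rightarrow> 'k::field path_alg \<Rightarrow> 'k bocs_elem \<Rightarrow> 'k bocs_elem" where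
  "U_left n r a (b, v) = (a \<cdot>\<^sub>T b, delta n r a \<cdot>\<^sub>T b + a \<cdot>\<^sub>T v)"

fun U_right :: "'k::field bocs_elem \<Rightarrow> 'k path_alg \<Rightarrow> 'k bocs_elem" where
  "U_right (b, v) a = (b \<cdot>\<^sub>T a, v \<cdot>\<^sub>T a)"

text \<open>
  \<open>U \<otimes>\<^sub>A U\<close> by generators and relations: the list \<open>[(u\<^sub>1, w\<^sub>1), \<dots>, (u\<^sub>m, w\<^sub>m)]\<close> stands for
  \<open>u\<^sub>1 \<otimes> w\<^sub>1 + \<dots> + u\<^sub>m \<otimes> w\<^sub>m\<close>, and \<open>tensor_eq\<close> is equality in \<open>U \<otimes>\<^sub>A U\<close>.
\<close>

inductive tensor_eq ::
  "nat \<Rightarrow> nat rel \<Rightarrow> ('k::field bocs_elem \<times> 'k bocs_elem) list \<Rightarrow>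
   ('k bocs_elem \<times> 'k bocs_elem) list \<Rightarrow> bool" for n r where
  refl: "set ts \<subseteq> U_bimod n r \<times> U_bimod n r \<Longrightarrow> tensor_eq n r ts ts"
| sym: "tensor_eq n r ts us \<Longrightarrow> tensor_eq n r us ts"
| trans: "tensor_eq n r ts us \<Longrightarrow> tensor_eq n r us ws \<Longrightarrow> tensor_eq n r ts ws"
| append: "tensor_eq n r ts ts' \<Longrightarrow> tensor_eq n r us us' \<Longrightarrow> tensor_eq n r (ts @ us) (ts' @ us')"
| commute: "set ts \<subseteq> U_bimod n r \<times> U_bimod n r \<Longrightarrow> set us \<subseteq> U_bimod n r \<times> U_bimod n r \<Longrightarrow>
    tensor_eq n r (ts @ us) (us @ ts)"
| add_left: "u \<in> U_bimod n r \<Longrightarrow> u' \<in> U_bimod n r \<Longrightarrow> w \<in> U_bimod n r \<Longrightarrow>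
    tensor_eq n r [(U_add u u', w)] [(u, w), (u', w)]"
| add_right: "u \<in> U_bimod n r \<Longrightarrow> w \<in> U_bimod n r \<Longrightarrow> w' \<in> U_bimod n r \<Longrightarrow>
    tensor_eq n r [(u, U_add w w')] [(u, w), (u, w')]"
| zero_left: "w \<in> U_bimod n r \<Longrightarrow> tensor_eq n r [((0, 0), w)] []"
| zero_right: "u \<in> U_bimod n r \<Longrightarrow> tensor_eq n r [(u, (0, 0))] []"
| balanced: "u \<in> U_bimod n r \<Longrightarrow> a \<in> A_alg n r \<Longrightarrow> w \<in> U_bimod n r \<Longrightarrow>
    tensor_eq n r [(U_right u a, w)] [(u, U_left n r a w)]"

text \<open>
  \<open>\<mu>(u)\<close> as the set of all its representatives. The summand \<open>\<delta>(v)\<close> lies in degree \<open>2\<close>, which is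
  identified with \<open>V \<otimes>\<^sub>A V\<close> by multiplication; \<open>ds\<close> is a preimage of \<open>\<delta>(v)\<close> in \<open>V \<otimes>\<^sub>A V\<close>.
\<close>

fun comult ::
  "nat \<Rightarrow> nat rel \<Rightarrow> 'k::field bocs_elem \<Rightarrow> ('k bocs_elem \<times> 'k bocs_elem) list set" where
  "comult n r (b, v) = {ts. \<exists>ds.
     set ds \<subseteq> V_bimod n r \<times> V_bimod n r \<and>
     (\<Sum>(x, y)\<leftarrow>ds. x \<cdot>\<^sub>T y) = delta n r v \<and>
     tensor_eq n r ts
       ([(omega n, (b, 0))] @ map (\<lambda>(x, y). ((0, x), (0, y))) ds @
        [(omega n, (0, v)), ((0, v), omega n)])}"

definition burt_butler_carrier ::
  "nat \<Rightarrow> nat rel \<Rightarrow> ('k::field bocs_elem \<Rightarrow> 'k path_alg) set" where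
  "burt_butler_carrier n r = {\<phi> \<in> U_bimod n r \<rightarrow>\<^sub>E A_alg n r.
     (\<forall>u\<in>U_bimod n r. \<forall>w\<in>U_bimod n r. \<phi> (U_add u w) = \<phi> u + \<phi> w) \<and>
     (\<forall>u\<in>U_bimod n r. \<forall>a\<in>A_alg n r. \<phi> (U_right u a) = \<phi> u \<cdot>\<^sub>T a)}"

text \<open>
  The value of the product does not depend on the chosen representative \<open>\<Sum>\<^sub>t u\<^sup>1\<^sub>t \<otimes> u\<^sup>2\<^sub>t\<close> of \<open>\<mu>(u)\<close>,
  as \<open>u\<^sup>1 \<otimes> u\<^sup>2 \<mapsto> \<psi>(\<phi>(u\<^sup>1) u\<^sup>2)\<close> is balanced.
\<close>

definition burt_butler_mult ::
  "nat \<Rightarrow> nat rel \<Rightarrow> ('k::field bocs_elem \<Rightarrow> 'k path_alg) \<Rightarrow> ('k bocs_elem \<Rightarrow> 'k path_alg) \<Rightarrow>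
   ('k bocs_elem \<Rightarrow> 'k path_alg)" where
  "burt_butler_mult n r \<psi> \<phi> = (\<lambda>u\<in>U_bimod n r.
     \<Sum>(u1, u2)\<leftarrow>(SOME ts. ts \<in> comult n r u). \<psi> (U_left n r (\<phi> u1) u2))"

definition burt_butler_algebra ::
  "nat \<Rightarrow> nat rel \<Rightarrow> ('k::field, 'k bocs_elem \<Rightarrow> 'k path_alg) module" where
  "burt_butler_algebra n r =
     \<lparr>carrier = burt_butler_carrier n r,
      mult = burt_butler_mult n r,
      one = (\<lambda>u\<in>U_bimod n r. fst u),
      zero = (\<lambda>u\<in>U_bimod n r. 0),
      add = (\<lambda>\<phi> \<psi>. \<lambda>u\<in>U_bimod n r. \<phi> u + \<psi> u),
      smult = (\<lambda>c \<phi>. \<lambda>u\<in>U_bimod n r. scale c (\<phi> u))\<rparr>"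


section \<open>The matrix algebra\<close>

text \<open>Matrices are indexed from \<open>0\<close>: the entry \<open>M\<^sub>j\<^sub>i\<close> of the usual indexing is \<open>M $$ (j - 1, i - 1)\<close>.\<close>

definition min_elems :: "nat \<Rightarrow> nat rel \<Rightarrow> nat set" where
  "min_elems n r = {j \<in> {1..n}. \<not> (\<exists>i\<in>{1..n}. strictly_below r i j)}"

definition num_min :: "nat \<Rightarrow> nat rel \<Rightarrow> nat" where
  "num_min n r = card (min_elems n r)"

definition num_nonmin :: "nat \<Rightarrow> nat rel \<Rightarrow> nat" where
  "num_nonmin n r = card ({1..n} - min_elems n r)"

definition incidence_algebra :: "nat \<Rightarrow> nat rel \<Rightarrow> 'k::field mat set" where
  "incidence_algebra n r = {M \<in> carrier_mat n n.
     \<forall>j\<in>{1..n}. \<forall>i\<in>{1..n}. M $$ (j - 1, i - 1) \<noteq> 0 \<longrightarrow> (i, j) \<in> r}"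

definition all_ones :: "nat \<Rightarrow> 'k::field vec" where
  "all_ones n = vec n (\<lambda>_. 1)"

definition incidence_algebra_ones :: "nat \<Rightarrow> nat rel \<Rightarrow> 'k::field mat set" where
  "incidence_algebra_ones n r =
     {M \<in> incidence_algebra n r. \<exists>c. M *\<^sub>v all_ones n = c \<cdot>\<^sub>v all_ones n}"

definition diagonal_mats :: "nat \<Rightarrow> 'k::field mat set" where
  "diagonal_mats m = {M \<in> carrier_mat m m. diagonal_mat M}"

definition Z_mats :: "nat \<Rightarrow> nat rel \<Rightarrow> 'k::field mat set" where
  "Z_mats n r = {M \<in> carrier_mat (num_nonmin n r) (num_min n r).
     \<forall>j\<in>{1..num_nonmin n r}. \<forall>i\<in>{1..num_min n r}.
       M $$ (j - 1, i - 1) \<noteq> 0 \<longrightarrow> (i, j + num_min n r) \<in> r}"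

definition L'_mats :: "nat \<Rightarrow> nat rel \<Rightarrow> 'k::field mat set" where
  "L'_mats n r =
     {four_block_mat D (0\<^sub>m (num_min n r) n) (D' @\<^sub>r Z) M | D D' Z M.
        D \<in> diagonal_mats (num_min n r) \<and> D' \<in> diagonal_mats (num_min n r) \<and>
        Z \<in> Z_mats n r \<and> M \<in> incidence_algebra_ones n r}"

definition L'_algebra :: "nat \<Rightarrow> nat rel \<Rightarrow> ('k::field, 'k mat) module" where
  "L'_algebra n r =
     \<lparr>carrier = L'_mats n r, mult = (*), one = 1\<^sub>m (num_min n r + n),
      zero = 0\<^sub>m (num_min n r + n) (num_min n r + n), add = (+), smult = (\<cdot>\<^sub>m)\<rparr>"

end

theory Submission
  imports Defs
begin

text \<open>
  The left Burt-Butler algebra \<open>L\<close> is the endomorphism algebra of \<open>A\<close> in the Kleisli category of the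
  bocs. As a right \<open>A\<close>-module, \<open>U\<close> is \<open>\<omega> A \<oplus> V\<close>, so \<open>\<phi> \<in> L\<close> is given by \<open>\<phi> (\<omega>) \<in> A\<close> and by the values
  \<open>\<phi> (v\<^sub>i\<^sub>j), \<phi> (\<alpha>\<^sub>i v\<^sub>i\<^sub>j) \<in> A e\<^sub>j = K e\<^sub>j + K \<alpha>\<^sub>j\<close>. Arranged in a matrix of size \<open>n + n\<close>, the coordinates of
  these values form two by two blocks of incidence matrices, and the product of \<open>L\<close> becomes the
  product of matrices (\<open>bb_mat_mult\<close>). The image consists of all such matrices for which
  \<open>(0, \<dots>, 0, 1, \<dots>, 1)\<close> is an eigenvector: the eigenvalue is the coefficient of \<open>\<phi> (\<omega>)\<close> at \<open>e\<^sub>0\<close>, and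
  the diagonal of the right half, which carries no value of \<open>\<phi>\<close>, is determined by the row sums
  (\<open>alg_iso_bb_mat\<close>). Conceptually, these are the endomorphisms of \<open>P\<^sub>1 \<oplus> \<dots> \<oplus> P\<^sub>n \<oplus> P\<^sub>0\<close> in the
  category of linear maps from vector spaces to projective modules over the incidence algebra, where
  \<open>P\<^sub>i\<close> is \<open>0 \<rightarrow> K\<P> e\<^sub>i\<close> and \<open>P\<^sub>0\<close> is \<open>K \<rightarrow> K\<P>\<close>, \<open>1 \<mapsto> \<one>\<close>.

  The matrix algebra \<open>L'\<close> is the endomorphism algebra of \<open>P\<^sub>1 \<oplus> \<dots> \<oplus> P\<^bsub>n''\<^esub> \<oplus> P\<^sub>0\<close>, with only the
  minimal elements in the first block (\<open>L'_algebra_eq\<close>). For nonminimal \<open>j\<close> and a minimal element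
  \<open>m\<close> below \<open>j\<close>, the matrix units \<open>E\<^sub>j\<^sub>j - E\<^sub>j\<^sub>m\<close> have row sums \<open>0\<close> and exhibit \<open>P\<^sub>j\<close> as a direct
  summand of \<open>P\<^sub>0\<close>. Hence \<open>L'\<close> is a full corner of the algebra of all these matrices
  (\<open>full_corner_rep_alg\<close>), and a full corner is Morita equivalent to the algebra
  (\<open>morita_equivalent_corner\<close>), by \<open>M \<mapsto> e M\<close> and an explicit inverse.

  The matrices in \<open>L'\<close> are lower triangular, so diagonal entries are characters, and an idempotent
  with zero diagonal vanishes. The diagonal entries of the lower right block at the minimal elements
  coincide, as they all equal the eigenvalue. Therefore the matrix units of the first block, the
  \<open>E\<^sub>j\<^sub>j - E\<^sub>j\<^sub>m\<close> and the complement of their sum are primitive orthogonal idempotents, and they are told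
  apart by the characters (\<open>basic_rep_alg\<close>).
\<close>

section \<open>Morita equivalence of an algebra with a full corner\<close>

lemma mod_homD:
  assumes "f \<in> mod_hom B M N"
  shows "x \<in> carrier M \<Longrightarrow> f x \<in> carrier N"
    "x \<in> carrier M \<Longrightarrow> y \<in> carrier M \<Longrightarrow> f (x \<oplus>\<^bsub>M\<^esub> y) = f x \<oplus>\<^bsub>N\<^esub> f y"
    "a \<in> carrier B \<Longrightarrow> x \<in> carrier M \<Longrightarrow> f (a \<odot>\<^bsub>M\<^esub> x) = a \<odot>\<^bsub>N\<^esub> f x"
    "f \<in> extensional (carrier M)"
  using assms unfolding mod_hom_def by (auto simp: PiE_iff)

lemma (in left_module) act_zero:
  assumes "a \<in> carrier B" shows "a \<odot>\<^bsub>M\<^esub> \<zero>\<^bsub>M\<^esub> = \<zero>\<^bsub>M\<^esub>"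
proof -
  have "a \<odot>\<^bsub>M\<^esub> \<zero>\<^bsub>M\<^esub> \<oplus>\<^bsub>M\<^esub> a \<odot>\<^bsub>M\<^esub> \<zero>\<^bsub>M\<^esub> = a \<odot>\<^bsub>M\<^esub> \<zero>\<^bsub>M\<^esub>"
    using act_add[OF assms M.zero_closed M.zero_closed] by simp
  then show ?thesis
    by (metis M.add.l_cancel_one act_closed assms M.zero_closed)
qed

lemma left_moduleI:
  assumes "ring B" "abelian_group M"
    and "\<And>a x. a \<in> carrier B \<Longrightarrow> x \<in> carrier M \<Longrightarrow> a \<odot>\<^bsub>M\<^esub> x \<in> carrier M"
    and "\<And>a b x. a \<in> carrier B \<Longrightarrow> b \<in> carrier B \<Longrightarrow> x \<in> carrier M \<Longrightarrow>
          (a \<oplus>\<^bsub>B\<^esub> b) \<odot>\<^bsub>M\<^esub> x = a \<odot>\<^bsub>M\<^esub> x \<oplus>\<^bsub>M\<^esub> b \<odot>\<^bsub>M\<^esub> x"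
    and "\<And>a x y. a \<in> carrier B \<Longrightarrow> x \<in> carrier M \<Longrightarrow> y \<in> carrier M \<Longrightarrow>
          a \<odot>\<^bsub>M\<^esub> (x \<oplus>\<^bsub>M\<^esub> y) = a \<odot>\<^bsub>M\<^esub> x \<oplus>\<^bsub>M\<^esub> a \<odot>\<^bsub>M\<^esub> y"
    and "\<And>a b x. a \<in> carrier B \<Longrightarrow> b \<in> carrier B \<Longrightarrow> x \<in> carrier M \<Longrightarrow>
          (a \<otimes>\<^bsub>B\<^esub> b) \<odot>\<^bsub>M\<^esub> x = a \<odot>\<^bsub>M\<^esub> (b \<odot>\<^bsub>M\<^esub> x)"
    and "\<And>x. x \<in> carrier M \<Longrightarrow> \<one>\<^bsub>B\<^esub> \<odot>\<^bsub>M\<^esub> x = x"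
  shows "left_module B M"
  using assms unfolding left_module_def left_module_axioms_def by blast

text \<open>
  Inducing a module from the corner needs two copies of it, while the functors of a Morita
  equivalence stay within one type of carriers; an infinite type has room for pairs of its elements.
\<close>

lemma infinite_bool_fun_inj:
  assumes "infinite (UNIV :: 'm set)"
  shows "\<exists>f :: (bool \<Rightarrow> 'm) \<Rightarrow> 'm. inj f"
proof -
  have "(card_of ((UNIV :: 'm set) \<times> (UNIV :: 'm set)), card_of (UNIV :: 'm set)) \<in> ordIso"
    by (rule card_of_Times_same_infinite) (use assms in simp)
  then obtain g :: "'m \<times> 'm \<Rightarrow> 'm" where "bij_betw g (UNIV \<times> UNIV) UNIV"
    using card_of_ordIso by blast
  then have g: "inj g" by (simp add: bij_betw_def)
  have "inj (\<lambda>y :: bool \<Rightarrow> 'm. g (y False, y True))"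
  proof (rule injI)
    fix y z :: "bool \<Rightarrow> 'm"
    assume "g (y False, y True) = g (z False, z True)"
    then have "y False = z False" "y True = z True" using g by (auto dest: injD)
    then show "y = z" by (metis (full_types) ext)
  qed
  then show ?thesis by blast
qed

text \<open>
  The map \<open>\<iota>\<close> identifies \<open>B\<close> with the corner \<open>e C e\<close>, where \<open>e = \<iota> 1\<close>. The elements
  \<open>p s \<in> C e\<close> and \<open>q s \<in> e C\<close> witness that \<open>C e C = C\<close>, and two pairs of them suffice when
  \<open>1 = e + p q\<close>, that is, when \<open>C (1 - e)\<close> is a direct summand of \<open>C e\<close>. They are what makes the
  inverse of \<open>M \<mapsto> e M\<close> explicit, without tensor products.
\<close>

locale full_corner = C?: k_algebra C + B?: k_algebra B
  for C :: "('k::field, 'c) module" (structure) and B :: "('k, 'b) module" +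
  fixes \<iota> :: "'b \<Rightarrow> 'c" and p q :: "bool \<Rightarrow> 'c"
  assumes \<iota>_add: "\<And>x y. x \<in> carrier B \<Longrightarrow> y \<in> carrier B \<Longrightarrow> \<iota> (x \<oplus>\<^bsub>B\<^esub> y) = \<iota> x \<oplus> \<iota> y"
    and \<iota>_mult: "\<And>x y. x \<in> carrier B \<Longrightarrow> y \<in> carrier B \<Longrightarrow> \<iota> (x \<otimes>\<^bsub>B\<^esub> y) = \<iota> x \<otimes> \<iota> y"
    and \<iota>_smult: "\<And>c x. x \<in> carrier B \<Longrightarrow> \<iota> (c \<odot>\<^bsub>B\<^esub> x) = c \<odot> \<iota> x"
    and \<iota>_bij: "bij_betw \<iota> (carrier B)
        {x \<in> carrier C. \<iota> \<one>\<^bsub>B\<^esub> \<otimes> x = x \<and> x \<otimes> \<iota> \<one>\<^bsub>B\<^esub> = x}"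
    and p_closed: "\<And>s. p s \<in> carrier C" and q_closed: "\<And>s. q s \<in> carrier C"
    and p_e: "\<And>s. p s \<otimes> \<iota> \<one>\<^bsub>B\<^esub> = p s" and e_q: "\<And>s. \<iota> \<one>\<^bsub>B\<^esub> \<otimes> q s = q s"
    and pq: "p False \<otimes> q False \<oplus> p True \<otimes> q True = \<one>"
begin

abbreviation "e \<equiv> \<iota> \<one>\<^bsub>B\<^esub>"

lemma \<iota>_closed: "x \<in> carrier B \<Longrightarrow> \<iota> x \<in> carrier C"
  using \<iota>_bij by (auto simp: bij_betw_def)

lemma e_\<iota>: "x \<in> carrier B \<Longrightarrow> e \<otimes> \<iota> x = \<iota> x"
  using \<iota>_bij by (auto simp: bij_betw_def)

lemma \<iota>_e: "x \<in> carrier B \<Longrightarrow> \<iota> x \<otimes> e = \<iota> x"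
  using \<iota>_bij by (auto simp: bij_betw_def)

lemma e_closed [simp]: "e \<in> carrier C"
  by (simp add: \<iota>_closed)

lemma \<iota>_inj: "x \<in> carrier B \<Longrightarrow> y \<in> carrier B \<Longrightarrow> \<iota> x = \<iota> y \<longleftrightarrow> x = y"
  using \<iota>_bij by (auto simp: bij_betw_def inj_on_def)

definition corner :: "'c \<Rightarrow> 'b" where "corner = inv_into (carrier B) \<iota>"

lemma corner_closed_\<iota>:
  assumes "x \<in> carrier C" "e \<otimes> x = x" "x \<otimes> e = x"
  shows "corner x \<in> carrier B" "\<iota> (corner x) = x"
proof -
  have "x \<in> \<iota> ` carrier B" using \<iota>_bij assms by (auto simp: bij_betw_def)
  then show "corner x \<in> carrier B" "\<iota> (corner x) = x"
    unfolding corner_def by (auto intro: inv_into_into f_inv_into_f)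
qed

text \<open>
  The matrix \<open>(\<beta> s t c)\<close> over \<open>B\<close> represents left multiplication by \<open>c\<close> on the right \<open>B\<close>-module
  \<open>C e\<close>, which is generated by \<open>p False\<close> and \<open>p True\<close>. It is multiplicative in \<open>c\<close> since
  \<open>\<Sum>\<^sub>s p s q s = 1\<close>; the matrix of \<open>1\<close> is idempotent, but not the unit matrix in general.
\<close>

definition \<beta> :: "bool \<Rightarrow> bool \<Rightarrow> 'c \<Rightarrow> 'b" where
  "\<beta> s t c = corner (q s \<otimes> c \<otimes> p t)"

lemma \<beta>:
  assumes "c \<in> carrier C"
  shows \<beta>_closed: "\<beta> s t c \<in> carrier B" and \<iota>_\<beta>: "\<iota> (\<beta> s t c) = q s \<otimes> c \<otimes> p t"
proof -
  have "e \<otimes> (q s \<otimes> c \<otimes> p t) = q s \<otimes> c \<otimes> p t"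
    using assms by (simp add: C.m_assoc[symmetric] e_q p_closed q_closed)
  moreover have "q s \<otimes> c \<otimes> p t \<otimes> e = q s \<otimes> c \<otimes> p t"
    using assms by (simp add: C.m_assoc p_e p_closed q_closed)
  ultimately show "\<beta> s t c \<in> carrier B" "\<iota> (\<beta> s t c) = q s \<otimes> c \<otimes> p t"
    unfolding \<beta>_def using assms corner_closed_\<iota> p_closed q_closed by auto
qed

lemma \<beta>_add:
  assumes "c \<in> carrier C" "d \<in> carrier C"
  shows "\<beta> s t (c \<oplus> d) = \<beta> s t c \<oplus>\<^bsub>B\<^esub> \<beta> s t d"
proof -
  have "\<iota> (\<beta> s t (c \<oplus> d)) = \<iota> (\<beta> s t c \<oplus>\<^bsub>B\<^esub> \<beta> s t d)"
    using assms by (simp add: \<beta> \<iota>_add C.l_distr C.r_distr p_closed q_closed)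
  then show ?thesis using assms \<beta>_closed by (subst (asm) \<iota>_inj) auto
qed

lemma \<beta>_smult_one:
  "\<beta> s t (c \<odot> \<one>) = (c \<odot>\<^bsub>B\<^esub> \<one>\<^bsub>B\<^esub>) \<otimes>\<^bsub>B\<^esub> \<beta> s t \<one>"
proof -
  have "\<iota> (\<beta> s t (c \<odot> \<one>)) = c \<odot> (q s \<otimes> p t)"
    using C.smult_mult_left[of "q s" "p t" c] C.smult_mult_right[of "q s" "\<one>" c]
    by (simp add: \<beta> C.smult_closed p_closed q_closed)
  also have "\<dots> = \<iota> ((c \<odot>\<^bsub>B\<^esub> \<one>\<^bsub>B\<^esub>) \<otimes>\<^bsub>B\<^esub> \<beta> s t \<one>)"
    using B.smult_mult_left[of "\<one>\<^bsub>B\<^esub>" "\<beta> s t \<one>" c, symmetric]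
    by (simp add: \<beta> \<iota>_smult C.smult_closed p_closed q_closed)
  finally show ?thesis
    by (subst (asm) \<iota>_inj) (auto simp: \<beta>_closed C.smult_closed B.smult_closed)
qed

lemma \<beta>_mult:
  assumes c: "c \<in> carrier C" and d: "d \<in> carrier C"
  shows "\<beta> s t (c \<otimes> d) =
    \<beta> s False c \<otimes>\<^bsub>B\<^esub> \<beta> False t d \<oplus>\<^bsub>B\<^esub> \<beta> s True c \<otimes>\<^bsub>B\<^esub> \<beta> True t d"
proof -
  note cl = p_closed q_closed c d
  have "c \<otimes> d = c \<otimes> (p False \<otimes> q False \<oplus> p True \<otimes> q True) \<otimes> d"
    using cl by (simp add: pq)
  also have "\<dots> = c \<otimes> p False \<otimes> q False \<otimes> d \<oplus> c \<otimes> p True \<otimes> q True \<otimes> d"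
    using cl by (simp add: C.l_distr C.r_distr C.m_assoc)
  finally have "q s \<otimes> (c \<otimes> d) \<otimes> p t =
    (q s \<otimes> c \<otimes> p False) \<otimes> (q False \<otimes> d \<otimes> p t) \<oplus>
    (q s \<otimes> c \<otimes> p True) \<otimes> (q True \<otimes> d \<otimes> p t)"
    using cl by (simp add: C.l_distr C.r_distr C.m_assoc)
  then have "\<iota> (\<beta> s t (c \<otimes> d)) =
    \<iota> (\<beta> s False c \<otimes>\<^bsub>B\<^esub> \<beta> False t d \<oplus>\<^bsub>B\<^esub> \<beta> s True c \<otimes>\<^bsub>B\<^esub> \<beta> True t d)"
    using c d by (simp add: \<beta> \<iota>_add \<iota>_mult)
  then show ?thesis using c d by (subst (asm) \<iota>_inj) (auto simp: \<beta>_closed)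
qed

text \<open>
  The induced module \<open>C e \<otimes>\<^sub>B N\<close>: an element \<open>c \<otimes> x\<close> is determined by the two elements
  \<open>(q s c) x\<close> of \<open>N\<close>, and the pairs that arise are those fixed by the idempotent matrix of \<open>1\<close>.
\<close>

definition ind_act :: "('b, 'm) module \<Rightarrow> 'c \<Rightarrow> (bool \<Rightarrow> 'm) \<Rightarrow> (bool \<Rightarrow> 'm)" where
  "ind_act N c y = (\<lambda>s. \<beta> s False c \<odot>\<^bsub>N\<^esub> y False \<oplus>\<^bsub>N\<^esub> \<beta> s True c \<odot>\<^bsub>N\<^esub> y True)"

definition ind_carrier :: "('b, 'm) module \<Rightarrow> (bool \<Rightarrow> 'm) set" where
  "ind_carrier N = {y. (\<forall>s. y s \<in> carrier N) \<and> ind_act N \<one> y = y}"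

context
  fixes N :: "('b, 'm) module"
  assumes N: "left_module B N"
begin

interpretation N: left_module B N by (rule N)

lemma ind_act_closed:
  assumes "c \<in> carrier C" "\<And>s. y s \<in> carrier N"
  shows "ind_act N c y s \<in> carrier N"
  unfolding ind_act_def using assms by (simp add: \<beta>_closed N.act_closed)

lemma ind_act_add_scalar:
  assumes "c \<in> carrier C" "d \<in> carrier C" "\<And>s. y s \<in> carrier N"
  shows "ind_act N (c \<oplus> d) y = (\<lambda>s. ind_act N c y s \<oplus>\<^bsub>N\<^esub> ind_act N d y s)"
  unfolding ind_act_def using assms
  by (intro ext) (simp add: \<beta>_closed N.act_closed \<beta>_add N.act_add_scalar N.M.a_ac)

lemma ind_act_add:
  assumes "c \<in> carrier C" "\<And>s. y s \<in> carrier N" "\<And>s. z s \<in> carrier N"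
  shows "ind_act N c (\<lambda>s. y s \<oplus>\<^bsub>N\<^esub> z s) = (\<lambda>s. ind_act N c y s \<oplus>\<^bsub>N\<^esub> ind_act N c z s)"
  unfolding ind_act_def using assms
  by (intro ext) (simp add: \<beta>_closed N.act_closed \<beta>_add N.act_add N.M.a_ac)

lemma ind_act_mult:
  assumes "c \<in> carrier C" "d \<in> carrier C" "\<And>s. y s \<in> carrier N"
  shows "ind_act N (c \<otimes> d) y = ind_act N c (ind_act N d y)"
  unfolding ind_act_def using assms
  by (intro ext) (simp add: \<beta>_closed N.act_closed \<beta>_mult N.act_add N.act_add_scalar N.act_mult
      N.M.a_ac)

lemma ind_act_zero:
  assumes "c \<in> carrier C"
  shows "ind_act N c (\<lambda>s. \<zero>\<^bsub>N\<^esub>) = (\<lambda>s. \<zero>\<^bsub>N\<^esub>)"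
  unfolding ind_act_def using assms by (intro ext) (simp add: \<beta>_closed N.act_zero)

lemma ind_carrierD:
  assumes "y \<in> ind_carrier N" shows "y s \<in> carrier N" "ind_act N \<one> y = y"
  using assms by (auto simp: ind_carrier_def)

lemma ind_act_ind_carrier:
  assumes "c \<in> carrier C" "\<And>s. y s \<in> carrier N"
  shows "ind_act N c y \<in> ind_carrier N"
  unfolding ind_carrier_def using assms
  by (auto simp: ind_act_closed ind_act_mult[symmetric])

lemma add_ind_carrier:
  assumes "y \<in> ind_carrier N" "z \<in> ind_carrier N"
  shows "(\<lambda>s. y s \<oplus>\<^bsub>N\<^esub> z s) \<in> ind_carrier N"
  unfolding ind_carrier_def using assms by (auto simp: ind_act_add ind_carrierD)

lemma zero_ind_carrier: "(\<lambda>s. \<zero>\<^bsub>N\<^esub>) \<in> ind_carrier N"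
  unfolding ind_carrier_def by (auto simp: ind_act_zero)

lemma minus_ind_carrier:
  assumes y: "y \<in> ind_carrier N"
  shows "\<exists>z\<in>ind_carrier N. (\<lambda>s. z s \<oplus>\<^bsub>N\<^esub> y s) = (\<lambda>s. \<zero>\<^bsub>N\<^esub>)"
proof (rule bexI)
  let ?n = "\<lambda>s. \<ominus>\<^bsub>N\<^esub> y s"
  let ?z = "ind_act N \<one> ?n"
  have n: "?n s \<in> carrier N" for s using ind_carrierD[OF y] by simp
  show "?z \<in> ind_carrier N" using n by (intro ind_act_ind_carrier) auto
  have "(\<lambda>s. ?z s \<oplus>\<^bsub>N\<^esub> y s) = (\<lambda>s. ?z s \<oplus>\<^bsub>N\<^esub> ind_act N \<one> y s)"
    using ind_carrierD[OF y] by simp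
  also have "\<dots> = ind_act N \<one> (\<lambda>s. ?n s \<oplus>\<^bsub>N\<^esub> y s)"
    using ind_act_add[of "\<one>" ?n y] n ind_carrierD[OF y] by auto
  also have "\<dots> = (\<lambda>s. \<zero>\<^bsub>N\<^esub>)"
    using ind_carrierD[OF y] by (simp add: N.M.l_neg ind_act_zero)
  finally show "(\<lambda>s. ?z s \<oplus>\<^bsub>N\<^esub> y s) = (\<lambda>s. \<zero>\<^bsub>N\<^esub>)" .
qed

end

lemma sum_pq_act:
  assumes "left_module C M" "m \<in> carrier M"
  shows "p False \<odot>\<^bsub>M\<^esub> (q False \<odot>\<^bsub>M\<^esub> m) \<oplus>\<^bsub>M\<^esub> p True \<odot>\<^bsub>M\<^esub> (q True \<odot>\<^bsub>M\<^esub> m) = m"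
proof -
  interpret M: left_module C M by (rule assms)
  show ?thesis
    using assms(2) M.act_add_scalar[of "p False \<otimes> q False" "p True \<otimes> q True" m]
    by (simp add: p_closed q_closed M.act_mult pq M.act_one)
qed

text \<open>
  The injection \<open>enc\<close> of pairs moves the induced module into the type of the elements of \<open>N\<close>.
\<close>

definition ind_module :: "((bool \<Rightarrow> 'm) \<Rightarrow> 'm) \<Rightarrow> ('b, 'm) module \<Rightarrow> ('c, 'm) module" where
  "ind_module enc N =
     \<lparr>carrier = enc ` ind_carrier N, mult = (\<lambda>x y. x), one = enc (\<lambda>s. \<zero>\<^bsub>N\<^esub>),
      zero = enc (\<lambda>s. \<zero>\<^bsub>N\<^esub>), add = (\<lambda>x y. enc (\<lambda>s. inv_into UNIV enc x s \<oplus>\<^bsub>N\<^esub> inv_into UNIV enc y s)),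
      smult = (\<lambda>c x. enc (ind_act N c (inv_into UNIV enc x)))\<rparr>"

definition ind_map ::
  "((bool \<Rightarrow> 'm) \<Rightarrow> 'm) \<Rightarrow> ('b, 'm) module \<Rightarrow> ('b, 'm) module \<Rightarrow> ('m \<Rightarrow> 'm) \<Rightarrow> ('m \<Rightarrow> 'm)" where
  "ind_map enc M N f = (\<lambda>x\<in>carrier (ind_module enc M). enc (\<lambda>s. f (inv_into UNIV enc x s)))"

definition corner_module :: "('c, 'm) module \<Rightarrow> ('b, 'm) module" where
  "corner_module M =
     \<lparr>carrier = {x \<in> carrier M. e \<odot>\<^bsub>M\<^esub> x = x}, mult = mult M, one = one M,
      zero = zero M, add = add M, smult = (\<lambda>b x. \<iota> b \<odot>\<^bsub>M\<^esub> x)\<rparr>"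

definition corner_map ::
  "('c, 'm) module \<Rightarrow> ('c, 'm) module \<Rightarrow> ('m \<Rightarrow> 'm) \<Rightarrow> ('m \<Rightarrow> 'm)" where
  "corner_map M N f = restrict f (carrier (corner_module M))"

lemma ind_module_simps:
  assumes "inj enc"
  shows "carrier (ind_module enc N) = enc ` ind_carrier N"
    "\<zero>\<^bsub>ind_module enc N\<^esub> = enc (\<lambda>s. \<zero>\<^bsub>N\<^esub>)"
    "enc y \<oplus>\<^bsub>ind_module enc N\<^esub> enc z = enc (\<lambda>s. y s \<oplus>\<^bsub>N\<^esub> z s)"
    "c \<odot>\<^bsub>ind_module enc N\<^esub> enc y = enc (ind_act N c y)"
  using assms by (simp_all add: ind_module_def)

lemma ind_map_simp:
  assumes "inj enc" "y \<in> ind_carrier M"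
  shows "ind_map enc M N f (enc y) = enc (\<lambda>s. f (y s))"
  using assms by (simp add: ind_map_def ind_module_simps)

lemma ind_map_eqI:
  assumes "inj enc" "g \<in> extensional (carrier (ind_module enc M))"
    and "\<And>y. y \<in> ind_carrier M \<Longrightarrow> enc (\<lambda>s. f (y s)) = g (enc y)"
  shows "ind_map enc M N f = g"
proof (rule extensionalityI[OF _ assms(2)])
  show "ind_map enc M N f \<in> extensional (carrier (ind_module enc M))"
    unfolding ind_map_def by (rule restrict_extensional)
qed (use assms in \<open>auto simp: ind_map_simp ind_module_simps\<close>)

lemma corner_module_simps:
  "carrier (corner_module M) = {x \<in> carrier M. e \<odot>\<^bsub>M\<^esub> x = x}"
  "\<zero>\<^bsub>corner_module M\<^esub> = \<zero>\<^bsub>M\<^esub>"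
  "x \<oplus>\<^bsub>corner_module M\<^esub> y = x \<oplus>\<^bsub>M\<^esub> y"
  "b \<odot>\<^bsub>corner_module M\<^esub> x = \<iota> b \<odot>\<^bsub>M\<^esub> x"
  by (simp_all add: corner_module_def)

lemma ind_module:
  assumes enc: "inj enc" and N: "left_module B N"
  shows "left_module C (ind_module enc N)"
proof -
  interpret N: left_module B N by (rule N)
  note simps = ind_module_simps[OF enc] ind_carrierD[OF N] add_ind_carrier[OF N]
    zero_ind_carrier[OF N]
  have "abelian_group (ind_module enc N)"
  proof (rule abelian_groupI)
    fix x assume "x \<in> carrier (ind_module enc N)"
    then obtain y where y: "y \<in> ind_carrier N" "x = enc y" by (auto simp: simps)
    obtain z where "z \<in> ind_carrier N" "(\<lambda>s. z s \<oplus>\<^bsub>N\<^esub> y s) = (\<lambda>s. \<zero>\<^bsub>N\<^esub>)"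
      using minus_ind_carrier[OF N y(1)] by blast
    then show "\<exists>w\<in>carrier (ind_module enc N). w \<oplus>\<^bsub>ind_module enc N\<^esub> x = \<zero>\<^bsub>ind_module enc N\<^esub>"
      using y by (intro bexI[of _ "enc z"]) (simp_all add: simps)
  qed (auto simp: simps N.M.a_ac)
  then show ?thesis
    using C.ring_axioms by (intro left_moduleI)
      (auto simp: simps ind_act_ind_carrier[OF N] ind_act_add_scalar[OF N] ind_act_add[OF N] ind_act_mult[OF N])
qed

lemma corner_module:
  assumes M: "left_module C M"
  shows "left_module B (corner_module M)"
proof -
  interpret M: left_module C M by (rule M)
  have ab: "abelian_group (corner_module M)"
  proof (rule abelian_groupI)
    fix x assume x: "x \<in> carrier (corner_module M)"
    then have "e \<odot>\<^bsub>M\<^esub> (\<ominus>\<^bsub>M\<^esub> x) \<oplus>\<^bsub>M\<^esub> x = \<zero>\<^bsub>M\<^esub>"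
      using M.act_add[of e "\<ominus>\<^bsub>M\<^esub> x" x] by (simp add: corner_module_simps M.M.l_neg M.act_zero)
    then have "e \<odot>\<^bsub>M\<^esub> (\<ominus>\<^bsub>M\<^esub> x) = \<ominus>\<^bsub>M\<^esub> x"
      using x by (intro M.M.minus_equality[symmetric]) (auto simp: corner_module_simps M.act_closed)
    then show "\<exists>w\<in>carrier (corner_module M). w \<oplus>\<^bsub>corner_module M\<^esub> x = \<zero>\<^bsub>corner_module M\<^esub>"
      using x by (intro bexI[of _ "\<ominus>\<^bsub>M\<^esub> x"]) (auto simp: corner_module_simps M.M.l_neg)
  qed (auto simp: corner_module_simps M.M.a_ac M.act_add M.act_zero)
  have "e \<odot>\<^bsub>M\<^esub> (\<iota> b \<odot>\<^bsub>M\<^esub> x) = \<iota> b \<odot>\<^bsub>M\<^esub> x" if "b \<in> carrier B" "x \<in> carrier M" for b x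
    using that by (simp add: M.act_mult[symmetric] \<iota>_closed e_\<iota>)
  then show ?thesis
    using B.ring_axioms ab by (intro left_moduleI)
      (auto simp: corner_module_simps M.act_closed M.act_add M.act_add_scalar M.act_mult
        \<iota>_add \<iota>_mult \<iota>_closed)
qed

lemma ind_act_hom:
  assumes M: "left_module B M" and N: "left_module B N" and f: "f \<in> mod_hom B M N"
    and y: "\<And>s. y s \<in> carrier M" and c: "c \<in> carrier C"
  shows "ind_act N c (\<lambda>s. f (y s)) = (\<lambda>s. f (ind_act M c y s))"
proof -
  interpret M: left_module B M by (rule M)
  show ?thesis
    unfolding ind_act_def using y c by (intro ext) (simp add: mod_homD[OF f] \<beta>_closed M.act_closed)
qed

lemma hom_ind_carrier:
  assumes M: "left_module B M" and N: "left_module B N" and f: "f \<in> mod_hom B M N"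
    and y: "y \<in> ind_carrier M"
  shows "(\<lambda>s. f (y s)) \<in> ind_carrier N"
  using ind_carrierD(1)[OF M y]
  by (simp add: ind_carrier_def ind_act_hom[OF M N f] ind_carrierD(2)[OF M y] mod_homD(1)[OF f])

lemma ind_map:
  assumes enc: "inj enc" and M: "left_module B M" and N: "left_module B N"
    and f: "f \<in> mod_hom B M N"
  shows "ind_map enc M N f \<in> mod_hom C (ind_module enc M) (ind_module enc N)"
proof -
  note simps = ind_module_simps[OF enc] ind_carrierD[OF M] add_ind_carrier[OF M]
    ind_map_simp[OF enc] hom_ind_carrier[OF M N f] ind_act_ind_carrier[OF M] ind_act_hom[OF M N f]
    mod_homD[OF f]
  show ?thesis
    unfolding mod_hom_def
    by (auto simp: simps PiE_iff) (simp add: ind_map_def ind_module_simps[OF enc])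
qed

lemma ind_act_const_one:
  assumes N: "left_module B N" and y: "y \<in> ind_carrier N"
  shows "ind_act N (c \<odot> \<one>) y = (\<lambda>s. (c \<odot>\<^bsub>B\<^esub> \<one>\<^bsub>B\<^esub>) \<odot>\<^bsub>N\<^esub> y s)"
proof -
  interpret N: left_module B N by (rule N)
  have "ind_act N (c \<odot> \<one>) y = (\<lambda>s. (c \<odot>\<^bsub>B\<^esub> \<one>\<^bsub>B\<^esub>) \<odot>\<^bsub>N\<^esub> ind_act N \<one> y s)"
    unfolding ind_act_def using ind_carrierD[OF N y]
    by (simp add: \<beta>_smult_one N.act_mult N.act_add N.act_closed \<beta>_closed B.smult_closed)
  then show ?thesis using ind_carrierD[OF N y] by simp
qed

lemma ind_functor:
  assumes enc: "inj (enc :: (bool \<Rightarrow> 'm) \<Rightarrow> 'm)"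
  shows "k_linear_functor B C (ind_module enc) (ind_map enc)"
  unfolding k_linear_functor_def
proof (intro conjI allI ballI impI)
  note simps = ind_module_simps[OF enc] ind_map_simp[OF enc]
  fix M :: "('b, 'm) module" assume M: "left_module B M"
  interpret M: left_module B M by (rule M)
  show "left_module C (ind_module enc M)" using enc M by (rule ind_module)
  show "ind_map enc M M (\<lambda>x\<in>carrier M. x) = (\<lambda>x\<in>carrier (ind_module enc M). x)"
    by (rule ind_map_eqI[OF enc])
      (auto simp: simps ind_carrierD[OF M])
  fix N :: "('b, 'm) module" assume N: "left_module B N"
  interpret N: left_module B N by (rule N)
  fix f assume f: "f \<in> mod_hom B M N"
  show "ind_map enc M N f \<in> mod_hom C (ind_module enc M) (ind_module enc N)"
    by (rule ind_map[OF enc M N f])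
  { fix g assume g: "g \<in> mod_hom B M N"
    show "ind_map enc M N (\<lambda>x\<in>carrier M. f x \<oplus>\<^bsub>N\<^esub> g x) =
      (\<lambda>x\<in>carrier (ind_module enc M).
        ind_map enc M N f x \<oplus>\<^bsub>ind_module enc N\<^esub> ind_map enc M N g x)"
      by (rule ind_map_eqI[OF enc])
        (auto simp: simps ind_carrierD[OF M]) }
  { fix c
    show "ind_map enc M N (\<lambda>x\<in>carrier M. (c \<odot>\<^bsub>B\<^esub> \<one>\<^bsub>B\<^esub>) \<odot>\<^bsub>N\<^esub> f x) =
      (\<lambda>x\<in>carrier (ind_module enc M). (c \<odot> \<one>) \<odot>\<^bsub>ind_module enc N\<^esub> ind_map enc M N f x)"
      by (rule ind_map_eqI[OF enc])
        (auto simp: simps ind_carrierD[OF M] ind_act_const_one[OF N] hom_ind_carrier[OF M N f]) }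
next
  note simps = ind_module_simps[OF enc] ind_map_simp[OF enc]
  fix L M N :: "('b, 'm) module" and f g
  assume L: "left_module B L" and M: "left_module B M" and N: "left_module B N"
    and f: "f \<in> mod_hom B L M" and g: "g \<in> mod_hom B M N"
  show "ind_map enc L N (compose (carrier L) g f) =
    compose (carrier (ind_module enc L)) (ind_map enc M N g) (ind_map enc L M f)"
    by (rule ind_map_eqI[OF enc])
      (auto simp: simps compose_def ind_carrierD[OF L] hom_ind_carrier[OF L M f])
qed

lemma hom_corner:
  assumes "f \<in> mod_hom C M N" "x \<in> carrier M" "e \<odot>\<^bsub>M\<^esub> x = x"
  shows "e \<odot>\<^bsub>N\<^esub> f x = f x"
  using mod_homD(3)[OF assms(1) e_closed assms(2)] unfolding assms(3) ..

lemma corner_map: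
  assumes M: "left_module C M" and N: "left_module C N" and f: "f \<in> mod_hom C M N"
  shows "corner_map M N f \<in> mod_hom B (corner_module M) (corner_module N)"
proof -
  interpret M: left_module C M by (rule M)
  interpret cM: left_module B "corner_module M" by (rule corner_module[OF M])
  show ?thesis
    unfolding mod_hom_def corner_map_def
    using cM.M.a_closed cM.act_closed
    by (auto simp: PiE_iff corner_module_simps mod_homD[OF f] \<iota>_closed hom_corner[OF f])
qed

lemma corner_functor: "k_linear_functor C B corner_module corner_map"
  unfolding k_linear_functor_def
proof (intro conjI allI ballI impI)
  fix M :: "('c, 'm) module" assume M: "left_module C M"
  show "left_module B (corner_module M)" using M by (rule corner_module)
  show "corner_map M M (\<lambda>x\<in>carrier M. x) = (\<lambda>x\<in>carrier (corner_module M). x)"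
    by (auto simp: corner_map_def corner_module_simps restrict_def)
  fix N :: "('c, 'm) module" assume N: "left_module C N"
  interpret N: left_module C N by (rule N)
  fix f assume f: "f \<in> mod_hom C M N"
  show "corner_map M N f \<in> mod_hom B (corner_module M) (corner_module N)"
    by (rule corner_map[OF M N f])
  { fix g assume g: "g \<in> mod_hom C M N"
    show "corner_map M N (\<lambda>x\<in>carrier M. f x \<oplus>\<^bsub>N\<^esub> g x) =
      (\<lambda>x\<in>carrier (corner_module M).
        corner_map M N f x \<oplus>\<^bsub>corner_module N\<^esub> corner_map M N g x)"
      by (rule ext) (simp add: corner_map_def corner_module_simps) }
  { fix c
    have "\<iota> (c \<odot>\<^bsub>B\<^esub> \<one>\<^bsub>B\<^esub>) \<odot>\<^bsub>N\<^esub> f x = (c \<odot> \<one>) \<odot>\<^bsub>N\<^esub> f x"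
      if "x \<in> carrier M" "e \<odot>\<^bsub>M\<^esub> x = x" for x
    proof -
      have "\<iota> (c \<odot>\<^bsub>B\<^esub> \<one>\<^bsub>B\<^esub>) = (c \<odot> \<one>) \<otimes> e"
        using C.smult_mult_left[of "\<one>" e c, symmetric] by (simp add: \<iota>_smult)
      moreover have "e \<odot>\<^bsub>N\<^esub> f x = f x"
        using f that by (rule hom_corner)
      ultimately show ?thesis
        using that by (simp add: N.act_mult C.smult_closed mod_homD(1)[OF f])
    qed
    note this [simp]
    show "corner_map M N (\<lambda>x\<in>carrier M. (c \<odot> \<one>) \<odot>\<^bsub>N\<^esub> f x) =
      (\<lambda>x\<in>carrier (corner_module M).
        (c \<odot>\<^bsub>B\<^esub> \<one>\<^bsub>B\<^esub>) \<odot>\<^bsub>corner_module N\<^esub> corner_map M N f x)"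
      by (rule ext) (simp add: corner_map_def corner_module_simps) }
next
  fix L M N :: "('c, 'm) module" and f g
  assume L: "left_module C L" and M: "left_module C M" and N: "left_module C N"
    and f: "f \<in> mod_hom C L M" and g: "g \<in> mod_hom C M N"
  show "corner_map L N (compose (carrier L) g f) =
    compose (carrier (corner_module L)) (corner_map M N g) (corner_map L M f)"
    by (rule ext) (simp add: corner_map_def corner_module_simps compose_def
        mod_homD(1)[OF f] hom_corner[OF f])
qed

text \<open>
  The matrices of \<open>e C e \<rightarrow> C e\<close> and of \<open>C e \<rightarrow> e C e\<close>, the inclusion and multiplication by \<open>e\<close>,
  in the above generators. They compare \<open>N\<close> with \<open>e (C e \<otimes>\<^sub>B N)\<close>.
\<close>

definition qe :: "bool \<Rightarrow> 'b" where "qe s = corner (q s \<otimes> e)"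
definition ep :: "bool \<Rightarrow> 'b" where "ep s = corner (e \<otimes> p s)"

lemma e_e: "e \<otimes> e = e"
  by (simp add: e_\<iota>)

lemma qe: "qe s \<in> carrier B" "\<iota> (qe s) = q s \<otimes> e"
proof -
  have "e \<otimes> (q s \<otimes> e) = q s \<otimes> e" "q s \<otimes> e \<otimes> e = q s \<otimes> e"
    by (simp_all add: C.m_assoc[symmetric] e_q q_closed) (simp add: C.m_assoc q_closed e_e)
  then show "qe s \<in> carrier B" "\<iota> (qe s) = q s \<otimes> e"
    unfolding qe_def using corner_closed_\<iota> q_closed by auto
qed

lemma ep: "ep s \<in> carrier B" "\<iota> (ep s) = e \<otimes> p s"
proof -
  have "e \<otimes> (e \<otimes> p s) = e \<otimes> p s" "e \<otimes> p s \<otimes> e = e \<otimes> p s"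
    by (simp_all add: C.m_assoc[symmetric] p_closed e_e) (simp add: C.m_assoc p_closed p_e)
  then show "ep s \<in> carrier B" "\<iota> (ep s) = e \<otimes> p s"
    unfolding ep_def using corner_closed_\<iota> p_closed by auto
qed

lemma qe_ep: "qe s \<otimes>\<^bsub>B\<^esub> ep t = \<beta> s t e"
proof -
  have "q s \<otimes> e \<otimes> (e \<otimes> p t) = q s \<otimes> (e \<otimes> e) \<otimes> p t"
    unfolding C.m_assoc[OF q_closed e_closed e_closed, symmetric]
    by (simp add: C.m_assoc p_closed q_closed)
  then have "\<iota> (qe s \<otimes>\<^bsub>B\<^esub> ep t) = \<iota> (\<beta> s t e)"
    by (simp add: \<iota>_mult qe ep \<iota>_\<beta> e_e)
  then show ?thesis by (subst (asm) \<iota>_inj) (auto simp: qe ep \<beta>_closed)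
qed

lemma sum_\<beta>_qe:
  assumes "b \<in> carrier B"
  shows "\<beta> s False (\<iota> b) \<otimes>\<^bsub>B\<^esub> qe False \<oplus>\<^bsub>B\<^esub> \<beta> s True (\<iota> b) \<otimes>\<^bsub>B\<^esub> qe True = qe s \<otimes>\<^bsub>B\<^esub> b"
proof -
  note cl = p_closed q_closed \<iota>_closed[OF assms]
  have "\<iota> (\<beta> s False (\<iota> b) \<otimes>\<^bsub>B\<^esub> qe False \<oplus>\<^bsub>B\<^esub> \<beta> s True (\<iota> b) \<otimes>\<^bsub>B\<^esub> qe True)
    = q s \<otimes> \<iota> b \<otimes> (p False \<otimes> q False \<oplus> p True \<otimes> q True) \<otimes> e"
    using cl by (simp add: \<iota>_add \<iota>_mult \<beta> qe assms C.l_distr C.r_distr C.m_assoc)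
  also have "\<dots> = \<iota> (qe s \<otimes>\<^bsub>B\<^esub> b)"
    using cl assms by (simp add: pq \<iota>_mult qe C.m_assoc \<iota>_e e_\<iota>)
  finally show ?thesis
    using assms by (subst (asm) \<iota>_inj) (auto simp: qe \<beta>_closed \<iota>_closed)
qed

lemma sum_ep_qe: "ep False \<otimes>\<^bsub>B\<^esub> qe False \<oplus>\<^bsub>B\<^esub> ep True \<otimes>\<^bsub>B\<^esub> qe True = \<one>\<^bsub>B\<^esub>"
proof -
  have "\<iota> (ep False \<otimes>\<^bsub>B\<^esub> qe False \<oplus>\<^bsub>B\<^esub> ep True \<otimes>\<^bsub>B\<^esub> qe True)
    = e \<otimes> (p False \<otimes> q False \<oplus> p True \<otimes> q True) \<otimes> e"
    by (simp add: \<iota>_add \<iota>_mult qe ep C.l_distr C.r_distr C.m_assoc p_closed q_closed)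
  also have "\<dots> = e" by (simp add: pq e_e)
  finally show ?thesis by (subst (asm) \<iota>_inj) (auto simp: qe ep)
qed

definition unit_B :: "((bool \<Rightarrow> 'm) \<Rightarrow> 'm) \<Rightarrow> ('b, 'm) module \<Rightarrow> 'm \<Rightarrow> 'm" where
  "unit_B enc N = (\<lambda>x\<in>carrier N. enc (\<lambda>s. qe s \<odot>\<^bsub>N\<^esub> x))"

text \<open>
  The inverse of \<open>x \<mapsto> (q s e x)\<^sub>s\<close> is \<open>y \<mapsto> \<Sum>\<^sub>s e p s y\<^sub>s\<close>.
\<close>

lemma unit_B:
  assumes enc: "inj enc" and N: "left_module B N"
  shows "unit_B enc N \<in> mod_iso B N (corner_module (ind_module enc N))"
proof -
  interpret N: left_module B N by (rule N)
  note simps = ind_module_simps[OF enc] corner_module_simps unit_B_def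
  have act: "ind_act N (\<iota> b) (\<lambda>s. qe s \<odot>\<^bsub>N\<^esub> x) = (\<lambda>s. qe s \<odot>\<^bsub>N\<^esub> (b \<odot>\<^bsub>N\<^esub> x))"
    if "b \<in> carrier B" "x \<in> carrier N" for b x
  proof
    fix s
    show "ind_act N (\<iota> b) (\<lambda>s. qe s \<odot>\<^bsub>N\<^esub> x) s = qe s \<odot>\<^bsub>N\<^esub> (b \<odot>\<^bsub>N\<^esub> x)"
      unfolding ind_act_def using that
      by (simp add: N.act_mult[symmetric] N.act_add_scalar[symmetric] sum_\<beta>_qe qe \<beta>_closed
          \<iota>_closed)
  qed
  have in_ind: "(\<lambda>s. qe s \<odot>\<^bsub>N\<^esub> x) \<in> ind_carrier N" if "x \<in> carrier N" for x
    using ind_act_ind_carrier[OF N, of e "\<lambda>s. qe s \<odot>\<^bsub>N\<^esub> x"] act[of "\<one>\<^bsub>B\<^esub>" x] that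
    by (simp add: N.act_closed qe N.act_one)
  have hom: "unit_B enc N \<in> mod_hom B N (corner_module (ind_module enc N))"
    unfolding mod_hom_def using act[of "\<one>\<^bsub>B\<^esub>"]
    by (auto simp: simps PiE_iff in_ind N.act_one act N.act_add qe N.act_closed)
  let ?r = "\<lambda>y :: bool \<Rightarrow> _. ep False \<odot>\<^bsub>N\<^esub> y False \<oplus>\<^bsub>N\<^esub> ep True \<odot>\<^bsub>N\<^esub> y True"
  have inj: "inj_on (unit_B enc N) (carrier N)"
  proof (rule inj_on_inverseI)
    fix x assume x: "x \<in> carrier N"
    have "?r (\<lambda>s. qe s \<odot>\<^bsub>N\<^esub> x) = x"
      using x by (simp add: N.act_mult[symmetric] N.act_add_scalar[symmetric] sum_ep_qe qe ep N.act_one)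
    then show "?r (inv_into UNIV enc (unit_B enc N x)) = x" using x enc by (simp add: unit_B_def)
  qed
  have "z \<in> unit_B enc N ` carrier N" if z: "z \<in> carrier (corner_module (ind_module enc N))" for z
  proof -
    obtain y where y: "y \<in> ind_carrier N" "z = enc y" "ind_act N e y = y"
      using z enc by (auto simp: simps inj_eq)
    note yc = ind_carrierD(1)[OF N y(1)]
    have "qe s \<odot>\<^bsub>N\<^esub> ?r y = ind_act N e y s" for s
      using yc by (simp add: ind_act_def N.act_add N.act_closed qe ep N.act_mult[symmetric] qe_ep)
    then have "z = unit_B enc N (?r y)"
      using y yc by (simp add: unit_B_def N.act_closed ep)
    then show ?thesis using yc by (auto simp: N.act_closed ep)
  qed
  then show ?thesis
    using hom inj by (auto simp: mod_iso_def bij_betw_def mod_homD[OF hom])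
qed

definition unit_C :: "((bool \<Rightarrow> 'm) \<Rightarrow> 'm) \<Rightarrow> ('c, 'm) module \<Rightarrow> 'm \<Rightarrow> 'm" where
  "unit_C enc M = (\<lambda>x\<in>carrier M. enc (\<lambda>s. q s \<odot>\<^bsub>M\<^esub> x))"

text \<open>
  The inverse of \<open>x \<mapsto> (q s x)\<^sub>s\<close> is \<open>y \<mapsto> \<Sum>\<^sub>s p s y\<^sub>s\<close>, because \<open>\<Sum>\<^sub>s p s q s = 1\<close>.
\<close>

lemma unit_C:
  assumes enc: "inj enc" and M: "left_module C M"
  shows "unit_C enc M \<in> mod_iso C M (ind_module enc (corner_module M))"
proof -
  interpret M: left_module C M by (rule M)
  note N = corner_module[OF M]
  note simps = ind_module_simps[OF enc] corner_module_simps unit_C_def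
  let ?r = "\<lambda>y :: bool \<Rightarrow> _. p False \<odot>\<^bsub>M\<^esub> y False \<oplus>\<^bsub>M\<^esub> p True \<odot>\<^bsub>M\<^esub> y True"
  have ind_act: "ind_act (corner_module M) c y s = q s \<odot>\<^bsub>M\<^esub> (c \<odot>\<^bsub>M\<^esub> ?r y)"
    if "c \<in> carrier C" "\<And>s. y s \<in> carrier M" for c y s
    using that by (simp add: ind_act_def corner_module_simps \<iota>_\<beta> M.act_mult M.act_add M.act_closed
        p_closed q_closed)
  have act: "ind_act (corner_module M) c (\<lambda>s. q s \<odot>\<^bsub>M\<^esub> x) = (\<lambda>s. q s \<odot>\<^bsub>M\<^esub> (c \<odot>\<^bsub>M\<^esub> x))"
    if "c \<in> carrier C" "x \<in> carrier M" for c x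
    using that sum_pq_act[OF M, of x] by (intro ext) (simp add: ind_act M.act_closed q_closed)
  have eq: "e \<odot>\<^bsub>M\<^esub> (q s \<odot>\<^bsub>M\<^esub> x) = q s \<odot>\<^bsub>M\<^esub> x" if "x \<in> carrier M" for s x
    using that by (simp add: M.act_mult[symmetric] q_closed e_q)
  have in_ind: "(\<lambda>s. q s \<odot>\<^bsub>M\<^esub> x) \<in> ind_carrier (corner_module M)" if "x \<in> carrier M" for x
    using that by (simp add: ind_carrier_def act M.act_one corner_module_simps eq M.act_closed q_closed)
  have hom: "unit_C enc M \<in> mod_hom C M (ind_module enc (corner_module M))"
    unfolding mod_hom_def
    by (auto simp: simps PiE_iff in_ind act M.act_add q_closed M.act_closed)
  have inj: "inj_on (unit_C enc M) (carrier M)"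
    by (rule inj_on_inverseI[where g = "\<lambda>z. ?r (inv_into UNIV enc z)"])
      (use enc in \<open>simp add: unit_C_def sum_pq_act[OF M]\<close>)
  have "z \<in> unit_C enc M ` carrier M" if z: "z \<in> carrier (ind_module enc (corner_module M))" for z
  proof -
    obtain y where y: "y \<in> ind_carrier (corner_module M)" "z = enc y"
      using z by (auto simp: simps)
    have yc: "y s \<in> carrier M" for s
      using ind_carrierD(1)[OF N y(1)] by (simp add: corner_module_simps)
    have "y s = q s \<odot>\<^bsub>M\<^esub> ?r y" for s
    proof -
      have "y s = ind_act (corner_module M) \<one> y s"
        by (simp only: ind_carrierD(2)[OF N y(1)])
      also have "\<dots> = q s \<odot>\<^bsub>M\<^esub> ?r y"
        by (subst ind_act) (simp_all add: yc M.act_one M.act_closed p_closed)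
      finally show ?thesis .
    qed
    then have "y = (\<lambda>s. q s \<odot>\<^bsub>M\<^esub> ?r y)" by (rule ext)
    moreover have "unit_C enc M (?r y) = enc (\<lambda>s. q s \<odot>\<^bsub>M\<^esub> ?r y)"
      by (simp add: unit_C_def M.act_closed p_closed yc)
    ultimately have "z = unit_C enc M (?r y)"
      using y(2) by (simp only:)
    then show ?thesis using yc by (auto simp: M.act_closed p_closed)
  qed
  then show ?thesis
    using hom inj by (auto simp: mod_iso_def bij_betw_def mod_homD[OF hom])
qed

theorem morita_equivalent_corner:
  assumes inf: "infinite (UNIV :: 'm set)"
  shows "morita_equivalent TYPE('m) B C"
proof -
  obtain enc :: "(bool \<Rightarrow> 'm) \<Rightarrow> 'm" where enc: "inj enc"
    using infinite_bool_fun_inj[OF inf] by blast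
  have "natural_iso_from_id B (\<lambda>N. corner_module (ind_module enc N))
    (\<lambda>M N f. corner_map (ind_module enc M) (ind_module enc N) (ind_map enc M N f)) (unit_B enc)"
    unfolding natural_iso_from_id_def
  proof (intro conjI allI impI ballI)
    fix M N :: "('b, 'm) module" and f
    assume M: "left_module B M" and N: "left_module B N" and f: "f \<in> mod_hom B M N"
    have "unit_B enc M x \<in> carrier (corner_module (ind_module enc M))" if "x \<in> carrier M" for x
      using unit_B[OF enc M] that by (auto simp: mod_iso_def dest: mod_homD)
    moreover have "unit_B enc M x \<in> carrier (ind_module enc M)" if "x \<in> carrier M" for x
      using calculation[OF that] by (simp add: corner_module_simps)
    ultimately show "compose (carrier M) (unit_B enc N) f =
      compose (carrier M) (corner_map (ind_module enc M) (ind_module enc N) (ind_map enc M N f))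
        (unit_B enc M)"
      using enc
      by (auto simp: compose_def restrict_def fun_eq_iff corner_map_def ind_map_def unit_B_def
          mod_homD[OF f] qe)
  qed (rule unit_B[OF enc])
  moreover have "natural_iso_from_id C (\<lambda>M. ind_module enc (corner_module M))
    (\<lambda>M N f. ind_map enc (corner_module M) (corner_module N) (corner_map M N f)) (unit_C enc)"
    unfolding natural_iso_from_id_def
  proof (intro conjI allI impI ballI)
    fix M N :: "('c, 'm) module" and f
    assume M: "left_module C M" and N: "left_module C N" and f: "f \<in> mod_hom C M N"
    interpret M: left_module C M by (rule M)
    have "unit_C enc M x \<in> carrier (ind_module enc (corner_module M))" if "x \<in> carrier M" for x
      using unit_C[OF enc M] that by (auto simp: mod_iso_def dest: mod_homD)
    moreover have "e \<odot>\<^bsub>M\<^esub> (q s \<odot>\<^bsub>M\<^esub> x) = q s \<odot>\<^bsub>M\<^esub> x" if "x \<in> carrier M" for s x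
      using that by (simp add: M.act_mult[symmetric] q_closed e_q)
    ultimately show "compose (carrier M) (unit_C enc N) f =
      compose (carrier M) (ind_map enc (corner_module M) (corner_module N) (corner_map M N f))
        (unit_C enc M)"
      using enc
      by (auto simp: compose_def restrict_def fun_eq_iff corner_map_def ind_map_def unit_C_def
          mod_homD[OF f] q_closed corner_module_simps M.act_closed)
  qed (rule unit_C[OF enc])
  ultimately show ?thesis
    unfolding morita_equivalent_def
    using B.k_algebra_axioms C.k_algebra_axioms ind_functor[OF enc] corner_functor by blast
qed

end

section \<open>Isomorphic algebras\<close>

definition alg_iso :: "('k::field, 'c) module \<Rightarrow> ('k, 'd) module \<Rightarrow> ('c \<Rightarrow> 'd) \<Rightarrow> bool" where
  "alg_iso C D h \<longleftrightarrow> bij_betw h (carrier C) (carrier D) \<and>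
     (\<forall>x\<in>carrier C. \<forall>y\<in>carrier C. x \<otimes>\<^bsub>C\<^esub> y \<in> carrier C \<and> h (x \<otimes>\<^bsub>C\<^esub> y) = h x \<otimes>\<^bsub>D\<^esub> h y) \<and>
     (\<forall>x\<in>carrier C. \<forall>y\<in>carrier C. x \<oplus>\<^bsub>C\<^esub> y \<in> carrier C \<and> h (x \<oplus>\<^bsub>C\<^esub> y) = h x \<oplus>\<^bsub>D\<^esub> h y) \<and>
     (\<forall>c. \<forall>x\<in>carrier C. c \<odot>\<^bsub>C\<^esub> x \<in> carrier C \<and> h (c \<odot>\<^bsub>C\<^esub> x) = c \<odot>\<^bsub>D\<^esub> h x) \<and>
     \<one>\<^bsub>C\<^esub> \<in> carrier C \<and> h \<one>\<^bsub>C\<^esub> = \<one>\<^bsub>D\<^esub> \<and> \<zero>\<^bsub>C\<^esub> \<in> carrier C \<and> h \<zero>\<^bsub>C\<^esub> = \<zero>\<^bsub>D\<^esub>"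

lemma alg_isoD:
  assumes "alg_iso C D h"
  shows "bij_betw h (carrier C) (carrier D)"
    "x \<in> carrier C \<Longrightarrow> h x \<in> carrier D"
    "x \<in> carrier C \<Longrightarrow> y \<in> carrier C \<Longrightarrow> x \<otimes>\<^bsub>C\<^esub> y \<in> carrier C"
    "x \<in> carrier C \<Longrightarrow> y \<in> carrier C \<Longrightarrow> h (x \<otimes>\<^bsub>C\<^esub> y) = h x \<otimes>\<^bsub>D\<^esub> h y"
    "x \<in> carrier C \<Longrightarrow> y \<in> carrier C \<Longrightarrow> x \<oplus>\<^bsub>C\<^esub> y \<in> carrier C"
    "x \<in> carrier C \<Longrightarrow> y \<in> carrier C \<Longrightarrow> h (x \<oplus>\<^bsub>C\<^esub> y) = h x \<oplus>\<^bsub>D\<^esub> h y"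
    "x \<in> carrier C \<Longrightarrow> c \<odot>\<^bsub>C\<^esub> x \<in> carrier C"
    "x \<in> carrier C \<Longrightarrow> h (c \<odot>\<^bsub>C\<^esub> x) = c \<odot>\<^bsub>D\<^esub> h x"
    "\<one>\<^bsub>C\<^esub> \<in> carrier C" "h \<one>\<^bsub>C\<^esub> = \<one>\<^bsub>D\<^esub>" "\<zero>\<^bsub>C\<^esub> \<in> carrier C" "h \<zero>\<^bsub>C\<^esub> = \<zero>\<^bsub>D\<^esub>"
    "x \<in> carrier C \<Longrightarrow> y \<in> carrier C \<Longrightarrow> h x = h y \<Longrightarrow> x = y"
  using assms unfolding alg_iso_def by (auto simp: bij_betw_def inj_on_def)

text \<open>
  All laws are reflected by the injective map \<open>h\<close>. For the left Burt-Butler algebra this replaces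
  a direct proof of associativity, which would need coassociativity of the bocs.
\<close>

lemma k_algebra_alg_iso:
  assumes iso: "alg_iso C D h" and D: "k_algebra D"
  shows "k_algebra C"
proof -
  interpret D: k_algebra D by (rule D)
  note iso = alg_isoD[OF iso]
  have inv: "\<exists>y\<in>carrier C. y \<oplus>\<^bsub>C\<^esub> x = \<zero>\<^bsub>C\<^esub>" if x: "x \<in> carrier C" for x
  proof -
    have "\<ominus>\<^bsub>D\<^esub> h x \<in> h ` carrier C" using iso(1) iso(2)[OF x] by (simp add: bij_betw_def)
    then obtain y where y: "y \<in> carrier C" "h y = \<ominus>\<^bsub>D\<^esub> h x" by (auto simp: image_iff)
    have "h (y \<oplus>\<^bsub>C\<^esub> x) = h \<zero>\<^bsub>C\<^esub>" using x y by (simp add: iso D.l_neg)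
    then have "y \<oplus>\<^bsub>C\<^esub> x = \<zero>\<^bsub>C\<^esub>" using iso(13)[of "y \<oplus>\<^bsub>C\<^esub> x" "\<zero>\<^bsub>C\<^esub>"] x y by (simp add: iso)
    with y show ?thesis by blast
  qed
  have "abelian_group C"
    by (rule abelian_groupI) (auto intro!: iso(13) inv simp: iso(2-12) D.a_ac)
  moreover have "monoid C"
    by (rule monoidI) (auto intro!: iso(13) simp: iso(2-12) D.m_assoc)
  ultimately have "ring C"
    by (rule ringI) (auto intro!: iso(13) simp: iso(2-12) D.l_distr D.r_distr)
  then show ?thesis
    unfolding k_algebra_def k_algebra_axioms_def
    by (auto intro!: iso(13) simp: iso(2-12) D.smult_closed D.smult_add_scalar D.smult_add
        D.smult_smult D.smult_one D.smult_mult_left D.smult_mult_right)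
       (auto simp: D.smult_mult_left[symmetric] D.smult_mult_right[symmetric] iso(2-12))
qed

lemma alg_iso_inv:
  assumes iso: "alg_iso C D h" and D: "k_algebra D"
  shows "alg_iso D C (inv_into (carrier C) h)"
proof -
  interpret D: k_algebra D by (rule D)
  note iso = alg_isoD[OF iso]
  let ?g = "inv_into (carrier C) h"
  have im: "h ` carrier C = carrier D" and inj: "inj_on h (carrier C)"
    using iso(1) by (auto simp: bij_betw_def)
  have g: "?g y \<in> carrier C" "h (?g y) = y" if "y \<in> carrier D" for y
    using that im by (auto intro: inv_into_into f_inv_into_f)
  have g_eq: "?g (h x) = x" if "x \<in> carrier C" for x using inj that by simp
  have bij: "bij_betw ?g (carrier D) (carrier C)"
    using iso(1) by (rule bij_betw_inv_into)
  show ?thesis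
    unfolding alg_iso_def
    using bij by (auto simp: D.smult_closed) (auto intro!: iso(13) simp: g iso D.smult_closed)
qed

section \<open>Incidence matrices with a common eigenvector\<close>

lemma sum_lessThan_add:
  fixes f :: "nat \<Rightarrow> 'a::comm_monoid_add"
  shows "(\<Sum>i<m + n. f i) = (\<Sum>i<m. f i) + (\<Sum>i<n. f (m + i))"
  by (induction n) (simp_all add: add.assoc)

lemma index_mult_mat_sum:
  assumes "X \<in> carrier_mat k l" "Y \<in> carrier_mat l c" "a < k" "b < c"
  shows "(X * Y) $$ (a, b) = (\<Sum>i<l. X $$ (a, i) * Y $$ (i, b))"
  using assms by (simp add: scalar_prod_def lessThan_atLeast0)

lemma mult_mat_nonzero:
  fixes X Y :: "'a::semiring_0 mat"
  assumes "X \<in> carrier_mat k l" "Y \<in> carrier_mat l c" "a < k" "b < c" "(X * Y) $$ (a, b) \<noteq> 0"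
  obtains i where "i < l" "X $$ (a, i) \<noteq> 0" "Y $$ (i, b) \<noteq> 0"
proof -
  have "\<exists>i\<in>{..<l}. X $$ (a, i) * Y $$ (i, b) \<noteq> 0"
  proof (rule ccontr)
    assume "\<not> ?thesis"
    then have "(\<Sum>i<l. X $$ (a, i) * Y $$ (i, b)) = 0" by (auto intro: sum.neutral)
    then show False using assms by (simp add: index_mult_mat_sum[OF assms(1-4)])
  qed
  then obtain i where "i < l" and i: "X $$ (a, i) * Y $$ (i, b) \<noteq> 0" by auto
  then show ?thesis using that[of i] by (metis mult_zero_left mult_zero_right)
qed

text \<open>
  Row \<open>a\<close> is the unit vector of \<open>f a\<close> if \<open>P a\<close>, and \<open>0\<close> otherwise; multiplication by such a matrix
  from the left selects rows.
\<close>

definition sel_mat :: "nat \<Rightarrow> nat \<Rightarrow> (nat \<Rightarrow> bool) \<Rightarrow> (nat \<Rightarrow> nat) \<Rightarrow> 'k::field mat" where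
  "sel_mat k l P f = mat k l (\<lambda>(a, b). if P a \<and> b = f a then 1 else 0)"

lemma sel_mat_carrier [simp]: "sel_mat k l P f \<in> carrier_mat k l"
  "dim_row (sel_mat k l P f) = k" "dim_col (sel_mat k l P f) = l"
  by (simp_all add: sel_mat_def)

lemma sel_mat_index [simp]:
  "a < k \<Longrightarrow> b < l \<Longrightarrow> sel_mat k l P f $$ (a, b) = (if P a \<and> b = f a then 1 else 0)"
  by (simp add: sel_mat_def)

lemma sel_mat_mult:
  assumes "Y \<in> carrier_mat l c" "\<And>a. a < k \<Longrightarrow> P a \<Longrightarrow> f a < l" "a < k" "b < c"
  shows "(sel_mat k l P f * Y) $$ (a, b) = (if P a then Y $$ (f a, b) else 0)"
  using assms by (subst index_mult_mat_sum[OF sel_mat_carrier(1) assms(1,3,4)])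
    (auto simp: if_distrib[of "\<lambda>x. x * _"] cong: if_cong)

lemma sel_mat_mult_vec:
  assumes "v \<in> carrier_vec l" "\<And>a. a < k \<Longrightarrow> P a \<Longrightarrow> f a < l" "a < k"
  shows "(sel_mat k l P f *\<^sub>v v) $ a = (if P a then v $ (f a) else 0)"
  using assms 
  by (auto simp: scalar_prod_def if_distrib[of "\<lambda>x. x * _"] cong: if_cong)

text \<open>
  The rows and columns of a matrix of size \<open>m + n\<close> are labelled by \<open>1, \<dots>, m, 1, \<dots>, n\<close>.
\<close>

definition label :: "nat \<Rightarrow> nat \<Rightarrow> nat" where
  "label m t = (if t < m then t + 1 else t - m + 1)"

definition tail_ones :: "nat \<Rightarrow> nat \<Rightarrow> 'k::field vec" where
  "tail_ones m n = vec (m + n) (\<lambda>t. if t < m then 0 else 1)"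

lemma tail_ones_simps [simp]:
  "tail_ones m n \<in> carrier_vec (m + n)" "dim_vec (tail_ones m n) = m + n"
  "t < m + n \<Longrightarrow> tail_ones m n $ t = (if t < m then 0 else 1)"
  by (simp_all add: tail_ones_def)

text \<open>
  For \<open>m \<le> n\<close>, let \<open>P\<^sub>i\<close> be the object \<open>0 \<rightarrow> K\<P> e\<^sub>i\<close> and \<open>P\<^sub>0\<close> the object \<open>K \<rightarrow> K\<P>\<close>, \<open>1 \<mapsto> \<one>\<close>, in the
  category of linear maps from vector spaces to projective modules over the incidence algebra. A
  morphism from \<open>P\<^sub>1 \<oplus> \<dots> \<oplus> P\<^sub>m \<oplus> P\<^sub>0\<close> to \<open>P\<^sub>1 \<oplus> \<dots> \<oplus> P\<^sub>k \<oplus> P\<^sub>0\<close> is a matrix subject to the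
  incidence condition that multiplies the image \<open>(0, \<dots>, 0, 1, \<dots>, 1)\<close> of \<open>1 \<in> K\<close> by a scalar.
\<close>

definition rep_hom :: "nat \<Rightarrow> nat rel \<Rightarrow> nat \<Rightarrow> nat \<Rightarrow> 'k::field mat set" where
  "rep_hom n r k m = {M \<in> carrier_mat (k + n) (m + n).
     (\<forall>a<k + n. \<forall>b<m + n. M $$ (a, b) \<noteq> 0 \<longrightarrow> (label m b, label k a) \<in> r) \<and>
     (\<exists>c. M *\<^sub>v tail_ones m n = c \<cdot>\<^sub>v tail_ones k n)}"

definition rep_alg :: "nat \<Rightarrow> nat rel \<Rightarrow> nat \<Rightarrow> ('k::field, 'k mat) module" where
  "rep_alg n r m =
     \<lparr>carrier = rep_hom n r m m, mult = (*), one = 1\<^sub>m (m + n),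
      zero = 0\<^sub>m (m + n) (m + n), add = (+), smult = (\<cdot>\<^sub>m)\<rparr>"

lemma rep_alg_simps [simp]:
  "carrier (rep_alg n r m) = rep_hom n r m m" "mult (rep_alg n r m) = (*)"
  "one (rep_alg n r m) = 1\<^sub>m (m + n)" "zero (rep_alg n r m) = 0\<^sub>m (m + n) (m + n)"
  "add (rep_alg n r m) = (+)" "smult (rep_alg n r m) = (\<cdot>\<^sub>m)"
  by (simp_all add: rep_alg_def)

lemma rep_homD:
  assumes "M \<in> rep_hom n r k m"
  shows "M \<in> carrier_mat (k + n) (m + n)"
    "a < k + n \<Longrightarrow> b < m + n \<Longrightarrow> M $$ (a, b) \<noteq> 0 \<Longrightarrow> (label m b, label k a) \<in> r"
  using assms unfolding rep_hom_def by auto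

lemma rep_homI:
  assumes "M \<in> carrier_mat (k + n) (m + n)"
    "\<And>a b. a < k + n \<Longrightarrow> b < m + n \<Longrightarrow> M $$ (a, b) \<noteq> 0 \<Longrightarrow> (label m b, label k a) \<in> r"
    "M *\<^sub>v tail_ones m n = c \<cdot>\<^sub>v tail_ones k n"
  shows "M \<in> rep_hom n r k m"
  using assms unfolding rep_hom_def by auto

lemma mult_tail_ones:
  assumes "M \<in> carrier_mat k (m + n)" "a < k"
  shows "(M *\<^sub>v tail_ones m n) $ a = (\<Sum>i<n. M $$ (a, m + i))"
proof -
  have "(M *\<^sub>v tail_ones m n) $ a = (\<Sum>i<m + n. M $$ (a, i) * (if i < m then 0 else 1))"
    using assms by (auto simp: scalar_prod_def lessThan_atLeast0 intro!: sum.cong)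
  also have "\<dots> = (\<Sum>i<n. M $$ (a, m + i))"
    by (simp add: sum_lessThan_add)
  finally show ?thesis .
qed

lemma rep_hom_mult:
  assumes "trans r" and M: "M \<in> rep_hom n r k l" and N: "N \<in> rep_hom n r l m"
  shows "M * N \<in> rep_hom n r k m"
proof -
  note cM = rep_homD(1)[OF M] and cN = rep_homD(1)[OF N]
  obtain c d where cd: "M *\<^sub>v tail_ones l n = c \<cdot>\<^sub>v tail_ones k n"
      "N *\<^sub>v tail_ones m n = d \<cdot>\<^sub>v tail_ones l n"
    using M N unfolding rep_hom_def by blast
  show ?thesis
  proof (rule rep_homI)
    fix a b assume ab: "a < k + n" "b < m + n" and "(M * N) $$ (a, b) \<noteq> 0"
    then obtain i where "i < l + n" "M $$ (a, i) \<noteq> 0" "N $$ (i, b) \<noteq> 0"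
      by (rule mult_mat_nonzero[OF cM cN])
    then show "(label m b, label k a) \<in> r"
      using rep_homD(2)[OF M] rep_homD(2)[OF N] ab \<open>trans r\<close> by (meson transD)
  next
    show "(M * N) *\<^sub>v tail_ones m n = (d * c) \<cdot>\<^sub>v tail_ones k n"
      using cM cN cd by (simp add: assoc_mult_mat_vec[OF cM cN] mult_mat_vec[OF cM] smult_smult_assoc)
  qed (use cM cN in simp)
qed

lemma rep_hom_add:
  assumes M: "M \<in> rep_hom n r k m" and N: "N \<in> rep_hom n r k m"
  shows "M + N \<in> rep_hom n r k m"
proof -
  note cM = rep_homD(1)[OF M] and cN = rep_homD(1)[OF N]
  obtain c d where cd: "M *\<^sub>v tail_ones m n = c \<cdot>\<^sub>v tail_ones k n"
      "N *\<^sub>v tail_ones m n = d \<cdot>\<^sub>v tail_ones k n"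
    using M N unfolding rep_hom_def by blast
  show ?thesis
  proof (rule rep_homI)
    show "(M + N) *\<^sub>v tail_ones m n = (c + d) \<cdot>\<^sub>v tail_ones k n"
      using cM cN cd by (simp add: add_mult_distrib_mat_vec[OF cM cN] add_smult_distrib_vec)
  next
    fix a b assume ab: "a < k + n" "b < m + n" "(M + N) $$ (a, b) \<noteq> 0"
    then have "M $$ (a, b) \<noteq> 0 \<or> N $$ (a, b) \<noteq> 0" using cM cN by auto
    then show "(label m b, label k a) \<in> r" using ab rep_homD(2)[OF M] rep_homD(2)[OF N] by blast
  qed (use cM cN in simp)
qed

lemma rep_hom_smult:
  assumes M: "M \<in> rep_hom n r k m"
  shows "x \<cdot>\<^sub>m M \<in> rep_hom n r k m"
proof -
  note cM = rep_homD(1)[OF M]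
  obtain c where c: "M *\<^sub>v tail_ones m n = c \<cdot>\<^sub>v tail_ones k n"
    using M unfolding rep_hom_def by blast
  show ?thesis
  proof (rule rep_homI)
    have "(x \<cdot>\<^sub>m M) *\<^sub>v tail_ones m n = x \<cdot>\<^sub>v (M *\<^sub>v tail_ones m n)"
      using cM by (intro eq_vecI) auto
    then show "(x \<cdot>\<^sub>m M) *\<^sub>v tail_ones m n = (x * c) \<cdot>\<^sub>v tail_ones k n"
      by (simp add: c smult_smult_assoc)
  next
    fix a b assume ab: "a < k + n" "b < m + n" "(x \<cdot>\<^sub>m M) $$ (a, b) \<noteq> 0"
    then show "(label m b, label k a) \<in> r" using cM by (intro rep_homD(2)[OF M]) auto
  qed (use cM in simp)
qed

lemma rep_hom_zero: "0\<^sub>m (k + n) (m + n) \<in> rep_hom n r k m"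
  by (rule rep_homI[where c = 0]) auto

lemma rep_hom_eqI:
  assumes M: "M \<in> rep_hom n r k m" and N: "N \<in> rep_hom n r k m"
    and "\<And>a b. a < k + n \<Longrightarrow> b < m + n \<Longrightarrow> (label m b, label k a) \<in> r \<Longrightarrow> M $$ (a, b) = N $$ (a, b)"
  shows "M = N"
proof (rule eq_matI)
  fix a b assume "a < dim_row N" "b < dim_col N"
  then have ab: "a < k + n" "b < m + n" using rep_homD(1)[OF N] by auto
  show "M $$ (a, b) = N $$ (a, b)"
  proof (cases "(label m b, label k a) \<in> r")
    case False
    then have "M $$ (a, b) = 0" "N $$ (a, b) = 0" using M N ab rep_homD(2) by blast+
    then show ?thesis by simp
  qed (use assms ab in auto)
qed (use rep_homD(1)[OF M] rep_homD(1)[OF N] in auto)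

locale num_poset =
  fixes n :: nat and r :: "nat rel"
  assumes n_pos: "n \<ge> 1" and poset: "partial_order_on {1..n} r"
    and r_le: "\<And>i j. (i, j) \<in> r \<Longrightarrow> i \<le> j"
    and min_initial: "min_elems n r = {1..num_min n r}"
begin

abbreviation "nm \<equiv> num_min n r"

lemma r_refl: "i \<in> {1..n} \<Longrightarrow> (i, i) \<in> r"
  using partial_order_onD(1)[OF poset] by (auto dest: refl_onD)

lemma r_trans: "trans r" using partial_order_onD(2)[OF poset] .

lemma r_antisym: "antisym r" using partial_order_onD(3)[OF poset] .

lemma r_field: "(i, j) \<in> r \<Longrightarrow> i \<in> {1..n} \<and> j \<in> {1..n}"
  using partial_order_onD(4)[OF poset] by auto

lemma label_range: "m \<le> n \<Longrightarrow> t < m + n \<Longrightarrow> label m t \<in> {1..n}"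
  by (auto simp: label_def)

lemma nm_le: "nm \<le> n"
proof -
  have "min_elems n r \<subseteq> {1..n}" by (auto simp: min_elems_def)
  then have "card (min_elems n r) \<le> card {1..n}" by (intro card_mono) auto
  then show ?thesis by (simp add: num_min_def)
qed

lemma below_min: "(i, j) \<in> r \<Longrightarrow> j \<le> nm \<Longrightarrow> i = j"
proof -
  assume "(i, j) \<in> r" "j \<le> nm"
  then have "j \<in> min_elems n r" using r_field min_initial by auto
  then show "i = j" using \<open>(i, j) \<in> r\<close> r_field by (auto simp: min_elems_def strictly_below_def)
qed

lemma ex_min_below: "j \<in> {1..n} \<Longrightarrow> \<exists>i\<in>{1..nm}. (i, j) \<in> r"
proof (induction j rule: less_induct)
  case (less j)
  show ?case
  proof (cases "j \<in> min_elems n r")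
    case True
    then show ?thesis using min_initial r_refl[OF less.prems] by auto
  next
    case False
    then obtain i where i: "i \<in> {1..n}" "strictly_below r i j"
      using less.prems by (auto simp: min_elems_def)
    then have "i < j" using r_le[of i j] by (auto simp: strictly_below_def)
    then obtain i' where "i' \<in> {1..nm}" "(i', i) \<in> r" using less.IH i by blast
    then show ?thesis using i r_trans by (meson strictly_below_def transD)
  qed
qed

lemma nm_pos: "nm \<ge> 1"
  using ex_min_below[of 1] n_pos by auto

lemma rep_hom_one: "m \<le> n \<Longrightarrow> 1\<^sub>m (m + n) \<in> rep_hom n r m m"
  by (rule rep_homI[where c = 1]) (auto intro: r_refl dest: label_range split: if_splits)

lemma k_algebra_rep_alg:
  assumes "m \<le> n"
  shows "k_algebra (rep_alg n r m :: ('k::field, 'k mat) module)"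
proof -
  let ?A = "rep_alg n r m :: ('k, 'k mat) module"
  note closed = rep_hom_add rep_hom_mult[OF r_trans] rep_hom_smult rep_hom_zero
    rep_hom_one[OF assms]
  note D = rep_homD(1)
  have neg: "\<exists>N\<in>rep_hom n r m m. N + M = 0\<^sub>m (m + n) (m + n)"
    if "M \<in> rep_hom n r m m" for M :: "'k mat"
    by (rule bexI[of _ "(-1) \<cdot>\<^sub>m M"]) (use D[OF that] in \<open>auto intro: rep_hom_smult that\<close>)
  have "abelian_group ?A"
    by (rule abelian_groupI)
      (auto simp: closed neg dest: D intro: assoc_add_mat comm_add_mat left_add_zero_mat)
  moreover have "monoid ?A"
    by (rule monoidI)
      (auto simp: closed dest: D intro: assoc_mult_mat left_mult_one_mat right_mult_one_mat)
  ultimately have "ring ?A"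
    by (rule ringI)
      (auto dest!: D intro: add_mult_distrib_mat mult_add_distrib_mat)
  then show ?thesis
    unfolding k_algebra_def k_algebra_axioms_def
    by (auto simp: closed dest!: D intro: add_smult_distrib_right_mat add_smult_distrib_left_mat
        mult_smult_assoc_mat[symmetric] mult_smult_distrib[symmetric])
qed

end

section \<open>The matrix algebra of the theorem\<close>

context num_poset
begin

lemma num_nonmin_eq: "num_nonmin n r = n - nm"
proof -
  have "card ({1..n} - {1..nm}) = n - nm"
    using nm_le by (subst card_Diff_subset) auto
  then show ?thesis by (simp add: num_nonmin_def min_initial)
qed

text \<open>
  A row labelled by a minimal element has at most its diagonal entry in the right block, and this
  entry is the row sum, which is \<open>0\<close> by the eigenvector condition. The zero block of the matrix
  algebra is therefore automatic.
\<close>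

lemma upper_right_zero:
  assumes X: "X \<in> rep_hom n r nm nm" and a: "a < nm" and b: "nm \<le> b" "b < nm + n"
  shows "X $$ (a, b) = 0"
proof -
  note cX = rep_homD(1)[OF X]
  obtain c where c: "X *\<^sub>v tail_ones nm n = c \<cdot>\<^sub>v tail_ones nm n"
    using X unfolding rep_hom_def by blast
  have only: "X $$ (a, nm + i) = 0" if "i < n" "i \<noteq> a" for i
  proof (rule ccontr)
    assume "X $$ (a, nm + i) \<noteq> 0"
    then have "(i + 1, a + 1) \<in> r" using rep_homD(2)[OF X, of a "nm + i"] that a by (simp add: label_def)
    then show False using below_min[of "i + 1" "a + 1"] a that by simp
  qed
  have "(\<Sum>i<n. X $$ (a, nm + i)) = (c \<cdot>\<^sub>v tail_ones nm n) $ a"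
    using mult_tail_ones[OF cX, of a] a by (simp add: c)
  also have "\<dots> = 0" using a by simp
  also have "(\<Sum>i<n. X $$ (a, nm + i)) = X $$ (a, nm + a)"
    using a nm_le only by (subst sum.remove[of _ a]) (auto intro!: sum.neutral)
  finally have "X $$ (a, nm + a) = 0" .
  then show ?thesis using only[of "b - nm"] b by (cases "b - nm = a") auto
qed

lemma rep_hom_triangular:
  assumes X: "X \<in> rep_hom n r nm nm" and ab: "a < nm + n" "b < nm + n" and nz: "X $$ (a, b) \<noteq> 0"
  shows "b \<le> a"
proof -
  have "label nm b \<le> label nm a" using rep_homD(2)[OF X ab nz] r_le by blast
  moreover have "\<not> (a < nm \<and> nm \<le> b)" using upper_right_zero[OF X] ab nz by blast
  ultimately show ?thesis by (auto simp: label_def split: if_splits)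
qed

text \<open>
  In the lower right block, all diagonal entries at minimal elements agree: each of them is the only
  entry of its row, so it equals the eigenvalue. This is why only one simple module belongs to all
  of them.
\<close>

lemma rep_hom_min_diagonal:
  assumes X: "X \<in> rep_hom n r nm nm" and c: "X *\<^sub>v tail_ones nm n = c \<cdot>\<^sub>v tail_ones nm n"
    and a: "nm \<le> a" "a < nm + nm"
  shows "X $$ (a, a) = c"
proof -
  note cX = rep_homD(1)[OF X]
  have only: "X $$ (a, nm + i) = 0" if "i < n" "i \<noteq> a - nm" for i
  proof (rule ccontr)
    assume "X $$ (a, nm + i) \<noteq> 0"
    then have "(i + 1, a - nm + 1) \<in> r"
      using rep_homD(2)[OF X, of a "nm + i"] that a nm_le by (simp add: label_def)
    moreover have "a - nm + 1 \<le> nm" using a by simp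
    ultimately show False using below_min[of "i + 1" "a - nm + 1"] that by simp
  qed
  have "c = (\<Sum>i<n. X $$ (a, nm + i))"
    using mult_tail_ones[OF cX, of a] a nm_le by (simp add: c)
  also have "\<dots> = X $$ (a, nm + (a - nm))"
    using a nm_le only by (subst sum.remove[of _ "a - nm"]) (auto intro!: sum.neutral)
  finally show ?thesis using a by simp
qed

lemma four_block_in_rep_hom:
  assumes D: "D \<in> diagonal_mats nm" and D': "D' \<in> diagonal_mats nm"
    and Z: "Z \<in> Z_mats n r" and M: "M \<in> incidence_algebra_ones n r"
  shows "four_block_mat D (0\<^sub>m nm n) (D' @\<^sub>r Z) M \<in> rep_hom n r nm nm" (is "?X \<in> _")
proof -
  have cD: "D \<in> carrier_mat nm nm" "\<And>a b. a < nm \<Longrightarrow> b < nm \<Longrightarrow> a \<noteq> b \<Longrightarrow> D $$ (a, b) = 0"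
    using D by (auto simp: diagonal_mats_def diagonal_mat_def)
  have cD': "D' \<in> carrier_mat nm nm" "\<And>a b. a < nm \<Longrightarrow> b < nm \<Longrightarrow> a \<noteq> b \<Longrightarrow> D' $$ (a, b) = 0"
    using D' by (auto simp: diagonal_mats_def diagonal_mat_def)
  have cZ: "Z \<in> carrier_mat (n - nm) nm"
    using Z by (auto simp: Z_mats_def num_nonmin_eq)
  have rZ: "(b + 1, a + 1 + nm) \<in> r" if "a < n - nm" "b < nm" "Z $$ (a, b) \<noteq> 0" for a b
  proof -
    have "\<forall>j\<in>{1..n - nm}. \<forall>i\<in>{1..nm}. Z $$ (j - 1, i - 1) \<noteq> 0 \<longrightarrow> (i, j + nm) \<in> r"
      using Z by (simp add: Z_mats_def num_nonmin_eq)
    from this[rule_format, of "a + 1" "b + 1"] show ?thesis using that by simp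
  qed
  have cM: "M \<in> carrier_mat n n" using M by (auto simp: incidence_algebra_ones_def incidence_algebra_def)
  have rM: "(b + 1, a + 1) \<in> r" if "a < n" "b < n" "M $$ (a, b) \<noteq> 0" for a b
  proof -
    have "\<forall>j\<in>{1..n}. \<forall>i\<in>{1..n}. M $$ (j - 1, i - 1) \<noteq> 0 \<longrightarrow> (i, j) \<in> r"
      using M by (simp add: incidence_algebra_ones_def incidence_algebra_def)
    from this[rule_format, of "a + 1" "b + 1"] show ?thesis using that by simp
  qed
  obtain c where c: "M *\<^sub>v all_ones n = c \<cdot>\<^sub>v all_ones n"
    using M by (auto simp: incidence_algebra_ones_def)
  have row: "(\<Sum>i<n. M $$ (a, i)) = c" if a: "a < n" for a
  proof -
    have "(M *\<^sub>v all_ones n) $ a = (\<Sum>i<n. M $$ (a, i))"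
      using cM a by (auto simp: scalar_prod_def all_ones_def lessThan_atLeast0 intro!: sum.cong)
    moreover have "(c \<cdot>\<^sub>v all_ones n) $ a = c" using a by (simp add: all_ones_def)
    ultimately show ?thesis by (simp only: c)
  qed
  have app: "(D' @\<^sub>r Z) $$ (a, b) = (if a < nm then D' $$ (a, b) else Z $$ (a - nm, b))"
    if "a < n" "b < nm" for a b
    using that cD' cZ by (auto simp: append_rows_def)
  have dapp: "D' @\<^sub>r Z \<in> carrier_mat n nm"
    using carrier_append_rows[OF cD'(1) cZ] nm_le by simp
  have cX: "?X \<in> carrier_mat (nm + n) (nm + n)"
    using cD cM by (intro four_block_carrier_mat) auto
  have idx: "?X $$ (a, b) = (if a < nm then if b < nm then D $$ (a, b) else 0
      else if b < nm then (D' @\<^sub>r Z) $$ (a - nm, b) else M $$ (a - nm, b - nm))"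
    if "a < nm + n" "b < nm + n" for a b
    using that cD cM by (subst index_mat_four_block) auto
  show ?thesis
  proof (rule rep_homI)
    fix a b assume ab: "a < nm + n" "b < nm + n" and nz: "?X $$ (a, b) \<noteq> 0"
    consider "a < nm" "b < nm" | "a < nm" "nm \<le> b" | "nm \<le> a" "b < nm" | "nm \<le> a" "nm \<le> b"
      by linarith
    then show "(label nm b, label nm a) \<in> r"
    proof cases
      case 1
      then have "a = b" using nz ab cD(2)[of a b] by (auto simp: idx)
      then show ?thesis using r_refl[OF label_range[OF nm_le ab(1)]] by simp
    next
      case 3
      then show ?thesis
      proof (cases "a - nm < nm")
        case True
        then have "D' $$ (a - nm, b) \<noteq> 0" using nz 3 ab by (simp add: idx app)
        then have "a - nm = b" using True 3 cD'(2) by blast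
        then show ?thesis using 3 r_refl[OF label_range[OF nm_le ab(1)]] by (simp add: label_def)
      next
        case False
        then have "Z $$ (a - nm - nm, b) \<noteq> 0" using nz 3 ab by (simp add: idx app)
        then show ?thesis using rZ[of "a - nm - nm" b] 3 False ab by (simp add: label_def)
      qed
    next
      case 4
      then show ?thesis using rM[of "a - nm" "b - nm"] nz ab by (simp add: idx label_def)
    qed (use nz ab idx in auto)
  next
    show "?X *\<^sub>v tail_ones nm n = c \<cdot>\<^sub>v tail_ones nm n"
    proof (rule eq_vecI)
      fix a assume "a < dim_vec (c \<cdot>\<^sub>v tail_ones nm n)"
      then have a: "a < nm + n" by simp
      have "(?X *\<^sub>v tail_ones nm n) $ a = (\<Sum>i<n. ?X $$ (a, nm + i))"
        by (rule mult_tail_ones[OF cX a])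
      also have "\<dots> = (if a < nm then 0 else c)"
        using a row[of "a - nm"] by (auto simp: idx)
      finally show "(?X *\<^sub>v tail_ones nm n) $ a = (c \<cdot>\<^sub>v tail_ones nm n) $ a"
        using a by simp
    qed (use cX in auto)
  qed (rule cX)
qed

lemma rep_hom_four_block:
  assumes X: "X \<in> rep_hom n r nm nm"
  shows "X \<in> L'_mats n r"
proof -
  note cX = rep_homD(1)[OF X] and rX = rep_homD(2)[OF X]
  obtain c where c: "X *\<^sub>v tail_ones nm n = c \<cdot>\<^sub>v tail_ones nm n"
    using X unfolding rep_hom_def by blast
  define D where "D = mat nm nm (\<lambda>(a, b). X $$ (a, b))"
  define D' where "D' = mat nm nm (\<lambda>(a, b). X $$ (nm + a, b))"
  define Z where "Z = mat (n - nm) nm (\<lambda>(a, b). X $$ (nm + nm + a, b))"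
  define M where "M = mat n n (\<lambda>(a, b). X $$ (nm + a, nm + b))"
  note defs = D_def D'_def Z_def M_def
  have "D \<in> diagonal_mats nm"
  proof -
    have "X $$ (a, b) = 0" if ab: "a < nm" "b < nm" "a \<noteq> b" for a b
      using rX[of a b] ab below_min[of "b + 1" "a + 1"] by (auto simp: label_def)
    then show ?thesis by (auto simp: D_def diagonal_mats_def diagonal_mat_def)
  qed
  moreover have "D' \<in> diagonal_mats nm"
  proof -
    have "X $$ (nm + a, b) = 0" if ab: "a < nm" "b < nm" "a \<noteq> b" for a b
      using rX[of "nm + a" b] ab below_min[of "b + 1" "a + 1"] nm_le by (auto simp: label_def)
    then show ?thesis by (auto simp: D'_def diagonal_mats_def diagonal_mat_def)
  qed
  moreover have "Z \<in> Z_mats n r"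
  proof -
    have "(i, j + nm) \<in> r"
      if "j \<in> {1..n - nm}" "i \<in> {1..nm}" "X $$ (nm + nm + (j - 1), i - 1) \<noteq> 0" for i j
    proof -
      have "nm + nm + (j - 1) < nm + n" "i - 1 < nm + n" using that(1,2) by auto
      from rX[OF this that(3)] show ?thesis using that(1,2) by (simp add: label_def add_ac split: if_splits)
    qed
    then show ?thesis by (auto simp: Z_def Z_mats_def num_nonmin_eq)
  qed
  moreover have "M \<in> incidence_algebra_ones n r"
  proof -
    have "(i, j) \<in> r" if "j \<in> {1..n}" "i \<in> {1..n}" "X $$ (nm + (j - 1), nm + (i - 1)) \<noteq> 0" for i j
      using rX[OF _ _ that(3)] that(1,2) by (auto simp: label_def)
    moreover have "M *\<^sub>v all_ones n = c \<cdot>\<^sub>v all_ones n"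
    proof (rule eq_vecI)
      fix a assume "a < dim_vec (c \<cdot>\<^sub>v all_ones n)"
      then have a: "a < n" by (simp add: all_ones_def)
      have "(M *\<^sub>v all_ones n) $ a = (\<Sum>i<n. X $$ (nm + a, nm + i))"
        using a by (auto simp: M_def scalar_prod_def all_ones_def lessThan_atLeast0 intro!: sum.cong)
      also have "\<dots> = c" using mult_tail_ones[OF cX, of "nm + a"] a by (simp add: c)
      finally show "(M *\<^sub>v all_ones n) $ a = (c \<cdot>\<^sub>v all_ones n) $ a"
        using a by (simp add: all_ones_def)
    qed (simp_all add: M_def all_ones_def)
    ultimately show ?thesis
      by (auto simp: M_def incidence_algebra_ones_def incidence_algebra_def)
  qed
  moreover have "X = four_block_mat D (0\<^sub>m nm n) (D' @\<^sub>r Z) M"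
  proof (rule eq_matI)
    fix a b
    assume "a < dim_row (four_block_mat D (0\<^sub>m nm n) (D' @\<^sub>r Z) M)"
      "b < dim_col (four_block_mat D (0\<^sub>m nm n) (D' @\<^sub>r Z) M)"
    then have ab: "a < nm + n" "b < nm + n" by (simp_all add: D_def M_def)
    show "X $$ (a, b) = four_block_mat D (0\<^sub>m nm n) (D' @\<^sub>r Z) M $$ (a, b)"
      using ab upper_right_zero[OF X, of a b]
      by (subst index_mat_four_block) (auto simp: D_def M_def append_rows_def D'_def Z_def)
  qed (use cX in \<open>auto simp: D_def M_def\<close>)
  ultimately show ?thesis unfolding L'_mats_def by blast
qed

text \<open>
  The diagonal blocks and \<open>Z\<close> are the incidence condition for the columns labelled by minimal
  elements, so both conditions on the blocks are instances of the uniform description.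
\<close>

lemma L'_algebra_eq: "L'_algebra n r = rep_alg n r nm"
proof -
  have "L'_mats n r = rep_hom n r nm nm"
    using four_block_in_rep_hom rep_hom_four_block unfolding L'_mats_def by blast
  then show ?thesis by (simp add: L'_algebra_def rep_alg_def)
qed

definition min_below :: "nat \<Rightarrow> nat" where
  "min_below j = (SOME i. i < nm \<and> (i + 1, j + 1) \<in> r)"

lemma min_below:
  assumes "j < n"
  shows "min_below j < nm" "(min_below j + 1, j + 1) \<in> r"
proof -
  obtain i where "i \<in> {1..nm}" "(i, j + 1) \<in> r" using ex_min_below[of "j + 1"] assms by auto
  then have "\<exists>i. i < nm \<and> (i + 1, j + 1) \<in> r" by (intro exI[of _ "i - 1"]) auto
  from someI_ex[OF this] show "min_below j < nm" "(min_below j + 1, j + 1) \<in> r"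
    unfolding min_below_def by auto
qed

text \<open>
  \<open>J\<close> and \<open>J'\<close> are the inclusion of \<open>P\<^sub>1 \<oplus> \<dots> \<oplus> P\<^bsub>nm\<^esub> \<oplus> P\<^sub>0\<close> into
  \<open>P\<^sub>1 \<oplus> \<dots> \<oplus> P\<^sub>n \<oplus> P\<^sub>0\<close> and the projection onto it, and \<open>Je = J J'\<close>. The complement is the sum of
  the \<open>P\<^sub>j\<close> with \<open>j\<close> not minimal; \<open>Jq\<close> embeds it into \<open>P\<^sub>0\<close> by the columns of the incidence
  algebra, and \<open>Jp1 - Jp2\<close> splits this embedding. A map out of \<open>P\<^sub>0\<close> into the \<open>P\<^sub>j\<close> needs row sums
  \<open>0\<close>, so row \<open>j\<close> has the entry \<open>1\<close> at \<open>j\<close> and \<open>-1\<close> at a minimal element below \<open>j\<close>.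
\<close>

abbreviation "J \<equiv> sel_mat (n + n) (nm + n) (\<lambda>a. a < nm \<or> n \<le> a) (\<lambda>a. if a < n then a else nm + (a - n))"
abbreviation "J' \<equiv> sel_mat (nm + n) (n + n) (\<lambda>a. True) (\<lambda>b. if b < nm then b else n + (b - nm))"
abbreviation "Je \<equiv> sel_mat (n + n) (n + n) (\<lambda>a. a < nm \<or> n \<le> a) (\<lambda>a. a)"
abbreviation "Jq \<equiv> sel_mat (n + n) (n + n) (\<lambda>a. n + nm \<le> a) (\<lambda>a. a - n)"
abbreviation "Jp1 \<equiv> sel_mat (n + n) (n + n) (\<lambda>a. nm \<le> a \<and> a < n) (\<lambda>a. n + a)"
abbreviation "Jp2 \<equiv> sel_mat (n + n) (n + n) (\<lambda>a. nm \<le> a \<and> a < n) (\<lambda>a. n + min_below a)"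

lemma J_hom: "(J :: 'k::field mat) \<in> rep_hom n r n nm"
proof (rule rep_homI[where c = 1])
  fix a b assume "a < n + n" "b < nm + n" "J $$ (a, b) \<noteq> (0::'k)"
  then show "(label nm b, label n a) \<in> r"
    using nm_le by (auto simp: label_def intro!: r_refl split: if_splits)
qed (rule sel_mat_carrier, rule eq_vecI, subst sel_mat_mult_vec, auto)

lemma J'_hom: "(J' :: 'k::field mat) \<in> rep_hom n r nm n"
proof (rule rep_homI[where c = 1])
  fix a b assume "a < nm + n" "b < n + n" "J' $$ (a, b) \<noteq> (0::'k)"
  then show "(label n b, label nm a) \<in> r"
    using nm_le by (auto simp: label_def intro!: r_refl split: if_splits)
qed (rule sel_mat_carrier, rule eq_vecI, subst sel_mat_mult_vec, use nm_le in auto)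

lemma Jq_hom: "(Jq :: 'k::field mat) \<in> rep_hom n r n n"
proof (rule rep_homI[where c = 0])
  fix a b assume "a < n + n" "b < n + n" "Jq $$ (a, b) \<noteq> (0::'k)"
  then show "(label n b, label n a) \<in> r"
    using nm_le by (auto simp: label_def intro!: r_refl split: if_splits)
qed (rule sel_mat_carrier, rule eq_vecI, subst sel_mat_mult_vec, auto)

lemma Jp_hom: "(Jp1 - Jp2 :: 'k::field mat) \<in> rep_hom n r n n"
proof (rule rep_homI[where c = 0])
  fix a b assume "a < n + n" "b < n + n" "(Jp1 - Jp2) $$ (a, b) \<noteq> (0::'k)"
  then show "(label n b, label n a) \<in> r"
    using nm_le min_below[of a] by (auto simp: label_def intro!: r_refl split: if_splits)
next
  have "(Jp1 - Jp2) *\<^sub>v tail_ones n n = Jp1 *\<^sub>v tail_ones n n - Jp2 *\<^sub>v (tail_ones n n :: 'k vec)"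
    by (rule minus_mult_distrib_mat_vec) auto
  moreover have "(Jp1 *\<^sub>v tail_ones n n) $ a = (if nm \<le> a \<and> a < n then 1 else 0 :: 'k)"
    if "a < n + n" for a
    using that by (subst sel_mat_mult_vec) auto
  moreover have "(Jp2 *\<^sub>v tail_ones n n) $ a = (if nm \<le> a \<and> a < n then 1 else 0 :: 'k)"
    if "a < n + n" for a
    using that less_le_trans[OF min_below(1) nm_le, of a]
    by (subst sel_mat_mult_vec) (auto intro: less_le_trans[OF min_below(1) nm_le])
  ultimately show "(Jp1 - Jp2) *\<^sub>v tail_ones n n = (0::'k) \<cdot>\<^sub>v tail_ones n n"
    by (intro eq_vecI) (simp_all del: index_mult_mat_vec)
qed (auto intro: minus_carrier_mat)

lemma J_products:
  "J * J' = (Je :: 'k::field mat)" "J' * J = (1\<^sub>m (nm + n) :: 'k mat)"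
  "Je * Je = (Je :: 'k mat)" "Je * Jq = (Jq :: 'k mat)"
  "(Jp1 - Jp2) * Je = (Jp1 - Jp2 :: 'k mat)"
  "Je * Je + (Jp1 - Jp2) * Jq = (1\<^sub>m (n + n) :: 'k mat)"
proof -
  have mb: "n + min_below a < n + n" "min_below a < nm" if "a < n" for a
    using min_below(1)[OF that] nm_le by simp_all
  have nmb: "\<not> nm \<le> min_below a" if "a < n" for a
    using min_below(1)[OF that] by simp
  note sm = sel_mat_mult[OF sel_mat_carrier(1)]
  have p1: "(Jp1 * Y) $$ (a, b) = (if nm \<le> a \<and> a < n then Y $$ (n + a, b) else 0)"
    if "Y \<in> carrier_mat (n + n) (n + n)" "a < n + n" "b < n + n" for Y :: "'k mat" and a b
    using that by (subst sel_mat_mult[where c = "n + n"]) auto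
  have p2: "(Jp2 * Y) $$ (a, b) = (if nm \<le> a \<and> a < n then Y $$ (n + min_below a, b) else 0)"
    if "Y \<in> carrier_mat (n + n) (n + n)" "a < n + n" "b < n + n" for Y :: "'k mat" and a b
    using that mb by (subst sel_mat_mult[where c = "n + n"]) auto
  show "J * J' = (Je :: 'k mat)"
    by (rule eq_matI, subst sm) (use nm_le in auto)
  show "J' * J = (1\<^sub>m (nm + n) :: 'k mat)"
    by (rule eq_matI, subst sm) (use nm_le in auto)
  show ee: "Je * Je = (Je :: 'k mat)"
    by (rule eq_matI, subst sm) auto
  show "Je * Jq = (Jq :: 'k mat)"
    by (rule eq_matI, subst sm) auto
  have "(Jp1 - Jp2) * Je = Jp1 * Je - Jp2 * (Je :: 'k mat)"
    by (rule minus_mult_distrib_mat) auto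
  then show "(Jp1 - Jp2) * Je = (Jp1 - Jp2 :: 'k mat)"
    by (intro eq_matI) (use mb in \<open>auto simp: p1 p2 simp del: index_mult_mat(1)\<close>)
  have "(Jp1 - Jp2) * Jq = Jp1 * Jq - Jp2 * (Jq :: 'k mat)"
    by (rule minus_mult_distrib_mat) auto
  then show "Je * Je + (Jp1 - Jp2) * Jq = (1\<^sub>m (n + n) :: 'k mat)"
    unfolding ee
    by (intro eq_matI) (use mb in \<open>auto simp: p1 p2 nmb not_le simp del: index_mult_mat(1)\<close>)
qed

end

lemma full_corner_alg_iso:
  assumes fc: "full_corner D B \<iota> p q" and iso: "alg_iso D C g" and C: "k_algebra C"
  shows "full_corner C B (g \<circ> \<iota>) (g \<circ> p) (g \<circ> q)"
proof -
  interpret D: full_corner D B \<iota> p q by (rule fc)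
  interpret C: k_algebra C by (rule C)
  note iso = alg_isoD[OF iso]
  have bij: "bij_betw (g \<circ> \<iota>) (carrier B)
      {x \<in> carrier C. (g \<circ> \<iota>) \<one>\<^bsub>B\<^esub> \<otimes>\<^bsub>C\<^esub> x = x \<and> x \<otimes>\<^bsub>C\<^esub> (g \<circ> \<iota>) \<one>\<^bsub>B\<^esub> = x}"
  proof (rule bij_betw_trans[OF D.\<iota>_bij])
    let ?S = "{x \<in> carrier D. D.e \<otimes>\<^bsub>D\<^esub> x = x \<and> x \<otimes>\<^bsub>D\<^esub> D.e = x}"
    have "inj_on g ?S" using iso(1) by (auto simp: bij_betw_def inj_on_def)
    moreover have "g ` ?S = {x \<in> carrier C. g D.e \<otimes>\<^bsub>C\<^esub> x = x \<and> x \<otimes>\<^bsub>C\<^esub> g D.e = x}"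
    proof (intro equalityI subsetI)
      fix x assume "x \<in> {x \<in> carrier C. g D.e \<otimes>\<^bsub>C\<^esub> x = x \<and> x \<otimes>\<^bsub>C\<^esub> g D.e = x}"
      then have x: "x \<in> carrier C" "g D.e \<otimes>\<^bsub>C\<^esub> x = x" "x \<otimes>\<^bsub>C\<^esub> g D.e = x" by auto
      then obtain y where y: "y \<in> carrier D" "x = g y"
        using iso(1) by (auto simp: bij_betw_def)
      have "D.e \<otimes>\<^bsub>D\<^esub> y = y" "y \<otimes>\<^bsub>D\<^esub> D.e = y"
        using x y by (auto intro!: iso(13) simp: iso(4))
      then show "x \<in> g ` ?S" using y by blast
    qed (auto simp: iso(2) iso(4)[symmetric])
    ultimately show "bij_betw g ?S
      {x \<in> carrier C. (g \<circ> \<iota>) \<one>\<^bsub>B\<^esub> \<otimes>\<^bsub>C\<^esub> x = x \<and> x \<otimes>\<^bsub>C\<^esub> (g \<circ> \<iota>) \<one>\<^bsub>B\<^esub> = x}"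
      by (simp add: bij_betw_def)
  qed
  show ?thesis
  proof (unfold_locales)
    show "(g \<circ> p) False \<otimes>\<^bsub>C\<^esub> (g \<circ> q) False \<oplus>\<^bsub>C\<^esub> (g \<circ> p) True \<otimes>\<^bsub>C\<^esub> (g \<circ> q) True = \<one>\<^bsub>C\<^esub>"
      using D.pq by (simp add: iso(4,6,10)[symmetric] D.p_closed D.q_closed)
  qed (use bij in \<open>auto simp: D.\<iota>_add D.\<iota>_mult D.\<iota>_smult D.\<iota>_closed iso(2,8)
        iso(4,6)[symmetric] D.p_closed D.q_closed D.p_e D.e_q\<close>)
qed

lemma assoc_mult_mat_dim:
  fixes A B C :: "'a::semiring_0 mat"
  assumes "dim_col A = dim_row B" "dim_col B = dim_row C"
  shows "A * B * C = A * (B * C)"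
  by (rule assoc_mult_mat[of _ "dim_row A" "dim_row B" _ "dim_row C" _ "dim_col C"])
    (use assms in \<open>auto intro: carrier_matI\<close>)

context num_poset
begin

text \<open>
  Conjugation \<open>X \<mapsto> J X J'\<close> has the inverse \<open>Y \<mapsto> J' Y J\<close> on the corner of \<open>Je = J J'\<close>, as
  \<open>J' J = 1\<close>; both preserve the algebras since \<open>J\<close> and \<open>J'\<close> are morphisms.
\<close>

lemma full_corner_rep_alg:
  "full_corner (rep_alg n r n) (rep_alg n r nm :: ('k::field, 'k mat) module)
    (\<lambda>X. J * X * J') (\<lambda>b. if b then Jp1 - Jp2 else Je) (\<lambda>b. if b then Jq else Je)"
proof -
  let ?\<iota> = "\<lambda>X :: 'k mat. J * X * J'"
  interpret D: k_algebra "rep_alg n r n :: ('k, 'k mat) module"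
    by (rule k_algebra_rep_alg) simp
  interpret B: k_algebra "rep_alg n r nm :: ('k, 'k mat) module"
    by (rule k_algebra_rep_alg[OF nm_le])
  note assoc = assoc_mult_mat_dim
  have one: "?\<iota> (1\<^sub>m (nm + n)) = Je"
    by (simp add: right_mult_one_mat[OF sel_mat_carrier(1)] J_products(1))
  have \<iota>_hom: "?\<iota> X \<in> rep_hom n r n n" if "X \<in> rep_hom n r nm nm" for X
    by (rule rep_hom_mult[OF r_trans rep_hom_mult[OF r_trans J_hom that] J'_hom])
  have Je: "(Je :: 'k mat) \<in> rep_hom n r n n"
    unfolding J_products(1)[symmetric] by (rule rep_hom_mult[OF r_trans J_hom J'_hom])
  have J'J: "J' * (J * Y) = Y" if "Y \<in> carrier_mat (nm + n) c" for Y :: "'k mat" and c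
    using that J_products(2)[where 'k = 'k]
    by (subst assoc[symmetric]) auto
  have JeJ: "Je * (Je * Y) = Je * Y" if "dim_row Y = n + n" for Y :: "'k mat"
    using that by (subst assoc[symmetric]) (auto simp: J_products(3))
  have J'\<iota>: "J' * ?\<iota> X * J = X" if X: "X \<in> carrier_mat (nm + n) (nm + n)" for X
  proof -
    have "J' * ?\<iota> X * J = J' * (J * (X * (J' * J)))"
      using carrier_matD[OF X] by (simp add: assoc)
    also have "\<dots> = J' * (J * X)"
      using X by (simp only: J_products(2)) simp
    finally show ?thesis by (simp only: J'J[OF X])
  qed
  have \<iota>J': "?\<iota> (J' * Y * J) = Je * Y * Je" if Y: "Y \<in> carrier_mat (n + n) (n + n)" for Y
  proof -
    have "Je * Y * Je = J * J' * Y * (J * J')" by (simp only: J_products)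
    also have "\<dots> = ?\<iota> (J' * Y * J)"
      using carrier_matD[OF Y] by (simp add: assoc)
    finally show ?thesis by simp
  qed
  have bij: "bij_betw ?\<iota> (rep_hom n r nm nm) {x \<in> rep_hom n r n n. Je * x = x \<and> x * Je = x}"
  proof (rule bij_betw_byWitness[where f' = "\<lambda>Y. J' * Y * J"])
    show "\<forall>X\<in>rep_hom n r nm nm. J' * ?\<iota> X * J = X"
      using J'\<iota> rep_homD(1) by blast
    show "\<forall>Y\<in>{x \<in> rep_hom n r n n. Je * x = x \<and> x * Je = x}. ?\<iota> (J' * Y * J) = Y"
      using \<iota>J' rep_homD(1) by fastforce
    show "?\<iota> ` rep_hom n r nm nm \<subseteq> {x \<in> rep_hom n r n n. Je * x = x \<and> x * Je = x}"
    proof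
      fix x assume "x \<in> ?\<iota> ` rep_hom n r nm nm"
      then obtain X where x: "x = ?\<iota> X" and X: "X \<in> rep_hom n r nm nm" by blast
      note cX = rep_homD(1)[OF X] and cx = rep_homD(1)[OF \<iota>_hom[OF X], folded x]
      have x': "Je * x * Je = x" using \<iota>J'[OF cx] J'\<iota>[OF cX] x by simp
      have "Je * (Je * x * Je) = Je * x * Je" "Je * x * Je * Je = Je * x * Je"
        using carrier_matD[OF cx] by (simp_all add: assoc JeJ J_products(3))
      then show "x \<in> {x \<in> rep_hom n r n n. Je * x = x \<and> x * Je = x}"
        unfolding x' using x X \<iota>_hom by simp
    qed
    show "(\<lambda>Y. J' * Y * J) ` {x \<in> rep_hom n r n n. Je * x = x \<and> x * Je = x}
        \<subseteq> rep_hom n r nm nm"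
    proof
      fix x assume "x \<in> (\<lambda>Y. J' * Y * J) ` {x \<in> rep_hom n r n n. Je * x = x \<and> x * Je = x}"
      then obtain Y where "x = J' * Y * J" and Y: "Y \<in> rep_hom n r n n" by blast
      then show "x \<in> rep_hom n r nm nm"
        using rep_hom_mult[OF r_trans rep_hom_mult[OF r_trans J'_hom Y] J_hom] by simp
    qed
  qed
  have mult: "?\<iota> (X * Y) = ?\<iota> X * ?\<iota> Y"
    if X: "X \<in> carrier_mat (nm + n) (nm + n)" and Y: "Y \<in> carrier_mat (nm + n) (nm + n)" for X Y
  proof -
    have "?\<iota> X * ?\<iota> Y = J * (X * (J' * (J * (Y * J'))))"
      using carrier_matD[OF X] carrier_matD[OF Y] by (simp add: assoc)
    also have "J' * (J * (Y * J')) = Y * J'"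
      by (rule J'J[of _ "n + n"]) (use carrier_matD[OF Y] in \<open>auto intro: carrier_matI\<close>)
    also have "J * (X * (Y * J')) = ?\<iota> (X * Y)"
      using carrier_matD[OF X] carrier_matD[OF Y] by (simp add: assoc)
    finally show ?thesis by simp
  qed
  have add: "?\<iota> (X + Y) = ?\<iota> X + ?\<iota> Y"
    if X: "X \<in> carrier_mat (nm + n) (nm + n)" and Y: "Y \<in> carrier_mat (nm + n) (nm + n)" for X Y
    unfolding mult_add_distrib_mat[OF sel_mat_carrier(1) X Y]
    by (rule add_mult_distrib_mat[of _ "n + n" "nm + n" _ _ "n + n"])
      (use carrier_matD[OF X] carrier_matD[OF Y] in \<open>auto intro: carrier_matI\<close>)
  have smult: "?\<iota> (c \<cdot>\<^sub>m X) = c \<cdot>\<^sub>m ?\<iota> X"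
    if X: "X \<in> carrier_mat (nm + n) (nm + n)" for X c
    unfolding mult_smult_distrib[OF sel_mat_carrier(1) X]
    by (rule mult_smult_assoc_mat[of _ "n + n" "nm + n" _ "n + n"])
      (use carrier_matD[OF X] in \<open>auto intro: carrier_matI\<close>)
  show ?thesis
    unfolding full_corner_def full_corner_axioms_def
    using D.k_algebra_axioms B.k_algebra_axioms bij J_products(4,5,6)[where 'k = 'k] Je
      Jp_hom[where 'k = 'k] Jq_hom[where 'k = 'k]
    by (auto simp: J_products(1,3) intro!: add mult smult intro: rep_homD(1))
qed

end

section \<open>A basic set of primitive idempotents\<close>

lemma triangular_mult_diag:
  fixes X Y :: "'k::field mat"
  assumes X: "X \<in> carrier_mat N N" and Y: "Y \<in> carrier_mat N N"
    and tX: "\<And>a b. a < N \<Longrightarrow> b < N \<Longrightarrow> X $$ (a, b) \<noteq> 0 \<Longrightarrow> b \<le> a"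
    and tY: "\<And>a b. a < N \<Longrightarrow> b < N \<Longrightarrow> Y $$ (a, b) \<noteq> 0 \<Longrightarrow> b \<le> a"
    and t: "t < N"
  shows "(X * Y) $$ (t, t) = X $$ (t, t) * Y $$ (t, t)"
proof -
  have zero: "X $$ (t, i) * Y $$ (i, t) = 0" if "i < N" "i \<noteq> t" for i
  proof (rule ccontr)
    assume "X $$ (t, i) * Y $$ (i, t) \<noteq> 0"
    then have "i \<le> t" "t \<le> i" using tX[of t i] tY[of i t] that t by auto
    then show False using that by simp
  qed
  have "(X * Y) $$ (t, t) = (\<Sum>i<N. X $$ (t, i) * Y $$ (i, t))"
    by (rule index_mult_mat_sum[OF X Y t t])
  also have "\<dots> = X $$ (t, t) * Y $$ (t, t) + (\<Sum>i\<in>{..<N} - {t}. X $$ (t, i) * Y $$ (i, t))"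
    using t by (intro sum.remove) auto
  also have "(\<Sum>i\<in>{..<N} - {t}. X $$ (t, i) * Y $$ (i, t)) = 0"
    by (rule sum.neutral, rule ballI, rule zero) auto
  finally show ?thesis by simp
qed

text \<open>
  A strictly triangular matrix is nilpotent. Since \<open>X = X X\<close>, an entry on a lower subdiagonal is a
  sum of products of entries on higher ones.
\<close>

lemma triangular_idempotent_zero:
  fixes X :: "'k::field mat"
  assumes X: "X \<in> carrier_mat N N" and id: "X * X = X"
    and tX: "\<And>a b. a < N \<Longrightarrow> b < N \<Longrightarrow> X $$ (a, b) \<noteq> 0 \<Longrightarrow> b \<le> a"
    and diag: "\<And>a. a < N \<Longrightarrow> X $$ (a, a) = 0"
  shows "X = 0\<^sub>m N N"
proof (rule eq_matI)
  fix a b assume "a < dim_row (0\<^sub>m N N :: 'k mat)" "b < dim_col (0\<^sub>m N N :: 'k mat)"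
  then have "a < N" "b < N" by auto
  then have "X $$ (a, b) = 0"
  proof (induction "a - b" arbitrary: a b rule: less_induct)
    case less
    have "X $$ (a, i) * X $$ (i, b) = 0" if i: "i < N" for i
    proof (rule ccontr)
      assume "X $$ (a, i) * X $$ (i, b) \<noteq> 0"
      then have nz: "X $$ (a, i) \<noteq> 0" "X $$ (i, b) \<noteq> 0" by auto
      then have "i \<le> a" "b \<le> i" using tX i less.prems by auto
      moreover have "b \<noteq> i" using nz diag i by auto
      ultimately have "a - i < a - b" by simp
      then show False using less.hyps[of a i] nz i less.prems by simp
    qed
    then have "(X * X) $$ (a, b) = 0"
      using less.prems by (subst index_mult_mat_sum[OF X X]) (auto intro: sum.neutral)
    then show ?case by (simp only: id)
  qed
  then show "X $$ (a, b) = 0\<^sub>m N N $$ (a, b)" using \<open>a < N\<close> \<open>b < N\<close> by simp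
qed (use X in auto)

text \<open>
  With \<open>u = \<phi> e\<close> and \<open>\<phi> w = f\<close>, the isomorphism gives \<open>\<phi> (u w) = u f = u = \<phi> e\<close>. For matrices, the
  factorisation \<open>e = (u f) w\<close> is refuted by a diagonal entry, a character, that vanishes on \<open>f\<close> but
  not on \<open>e\<close>.
\<close>

lemma left_ideal_iso_factor:
  assumes B: "k_algebra B" and e: "idempotent B e" and f: "idempotent B f"
    and iso: "\<phi> \<in> mod_iso B (left_ideal_module B e) (left_ideal_module B f)"
  obtains u w where "u \<in> carrier B" "w \<in> carrier B" "u \<otimes>\<^bsub>B\<^esub> f = u" "e = u \<otimes>\<^bsub>B\<^esub> w"
proof -
  interpret B: k_algebra B by (rule B)
  have ec: "e \<in> carrier B" "e \<otimes>\<^bsub>B\<^esub> e = e" and fc: "f \<in> carrier B" "f \<otimes>\<^bsub>B\<^esub> f = f"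
    using e f by (auto simp: idempotent_def)
  have e_in: "e \<in> carrier (left_ideal_module B e)"
    using ec image_eqI[of e "\<lambda>x. x \<otimes>\<^bsub>B\<^esub> e" e "carrier B"] by (simp add: left_ideal_module_def)
  have f_in: "f \<in> carrier (left_ideal_module B f)"
    using fc image_eqI[of f "\<lambda>x. x \<otimes>\<^bsub>B\<^esub> f" f "carrier B"] by (simp add: left_ideal_module_def)
  have hom: "\<phi> \<in> mod_hom B (left_ideal_module B e) (left_ideal_module B f)"
    and bij: "bij_betw \<phi> (carrier (left_ideal_module B e)) (carrier (left_ideal_module B f))"
    using iso by (auto simp: mod_iso_def)
  have lin: "\<phi> (a \<otimes>\<^bsub>B\<^esub> x) = a \<otimes>\<^bsub>B\<^esub> \<phi> x"
    if "a \<in> carrier B" "x \<in> carrier (left_ideal_module B e)" for a x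
    using mod_homD(3)[OF hom that] by (simp add: left_ideal_module_def)
  have "\<phi> e \<in> carrier (left_ideal_module B f)" using bij e_in by (auto simp: bij_betw_def)
  then obtain u0 where u0: "u0 \<in> carrier B" "\<phi> e = u0 \<otimes>\<^bsub>B\<^esub> f"
    by (auto simp: left_ideal_module_def)
  then have uc: "\<phi> e \<in> carrier B" "\<phi> e \<otimes>\<^bsub>B\<^esub> f = \<phi> e" using fc by (simp_all add: B.m_assoc)
  have "f \<in> \<phi> ` carrier (left_ideal_module B e)"
    using f_in by (simp only: bij_betw_imp_surj_on[OF bij])
  then obtain w where w: "w \<in> carrier (left_ideal_module B e)" "\<phi> w = f"
    by (metis imageE)
  have wc: "w \<in> carrier B" using w(1) ec by (auto simp: left_ideal_module_def)
  have uw: "\<phi> e \<otimes>\<^bsub>B\<^esub> w \<in> carrier (left_ideal_module B e)"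
  proof -
    obtain w0 where "w0 \<in> carrier B" "w = w0 \<otimes>\<^bsub>B\<^esub> e"
      using w(1) by (auto simp: left_ideal_module_def)
    then have "\<phi> e \<otimes>\<^bsub>B\<^esub> w = (\<phi> e \<otimes>\<^bsub>B\<^esub> w0) \<otimes>\<^bsub>B\<^esub> e" "\<phi> e \<otimes>\<^bsub>B\<^esub> w0 \<in> carrier B"
      using uc(1) ec by (simp_all add: B.m_assoc)
    then show ?thesis by (auto simp: left_ideal_module_def)
  qed
  have "\<phi> (\<phi> e \<otimes>\<^bsub>B\<^esub> w) = \<phi> e"
    unfolding lin[OF uc(1) w(1)] w(2) by (rule uc(2))
  then have "\<phi> e \<otimes>\<^bsub>B\<^esub> w = e"
    using inj_onD[OF bij_betw_imp_inj_on[OF bij] _ uw e_in] by blast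
  then show thesis using that[OF uc(1) wc uc(2)] by simp
qed

context num_poset
begin

text \<open>
  In the upper left block, the idempotents are the matrix units. In the lower right block, the unit
  at a nonminimal \<open>j\<close> must be corrected by \<open>-1\<close> at a minimal element below \<open>j\<close> to have constant row
  sums; the index \<open>nm\<close> stands for what remains of the unit of this block. It cannot be split
  further because the diagonal entries at the minimal elements agree.
\<close>

definition prim :: "nat \<Rightarrow> 'k::field mat" where
  "prim t = (if t = nm
     then sel_mat (nm + n) (nm + n) (\<lambda>a. nm \<le> a)
            (\<lambda>a. if a < nm + nm then a else nm + min_below (a - nm))
     else sel_mat (nm + n) (nm + n) (\<lambda>a. a = t) (\<lambda>a. a) -
          sel_mat (nm + n) (nm + n) (\<lambda>a. a = t \<and> nm + nm \<le> a) (\<lambda>a. nm + min_below (a - nm)))"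

definition prim_index :: "nat set" where
  "prim_index = {..nm} \<union> {nm + nm..<nm + n}"

lemma finite_prim_index: "finite prim_index"
  by (simp add: prim_index_def)

lemma prim_index_less: "t \<in> prim_index \<Longrightarrow> t < nm + n"
  using n_pos by (auto simp: prim_index_def)

lemma nm_index: "nm \<in> prim_index"
  by (simp add: prim_index_def)

lemma prim_carrier: "prim t \<in> carrier_mat (nm + n) (nm + n)"
  by (simp add: prim_def minus_carrier_mat)

lemma prim_dims [simp]: "dim_row (prim t) = nm + n" "dim_col (prim t) = nm + n"
  using carrier_matD[OF prim_carrier[of t]] by auto

lemma min_below_bounds:
  assumes "nm \<le> a" "a < nm + n"
  shows "nm + min_below (a - nm) < nm + n" "min_below (a - nm) < nm"
proof -
  have "a - nm < n" using assms by simp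
  from min_below(1)[OF this] show "nm + min_below (a - nm) < nm + n" "min_below (a - nm) < nm"
    using nm_le by simp_all
qed

lemma prim_mult_index:
  assumes Y: "Y \<in> carrier_mat (nm + n) (nm + n)" and ab: "a < nm + n" "b < nm + n"
  shows "(prim t * Y) $$ (a, b) = (if t = nm
     then if nm \<le> a then Y $$ (if a < nm + nm then a else nm + min_below (a - nm), b) else 0
     else (if a = t then Y $$ (a, b) else 0) -
       (if a = t \<and> nm + nm \<le> a then Y $$ (nm + min_below (a - nm), b) else 0))"
proof (cases "t = nm")
  case True
  then have p: "prim t = sel_mat (nm + n) (nm + n) (\<lambda>a. nm \<le> a)
      (\<lambda>a. if a < nm + nm then a else nm + min_below (a - nm))"
    by (simp add: prim_def)
  show ?thesis
    unfolding p using True ab min_below_bounds by (subst sel_mat_mult[OF Y]) auto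
next
  case False
  have "prim t * Y = sel_mat (nm + n) (nm + n) (\<lambda>a. a = t) (\<lambda>a. a) * Y -
      sel_mat (nm + n) (nm + n) (\<lambda>a. a = t \<and> nm + nm \<le> a) (\<lambda>a. nm + min_below (a - nm)) * Y"
    using False Y by (simp add: prim_def minus_mult_distrib_mat[of _ "nm + n" "nm + n"])
  moreover have "(sel_mat (nm + n) (nm + n) (\<lambda>a. a = t) (\<lambda>a. a) * Y) $$ (a, b) =
      (if a = t then Y $$ (a, b) else 0)"
    using ab by (subst sel_mat_mult[OF Y]) auto
  moreover have "(sel_mat (nm + n) (nm + n) (\<lambda>a. a = t \<and> nm + nm \<le> a)
      (\<lambda>a. nm + min_below (a - nm)) * Y) $$ (a, b) =
      (if a = t \<and> nm + nm \<le> a then Y $$ (nm + min_below (a - nm), b) else 0)"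
    using ab min_below_bounds by (subst sel_mat_mult[OF Y]) auto
  ultimately show ?thesis
    using ab Y False by (simp del: index_mult_mat(1))
qed

lemma prim_index_entry:
  assumes ab: "a < nm + n" "b < nm + n"
  shows "prim t $$ (a, b) = (if t = nm
     then if nm \<le> a \<and> b = (if a < nm + nm then a else nm + min_below (a - nm)) then 1 else 0
     else (if a = t \<and> b = a then 1 else 0) -
       (if a = t \<and> nm + nm \<le> a \<and> b = nm + min_below (a - nm) then 1 else 0))"
  using ab by (simp add: prim_def)

lemma prim_products:
  assumes "s \<in> prim_index" "t \<in> prim_index"
  shows "prim s * (prim t :: 'k::field mat) = (if s = t then prim s else 0\<^sub>m (nm + n) (nm + n))"
proof (rule eq_matI)
  fix a b
  assume "a < dim_row (if s = t then prim s else 0\<^sub>m (nm + n) (nm + n))"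
    "b < dim_col (if s = t then prim s else 0\<^sub>m (nm + n) (nm + n))"
  then have ab: "a < nm + n" "b < nm + n"
    by (auto split: if_splits)
  have mb: "nm \<le> a \<longrightarrow> min_below (a - nm) < nm \<and> min_below (a - nm) < n"
    using min_below_bounds[of a] ab by auto
  have "(prim s * (prim t :: 'k mat)) $$ (a, b) = (if s = nm
     then if nm \<le> a then (prim t :: 'k mat) $$ (if a < nm + nm then a else nm + min_below (a - nm), b) else 0
     else (if a = s then prim t $$ (a, b) else 0) -
       (if a = s \<and> nm + nm \<le> a then prim t $$ (nm + min_below (a - nm), b) else 0))"
    by (rule prim_mult_index[OF prim_carrier ab])
  also have "\<dots> = (if s = t then prim s else 0\<^sub>m (nm + n) (nm + n)) $$ (a, b)"
  proof (cases "s = nm")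
    case True
    then have "t < nm \<or> t = nm \<or> nm + nm \<le> t" using assms by (auto simp: prim_index_def)
    then show ?thesis
      using True ab mb by (elim disjE; cases "nm \<le> a"; cases "a < nm + nm")
        (auto simp: prim_index_entry)
  next
    case False
    then have "s < nm \<or> nm + nm \<le> s" using assms by (auto simp: prim_index_def)
    moreover have "t < nm \<or> t = nm \<or> nm + nm \<le> t" using assms by (auto simp: prim_index_def)
    ultimately show ?thesis
      using False ab mb by (elim disjE; cases "a = s"; cases "t = s")
        (auto simp: prim_index_entry)
  qed
  finally show "(prim s * (prim t :: 'k mat)) $$ (a, b) = (if s = t then prim s else 0\<^sub>m (nm + n) (nm + n)) $$ (a, b)" .
qed auto

lemma prim_in: "t \<in> prim_index \<Longrightarrow> (prim t :: 'k::field mat) \<in> rep_hom n r nm nm"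
proof (rule rep_homI[where c = "if t = nm then 1 else 0"])
  assume t: "t \<in> prim_index"
  fix a b assume ab: "a < nm + n" "b < nm + n" and "prim t $$ (a, b) \<noteq> (0::'k)"
  then have "b = a \<or> (nm + nm \<le> a \<and> b = nm + min_below (a - nm))"
    by (auto simp: prim_index_entry split: if_splits)
  then show "(label nm b, label nm a) \<in> r"
    using r_refl[OF label_range[OF nm_le ab(1)]] min_below(2)[of "a - nm"] ab by (auto simp: label_def)
next
  assume t: "t \<in> prim_index"
  show "(prim t :: 'k mat) *\<^sub>v tail_ones nm n = (if t = nm then 1 else 0) \<cdot>\<^sub>v tail_ones nm n"
  proof (rule eq_vecI)
    fix a assume "a < dim_vec ((if t = nm then 1 else 0 :: 'k) \<cdot>\<^sub>v tail_ones nm n)"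
    then have a: "a < nm + n" by simp
    have "(prim t *\<^sub>v tail_ones nm n) $ a = (\<Sum>i<n. (prim t :: 'k mat) $$ (a, nm + i))"
      by (rule mult_tail_ones[OF prim_carrier a])
    also have "\<dots> = (if t = nm \<and> nm \<le> a then 1 else 0)"
    proof (cases "nm \<le> a")
      case True
      define i where "i = a - nm"
      have i: "a = nm + i" "i < n" using a True by (auto simp: i_def)
      have mb: "min_below i < n" using min_below(1)[OF i(2)] nm_le by simp
      show ?thesis
        using i mb t by (cases "t = nm"; cases "i < nm"; cases "t = nm + i")
          (auto simp: prim_index_entry sum_subtractf prim_index_def)
    next
      case False
      then have "(prim t :: 'k mat) $$ (a, nm + i) = 0" if "i < n" for i
        using a that by (auto simp: prim_index_entry)
      then show ?thesis using False by simp
    qed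
    finally show "(prim t *\<^sub>v tail_ones nm n) $ a =
        ((if t = nm then 1 else 0 :: 'k) \<cdot>\<^sub>v tail_ones nm n) $ a"
      using a by simp
  qed auto
qed (rule prim_carrier)

lemma prim_diag:
  assumes "t \<in> prim_index" "s < nm + n"
  shows "(prim t :: 'k::field mat) $$ (s, s) = (if s = t \<or> t = nm \<and> nm \<le> s \<and> s < nm + nm then 1 else 0)"
  using assms min_below_bounds[of s] by (auto simp: prim_index_entry prim_index_def)

lemma sum_prim:
  assumes ab: "a < nm + n" "b < nm + n"
  shows "(\<Sum>t\<in>prim_index. prim t $$ (a, b)) = (1\<^sub>m (nm + n) :: 'k::field mat) $$ (a, b)"
proof -
  have "(\<Sum>t\<in>prim_index. prim t $$ (a, b)) =
      (prim nm $$ (a, b) :: 'k) + (\<Sum>t\<in>prim_index - {nm}. prim t $$ (a, b))"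
    by (rule sum.remove[OF finite_prim_index nm_index])
  also have "(\<Sum>t\<in>prim_index - {nm}. prim t $$ (a, b)) =
      (\<Sum>t\<in>prim_index - {nm}. if t = a then prim a $$ (a, b) else 0 :: 'k)"
    by (rule sum.cong) (use ab in \<open>auto simp: prim_index_entry\<close>)
  also have "\<dots> = (if a \<in> prim_index - {nm} then prim a $$ (a, b) else 0)"
    using finite_prim_index by (simp add: sum.delta')
  finally show ?thesis
    using ab min_below_bounds[of a] by (auto simp: prim_index_entry prim_index_def)
qed

lemma finsum_rep_alg_index:
  assumes "finite T" "\<And>t. t \<in> T \<Longrightarrow> f t \<in> rep_hom n r nm nm" and ab: "a < nm + n" "b < nm + n"
  shows "finsum (rep_alg n r nm :: ('k::field, 'k mat) module) f T $$ (a, b) = (\<Sum>t\<in>T. f t $$ (a, b))"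
  using assms(1,2)
proof (induction T)
  interpret B: k_algebra "rep_alg n r nm :: ('k, 'k mat) module"
    by (rule k_algebra_rep_alg[OF nm_le])
  {
    case empty
    then show ?case using ab by simp
  next
    case (insert x F)
    have f: "f \<in> F \<rightarrow> carrier (rep_alg n r nm)" using insert.prems by auto
    have "finsum (rep_alg n r nm) f F \<in> carrier (rep_alg n r nm :: ('k, 'k mat) module)"
      using f by (rule B.finsum_closed)
    then have "finsum (rep_alg n r nm) f F \<in> carrier_mat (nm + n) (nm + n)"
      by (auto dest: rep_homD(1))
    then show ?case
      using insert f ab by (simp add: B.finsum_insert)
  }
qed

lemma rep_hom_mult_diag:
  assumes X: "X \<in> rep_hom n r nm nm" and Y: "Y \<in> rep_hom n r nm nm" and t: "t < nm + n"
  shows "(X * Y) $$ (t, t) = X $$ (t, t) * Y $$ (t, t)"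
  by (rule triangular_mult_diag[OF rep_homD(1)[OF X] rep_homD(1)[OF Y] rep_hom_triangular[OF X]
        rep_hom_triangular[OF Y] t])

lemma idempotent_cases:
  assumes X: "X \<in> rep_hom n r nm nm" and id: "X * X = X" and nz: "X \<noteq> 0\<^sub>m (nm + n) (nm + n)"
  obtains s where "s < nm + n" "X $$ (s, s) = (1 :: 'k::field)"
proof -
  note cX = rep_homD(1)[OF X]
  obtain s where s: "s < nm + n" "X $$ (s, s) \<noteq> 0"
    using triangular_idempotent_zero[OF cX id rep_hom_triangular[OF X]] nz by blast
  have "X $$ (s, s) * X $$ (s, s) = X $$ (s, s)"
    using rep_hom_mult_diag[OF X X s(1)] id
    by simp
  then show thesis using s that by simp
qed

text \<open>
  If \<open>prim t = f + g\<close> with orthogonal idempotents, each diagonal entry of \<open>prim t\<close> equal to \<open>1\<close>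
  belongs to exactly one of \<open>f\<close> and \<open>g\<close>. There is either one such entry, or these entries are tied
  together by the eigenvalue, so \<open>f\<close> or \<open>g\<close> has zero diagonal and vanishes.
\<close>

lemma prim_primitive:
  assumes t: "t \<in> prim_index"
  shows "primitive_idempotent (rep_alg n r nm) (prim t :: 'k::field mat)"
proof -
  have nz: "prim t \<noteq> (0\<^sub>m (nm + n) (nm + n) :: 'k mat)"
    using prim_diag[OF t, of t, where 'k = 'k] prim_index_less[OF t] by auto
  have "False"
    if f: "f \<in> rep_hom n r nm nm" "f * f = f" "f \<noteq> 0\<^sub>m (nm + n) (nm + n)"
      and g: "g \<in> rep_hom n r nm nm" "g * g = g" "g \<noteq> 0\<^sub>m (nm + n) (nm + n)"
      and fg: "f * g = 0\<^sub>m (nm + n) (nm + n)" and sum: "prim t = f + g" for f g :: "'k mat"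
  proof -
    note cf = rep_homD(1)[OF f(1)] and cg = rep_homD(1)[OF g(1)]
    obtain s where s: "s < nm + n" "f $$ (s, s) = 1" using f by (rule idempotent_cases)
    obtain s' where s': "s' < nm + n" "g $$ (s', s') = 1" using g by (rule idempotent_cases)
    have orth: "f $$ (a, a) * g $$ (a, a) = 0" if "a < nm + n" for a
      using rep_hom_mult_diag[OF f(1) g(1) that] fg that by simp
    have diag: "prim t $$ (a, a) = f $$ (a, a) + g $$ (a, a)" if "a < nm + n" for a
      using that cf cg sum by simp
    have "g $$ (s, s) = 0" "f $$ (s', s') = 0" using orth[OF s(1)] orth[OF s'(1)] s s' by auto
    then have "prim t $$ (s, s) = (1::'k)" "prim t $$ (s', s') = (1::'k)"
      using diag[OF s(1)] diag[OF s'(1)] s s' by auto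
    then have or: "s = t \<or> t = nm \<and> nm \<le> s \<and> s < nm + nm" "s' = t \<or> t = nm \<and> nm \<le> s' \<and> s' < nm + nm"
      using prim_diag[OF t s(1), where 'k = 'k] prim_diag[OF t s'(1), where 'k = 'k]
      by (auto split: if_splits)
    have "f $$ (s, s) = f $$ (s', s')"
    proof (cases "t = nm")
      case True
      obtain c where c: "f *\<^sub>v tail_ones nm n = c \<cdot>\<^sub>v tail_ones nm n"
        using f(1) unfolding rep_hom_def by blast
      show ?thesis
        using True or nm_pos rep_hom_min_diagonal[OF f(1) c, of s]
          rep_hom_min_diagonal[OF f(1) c, of s'] by auto
    qed (use or in auto)
    then show False using \<open>f $$ (s', s') = 0\<close> s by simp
  qed
  then show ?thesis
    unfolding primitive_idempotent_def idempotent_def orthogonal_def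
    using nz prim_in[OF t, where 'k = 'k] prim_products[OF t t, where 'k = 'k] by auto
qed

text \<open>
  The diagonal entry at \<open>s\<close> is multiplicative, equal to \<open>1\<close> on \<open>prim s\<close> and \<open>0\<close> on \<open>prim t\<close>.
\<close>

lemma prim_not_iso:
  assumes s: "s \<in> prim_index" and t: "t \<in> prim_index" and "s \<noteq> t"
  shows "mod_iso (rep_alg n r nm) (left_ideal_module (rep_alg n r nm) (prim s :: 'k::field mat))
    (left_ideal_module (rep_alg n r nm) (prim t)) = {}"
proof -
  have False if iso: "\<phi> \<in> mod_iso (rep_alg n r nm) (left_ideal_module (rep_alg n r nm) (prim s :: 'k mat))
    (left_ideal_module (rep_alg n r nm) (prim t))" for \<phi>
  proof -
    have "idempotent (rep_alg n r nm) (prim s :: 'k mat)" "idempotent (rep_alg n r nm) (prim t :: 'k mat)"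
      using prim_primitive s t by (auto simp: primitive_idempotent_def)
    then obtain u w where u: "u \<in> rep_hom n r nm nm" and w: "w \<in> rep_hom n r nm nm"
      and uw: "u * prim t = (u :: 'k mat)" "prim s = u * w"
      by (rule left_ideal_iso_factor[OF k_algebra_rep_alg[OF nm_le] _ _ iso]) auto
    note mult_diag = rep_hom_mult_diag[OF _ _ prim_index_less[OF s]]
    have "u $$ (s, s) * prim t $$ (s, s) = u $$ (s, s)"
      using mult_diag[OF u prim_in[OF t]] uw(1) by simp
    moreover have "u $$ (s, s) * w $$ (s, s) = 1"
      using mult_diag[OF u w] uw(2)[symmetric] prim_diag[OF s prim_index_less[OF s], where 'k = 'k]
      by simp
    moreover have "prim t $$ (s, s) = (0 :: 'k)"
      using s t \<open>s \<noteq> t\<close> prim_diag[OF t prim_index_less[OF s], where 'k = 'k]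
      by (auto simp: prim_index_def)
    ultimately show False by simp
  qed
  then show ?thesis by blast
qed

lemma basic_rep_alg: "basic_algebra (rep_alg n r nm :: ('k::field, 'k mat) module)"
  unfolding basic_algebra_def
proof (intro conjI exI ballI impI)
  let ?B = "rep_alg n r nm :: ('k, 'k mat) module"
  let ?E = "prim ` prim_index :: 'k mat set"
  show B: "k_algebra ?B" by (rule k_algebra_rep_alg[OF nm_le])
  interpret B: k_algebra ?B by (rule B)
  show "finite ?E" using finite_prim_index by simp
  show "primitive_idempotent ?B e" if "e \<in> ?E" for e
    using that prim_primitive by auto
  show "orthogonal ?B e f" if "e \<in> ?E" "f \<in> ?E" "e \<noteq> f" for e f
    using that by (auto simp: orthogonal_def prim_products)
  show "mod_iso ?B (left_ideal_module ?B e) (left_ideal_module ?B f) = {}"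
    if "e \<in> ?E" "f \<in> ?E" "e \<noteq> f" for e f
    using that prim_not_iso by auto
  have inj: "inj_on (prim :: nat \<Rightarrow> 'k mat) prim_index"
  proof (rule inj_onI, rule ccontr)
    fix s t assume st: "s \<in> prim_index" "t \<in> prim_index" "prim s = (prim t :: 'k mat)" "s \<noteq> t"
    have "prim s = (0\<^sub>m (nm + n) (nm + n) :: 'k mat)"
      using prim_products[OF st(1,1), where 'k = 'k] prim_products[OF st(1,2), where 'k = 'k] st(3,4)
      by simp
    then show False using prim_primitive[OF st(1), where 'k = 'k] by (simp add: primitive_idempotent_def)
  qed
  have "finsum ?B (\<lambda>e. e) ?E = finsum ?B prim prim_index"
    using inj prim_in by (subst B.finsum_reindex) auto
  also have "\<dots> = 1\<^sub>m (nm + n)"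
  proof (rule eq_matI)
    have "finsum ?B prim prim_index \<in> carrier ?B"
      using prim_in by (intro B.finsum_closed) auto
    then have "finsum ?B prim prim_index \<in> carrier_mat (nm + n) (nm + n)"
      by (auto dest: rep_homD(1))
    then show "dim_row (finsum ?B prim prim_index) = dim_row (1\<^sub>m (nm + n) :: 'k mat)"
      "dim_col (finsum ?B prim prim_index) = dim_col (1\<^sub>m (nm + n) :: 'k mat)" by auto
  qed (simp add: finsum_rep_alg_index[OF finite_prim_index prim_in] sum_prim)
  finally show "finsum ?B (\<lambda>e. e) ?E = \<one>\<^bsub>?B\<^esub>" by simp
qed

end

section \<open>The path algebra and its differential\<close>

abbreviation single :: "path \<Rightarrow> 'k::field \<Rightarrow> 'k path_alg" where
  "single \<equiv> Poly_Mapping.single"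
abbreviation lookup :: "'k::field path_alg \<Rightarrow> path \<Rightarrow> 'k" where
  "lookup \<equiv> Poly_Mapping.lookup"
abbreviation keys :: "'k::field path_alg \<Rightarrow> path set" where
  "keys \<equiv> Poly_Mapping.keys"

lemma lookup_scale [simp]: "lookup (scale c x) p = c * lookup x p"
  by (auto simp: scale_def Poly_Mapping.map.rep_eq when_def)

lemma scale_simps [simp]:
  "scale c 0 = 0" "scale 0 x = 0" "scale 1 x = x" "scale c (scale d x) = scale (c * d) x"
  "scale c (single p a) = single p (c * a)" "scale c (- x) = - scale c x"
  by (rule poly_mapping_eqI; simp add: lookup_single when_def mult.assoc)+

lemma scale_add: "scale c (x + y) = scale c x + scale c y"
  by (rule poly_mapping_eqI) (simp add: lookup_add distrib_left)

lemma scale_add_left: "scale (c + d) x = scale c x + scale d x"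
  by (rule poly_mapping_eqI) (simp add: lookup_add distrib_right)

lemma scale_diff: "scale c (x - y) = scale c x - scale c y"
  by (rule poly_mapping_eqI) (simp add: lookup_minus right_diff_distrib)

lemma scale_sum: "scale c (sum f S) = (\<Sum>i\<in>S. scale c (f i))"
  by (rule poly_mapping_eqI) (simp add: lookup_sum sum_distrib_left)

lemma sum_single_lookup:
  assumes "finite S" "keys x \<subseteq> S"
  shows "(\<Sum>p\<in>S. single p (lookup x p)) = x"
proof (rule poly_mapping_eqI)
  fix q
  have "lookup (\<Sum>p\<in>S. single p (lookup x p)) q = (\<Sum>p\<in>S. if p = q then lookup x q else 0)"
    by (simp add: lookup_sum lookup_single when_def) (rule sum.cong, auto)
  also have "\<dots> = lookup x q" using assms by (auto simp: in_keys_iff)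
  finally show "lookup (\<Sum>p\<in>S. single p (lookup x p)) q = lookup x q" .
qed

lemma path_alg_induct [case_names zero single add]:
  assumes "P 0" "\<And>p c. P (single p c)" "\<And>x y. P x \<Longrightarrow> P y \<Longrightarrow> P (x + y)"
  shows "P (x :: 'k::field path_alg)"
proof -
  have "P (\<Sum>p\<in>S. single p (lookup x p))" if "finite S" for S
    using that by (induction S) (auto intro: assms)
  from this[of "keys x"] show ?thesis by (simp add: sum_single_lookup)
qed

definition lin_ext :: "(path \<Rightarrow> 'k::field path_alg) \<Rightarrow> 'k path_alg \<Rightarrow> 'k path_alg" where
  "lin_ext f x = (\<Sum>p\<in>keys x. scale (lookup x p) (f p))"

lemma lin_ext_superset:
  assumes "finite S" "keys x \<subseteq> S"
  shows "lin_ext f x = (\<Sum>p\<in>S. scale (lookup x p) (f p))"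
  unfolding lin_ext_def using assms by (intro sum.mono_neutral_left) (auto simp: in_keys_iff)

lemma lin_ext_simps [simp]:
  "lin_ext f 0 = 0" "lin_ext f (single p c) = scale c (f p)"
  by (simp add: lin_ext_def) (subst lin_ext_superset[of "{p}"], auto)

lemma lin_ext_add: "lin_ext f (x + y) = lin_ext f x + lin_ext f y"
proof -
  let ?S = "keys x \<union> keys y"
  have "lin_ext f z = (\<Sum>p\<in>?S. scale (lookup z p) (f p))" if "z \<in> {x, y, x + y}" for z
    using that keys_add[of x y] by (intro lin_ext_superset) auto
  then show ?thesis by (simp add: lookup_add scale_add_left sum.distrib)
qed

lemma lin_ext_scale: "lin_ext f (scale c x) = scale c (lin_ext f x)"
  by (induction x rule: path_alg_induct) (simp_all add: lin_ext_add scale_add)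

lemma lin_ext_uminus: "lin_ext f (- x) = - lin_ext f x"
  using lin_ext_add[of f x "- x"] by (simp add: eq_neg_iff_add_eq_0 add.commute)

lemma lin_ext_sum: "lin_ext f (sum g S) = (\<Sum>i\<in>S. lin_ext f (g i))"
  by (induction S rule: infinite_finite_induct) (simp_all add: lin_ext_add)

lemma delta_lin_ext: "delta n r = lin_ext (delta_path n r)"
  by (rule ext) (simp add: delta_def lin_ext_def)

lemma path_mult_lin_ext:
  "x \<cdot>\<^sub>T y = lin_ext (\<lambda>p. lin_ext (\<lambda>q. if snd p = path_target q
     then single (fst p @ fst q, snd q) 1 else 0) y) x"
  unfolding path_mult_def lin_ext_def scale_sum
  by (intro sum.cong refl) auto

lemma path_mult_add_left: "(x + x') \<cdot>\<^sub>T y = x \<cdot>\<^sub>T y + x' \<cdot>\<^sub>T y"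
  by (simp add: path_mult_lin_ext lin_ext_add)

lemma lin_ext_fun_add: "lin_ext (\<lambda>p. f p + g p) x = lin_ext f x + lin_ext g x"
  by (simp add: lin_ext_def scale_add sum.distrib)

lemma lin_ext_fun_scale: "lin_ext (\<lambda>p. scale c (f p)) x = scale c (lin_ext f x)"
  by (simp add: lin_ext_def scale_sum mult.commute)

lemma lin_ext_fun_zero [simp]: "lin_ext (\<lambda>p. 0) x = 0"
  by (simp add: lin_ext_def)

lemma path_mult_add_right: "x \<cdot>\<^sub>T (y + y') = x \<cdot>\<^sub>T y + x \<cdot>\<^sub>T y'"
  by (simp add: path_mult_lin_ext lin_ext_add lin_ext_fun_add)

lemma path_mult_scale_left [simp]: "scale c x \<cdot>\<^sub>T y = scale c (x \<cdot>\<^sub>T y)"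
  by (simp add: path_mult_lin_ext lin_ext_scale)

lemma path_mult_scale_right [simp]: "x \<cdot>\<^sub>T scale c y = scale c (x \<cdot>\<^sub>T y)"
  by (simp add: path_mult_lin_ext lin_ext_scale lin_ext_fun_scale)

lemma path_mult_zero [simp]: "0 \<cdot>\<^sub>T y = 0" "x \<cdot>\<^sub>T 0 = 0"
  by (simp_all add: path_mult_lin_ext)

lemma path_mult_uminus [simp]: "(- x) \<cdot>\<^sub>T y = - (x \<cdot>\<^sub>T y)" "x \<cdot>\<^sub>T (- y) = - (x \<cdot>\<^sub>T y)"
  using path_mult_add_left[of x "- x" y] path_mult_add_right[of x y "- y"]
  by (simp_all add: eq_neg_iff_add_eq_0 add.commute)

lemma path_mult_sum_left: "sum f S \<cdot>\<^sub>T y = (\<Sum>i\<in>S. f i \<cdot>\<^sub>T y)"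
  by (induction S rule: infinite_finite_induct) (simp_all add: path_mult_add_left)

lemma path_mult_sum_right: "x \<cdot>\<^sub>T sum f S = (\<Sum>i\<in>S. x \<cdot>\<^sub>T f i)"
  by (induction S rule: infinite_finite_induct) (simp_all add: path_mult_add_right)

lemma path_mult_single:
  "single p a \<cdot>\<^sub>T single q b =
     (if snd p = path_target q then single (fst p @ fst q, snd q) (a * b) else 0)"
  by (simp add: path_mult_lin_ext)

lemma path_target_append: "path_target (as @ bs, s) = path_target (as, path_target (bs, s))"
  by (cases as) auto

lemma path_mult_assoc: "x \<cdot>\<^sub>T y \<cdot>\<^sub>T z = x \<cdot>\<^sub>T (y \<cdot>\<^sub>T z)"
proof (induction x rule: path_alg_induct)
  case (single p a)
  show ?case
  proof (induction y rule: path_alg_induct)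
    case (single q b)
    show ?case
    proof (induction z rule: path_alg_induct)
      case (single s c)
      show ?case
        by (cases q) (auto simp: path_mult_single path_target_append mult.assoc)
    qed (simp_all add: path_mult_add_right)
  qed (simp_all add: path_mult_add_right path_mult_add_left)
qed (simp_all add: path_mult_add_left)

text \<open>
  The basis of \<open>A\<close> consists of \<open>E i\<close> and \<open>Al i\<close>, that of \<open>V\<close> of the paths \<open>Vp s i j\<close>: \<open>v\<^sub>i\<^sub>j\<close> for
  \<open>s = False\<close> and \<open>\<alpha>\<^sub>i v\<^sub>i\<^sub>j\<close> for \<open>s = True\<close>.
\<close>

abbreviation E :: "nat \<Rightarrow> 'k::field path_alg" where "E i \<equiv> single ([], i) 1"
abbreviation Al :: "nat \<Rightarrow> 'k::field path_alg" where "Al i \<equiv> single ([Alpha i], i) 1"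
abbreviation Vp :: "bool \<Rightarrow> nat \<Rightarrow> nat \<Rightarrow> path" where
  "Vp s i j \<equiv> (if s then ([Alpha i, Vee i j], j) else ([Vee i j], j))"
abbreviation V :: "bool \<Rightarrow> nat \<Rightarrow> nat \<Rightarrow> 'k::field path_alg" where
  "V s i j \<equiv> single (Vp s i j) 1"

lemma mult_E_lookup: "lookup (x \<cdot>\<^sub>T E i) p = (if snd p = i then lookup x p else 0)"
  by (induction x rule: path_alg_induct)
    (auto simp: path_mult_single path_mult_add_left lookup_add lookup_single when_def)

lemma T_deg_closed:
  "0 \<in> T_deg n r d"
  "x \<in> T_deg n r d \<Longrightarrow> y \<in> T_deg n r d \<Longrightarrow> x + y \<in> T_deg n r d"
  "x \<in> T_deg n r d \<Longrightarrow> - x \<in> T_deg n r d"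
  "x \<in> T_deg n r d \<Longrightarrow> scale c x \<in> T_deg n r d"
  "is_path n r p \<Longrightarrow> path_degree p = d \<Longrightarrow> single p c \<in> T_deg n r d"
proof -
  show "x \<in> T_deg n r d \<Longrightarrow> y \<in> T_deg n r d \<Longrightarrow> x + y \<in> T_deg n r d"
    using keys_add[of x y] unfolding T_deg_def by blast
qed (auto simp: T_deg_def in_keys_iff lookup_single when_def split: if_splits)

lemma T_deg_sum: "(\<And>i. i \<in> S \<Longrightarrow> f i \<in> T_deg n r d) \<Longrightarrow> sum f S \<in> T_deg n r d"
  by (induction S rule: infinite_finite_induct) (auto intro: T_deg_closed)

lemma T_deg_induct [consumes 1, case_names zero single add]:
  assumes "x \<in> T_deg n r d" "P 0"
    and single: "\<And>p c. is_path n r p \<Longrightarrow> path_degree p = d \<Longrightarrow> P (single p c)"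
    and add: "\<And>x y. x \<in> T_deg n r d \<Longrightarrow> y \<in> T_deg n r d \<Longrightarrow> P x \<Longrightarrow> P y \<Longrightarrow> P (x + y)"
  shows "P (x :: 'k::field path_alg)"
proof -
  have "P (\<Sum>p\<in>S. single p (lookup x p)) \<and> (\<Sum>p\<in>S. single p (lookup x p)) \<in> T_deg n r d"
    if "finite S" "S \<subseteq> keys x" for S
    using that
  proof (induction S)
    case (insert p S)
    then have "is_path n r p" "path_degree p = d" using assms(1) by (auto simp: T_deg_def)
    then show ?case using insert by (auto intro: T_deg_closed add single)
  qed (auto intro: T_deg_closed assms)
  from this[of "keys x"] show ?thesis by (simp add: sum_single_lookup)
qed

lemma is_path_append:
  "is_path n r (as, path_target (bs, s)) \<Longrightarrow> is_path n r (bs, s) \<Longrightarrow> is_path n r (as @ bs, s)"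
proof (induction as)
  case (Cons a as)
  then show ?case by (simp add: path_target_append)
qed simp

lemma path_degree_append [simp]: "path_degree (as @ bs, s) = path_degree (as, s') + path_degree (bs, s)"
  by (simp add: path_degree_def)

lemma T_deg_mult:
  assumes "x \<in> T_deg n r d" "y \<in> T_deg n r d'"
  shows "x \<cdot>\<^sub>T y \<in> T_deg n r (d + d')"
  using assms(1)
proof (induction x rule: T_deg_induct)
  case (single p c)
  from assms(2) show ?case
  proof (induction y rule: T_deg_induct)
    case (single q e)
    then show ?case
      using \<open>is_path n r p\<close> \<open>path_degree p = d\<close>
      by (cases p; cases q) (auto simp: path_mult_single path_degree_def intro!: T_deg_closed is_path_append)
  qed (auto simp: path_mult_add_right intro: T_deg_closed)
qed (auto simp: path_mult_add_left intro: T_deg_closed)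

lemma A_path_cases:
  assumes "is_path n r p" "path_degree p = 0"
  obtains (e) i where "i \<le> n" "p = ([], i)" | (a) i where "i \<in> {1..n}" "p = ([Alpha i], i)"
proof -
  obtain as s where p: "p = (as, s)" by (cases p)
  show thesis
  proof (cases as)
    case Nil
    then show ?thesis using assms p e by auto
  next
    case (Cons x bs)
    then obtain i where x: "x = Alpha i" using assms p by (cases x) (auto simp: path_degree_def)
    have "bs = []"
    proof (cases bs)
      case (Cons y cs)
      then show ?thesis using assms p x \<open>as = x # bs\<close> by (cases y) (auto simp: path_degree_def)
    qed
    then show ?thesis using assms p x Cons a[of i] by auto
  qed
qed

lemma V_path_cases:
  assumes "is_path n r p" "path_degree p = 1"
  obtains s i j where "i \<in> {1..n}" "j \<in> {1..n}" "strictly_below r i j" "p = Vp s i j"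
proof -
  have A0: "bs = []" if bs: "is_path n r (bs, t)" "path_degree (bs, t) = 0" "path_target (bs, t) \<noteq> 0" for bs t
    using bs(1,2) by (rule A_path_cases) (use bs(3) in auto)
  obtain as t where p: "p = (as, t)" by (cases p)
  show thesis
  proof (cases as)
    case Nil
    then show ?thesis using assms p by (simp add: path_degree_def)
  next
    case as: (Cons x bs)
    show ?thesis
    proof (cases x)
      case (Vee i j)
      then have bs: "bs = []" using A0[of bs t] assms p as by (auto simp: path_degree_def)
      have path: "is_path n r ([Vee i j], t)" using assms(1) unfolding p as bs Vee .
      show ?thesis
        by (rule that[of i j False]) (use path in \<open>auto simp: p as bs Vee\<close>)
    next
      case (Alpha i)
      then have bs: "is_path n r (bs, t)" "path_degree (bs, t) = 1"
        and tgt: "path_target (bs, t) = i" and i: "i \<in> {1..n}"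
        using assms p as by (auto simp: path_degree_def)
      have "bs \<noteq> []" using bs(2) by (auto simp: path_degree_def)
      then obtain y cs where y: "bs = y # cs" by (meson list.exhaust)
      have "y \<noteq> Alpha h" for h using tgt i y by auto
      then obtain i' j where j: "y = Vee i' j" by (meson arrow.exhaust)
      have "i' = i" using tgt y j by simp
      moreover have "cs = []" using A0[of cs t] bs y j by (auto simp: path_degree_def)
      moreover have "t = j" "j \<in> {1..n}" "strictly_below r i' j"
        using bs(1) y j \<open>cs = []\<close> by auto
      ultimately show ?thesis using that[of i j True] p as Alpha y j i by simp
    qed
  qed
qed

lemma V_is_path:
  assumes "i \<in> {1..n}" "j \<in> {1..n}" "strictly_below r i j"
  shows "is_path n r (Vp s i j)" "path_degree (Vp s i j) = 1"
  using assms by (auto simp: path_degree_def)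

lemma E_in_A: "i \<le> n \<Longrightarrow> single ([], i) c \<in> A_alg n r"
  by (rule T_deg_closed) (auto simp: path_degree_def)

lemma Al_in_A: "i \<in> {1..n} \<Longrightarrow> single ([Alpha i], i) c \<in> A_alg n r"
  by (rule T_deg_closed) (auto simp: path_degree_def)

lemma V_in_V:
  "i \<in> {1..n} \<Longrightarrow> j \<in> {1..n} \<Longrightarrow> strictly_below r i j \<Longrightarrow> single (Vp s i j) c \<in> V_bimod n r"
  by (rule T_deg_closed) (auto simp: path_degree_def)

lemma path_one_in_A: "path_one n \<in> A_alg n r"
  unfolding path_one_def by (intro T_deg_sum E_in_A) auto

lemma path_target_range: "is_path n r p \<Longrightarrow> path_target p \<le> n"
  by (cases p rule: path_target.cases) (auto elim: is_arrow.elims)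

lemma path_source_range: "is_path n r p \<Longrightarrow> snd p \<le> n"
proof (induction p rule: is_path.induct)
  case (2 n r a as s)
  then show ?case by simp
qed auto

lemma path_one_mult:
  assumes "x \<in> T_deg n r d"
  shows "path_one n \<cdot>\<^sub>T x = x" "x \<cdot>\<^sub>T path_one n = x"
proof -
  show "path_one n \<cdot>\<^sub>T x = x" using assms
  proof (induction x rule: T_deg_induct)
    case (single p c)
    then have "path_one n \<cdot>\<^sub>T single p c = (\<Sum>i=0..n. if i = path_target p then single p c else 0)"
      by (auto simp: path_one_def path_mult_sum_left path_mult_single intro!: sum.cong)
    then show ?case using path_target_range[OF single(1)] by simp
  qed (simp_all add: path_mult_add_right)
  show "x \<cdot>\<^sub>T path_one n = x" using assms
  proof (induction x rule: T_deg_induct)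
    case (single p c)
    then have "single p c \<cdot>\<^sub>T path_one n = (\<Sum>i=0..n. if i = snd p then single p c else 0)"
      by (auto simp: path_one_def path_mult_sum_right path_mult_single intro!: sum.cong)
    then show ?case using path_source_range[OF single(1)] by simp
  qed (simp_all add: path_mult_add_left)
qed

lemma lookup_A_mult_Al:
  assumes "x \<in> A_alg n r"
  shows "x \<cdot>\<^sub>T Al i = single ([Alpha i], i) (lookup x ([], 0))"
  using assms
proof (induction x rule: T_deg_induct)
  case (single p c)
  then show ?case
    by (cases rule: A_path_cases) (auto simp: path_mult_single lookup_single when_def)
qed (simp_all add: path_mult_add_left lookup_add single_add)

lemma A_mult_V:
  assumes "x \<in> A_alg n r" "k \<in> {1..n}"
  shows "x \<cdot>\<^sub>T V False k j = single (Vp False k j) (lookup x ([], k)) +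
      single (Vp True k j) (lookup x ([Alpha k], k))"
    "x \<cdot>\<^sub>T V True k j = single (Vp True k j) (lookup x ([], 0))"
proof -
  show "x \<cdot>\<^sub>T V False k j = single (Vp False k j) (lookup x ([], k)) +
      single (Vp True k j) (lookup x ([Alpha k], k))"
    using assms(1)
  proof (induction x rule: T_deg_induct)
    case (single p c)
    then show ?case
      using assms(2) by (cases rule: A_path_cases) (auto simp: path_mult_single lookup_single when_def)
  qed (simp_all add: path_mult_add_left lookup_add single_add)
  show "x \<cdot>\<^sub>T V True k j = single (Vp True k j) (lookup x ([], 0))"
    using assms(1)
  proof (induction x rule: T_deg_induct)
    case (single p c)
    then show ?case
      using assms(2) by (cases rule: A_path_cases) (auto simp: path_mult_single lookup_single when_def)
  qed (simp_all add: path_mult_add_left lookup_add single_add)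
qed

lemma A_eqI:
  assumes "x \<in> A_alg n r" "y \<in> A_alg n r"
    and "\<And>i. i \<le> n \<Longrightarrow> lookup x ([], i) = lookup y ([], i)"
    and "\<And>i. i \<in> {1..n} \<Longrightarrow> lookup x ([Alpha i], i) = lookup y ([Alpha i], i)"
  shows "x = y"
proof (rule poly_mapping_eqI)
  fix p
  show "lookup x p = lookup y p"
  proof (cases "is_path n r p \<and> path_degree p = 0")
    case True
    then have "is_path n r p" "path_degree p = 0" by auto
    then show ?thesis by (rule A_path_cases) (use assms in auto)
  next
    case False
    then have "p \<notin> keys x" "p \<notin> keys y" using assms by (auto simp: T_deg_def)
    then show ?thesis by (simp add: in_keys_iff)
  qed
qed

lemma delta_add: "delta n r (x + y) = delta n r x + delta n r y"
  by (simp add: delta_lin_ext lin_ext_add)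

lemma delta_scale: "delta n r (scale c x) = scale c (delta n r x)"
  by (simp add: delta_lin_ext lin_ext_scale)

lemma delta_zero [simp]: "delta n r 0 = 0"
  by (simp add: delta_lin_ext)

lemma delta_E [simp]: "delta n r (single ([], i) c) = 0"
  by (simp add: delta_lin_ext)

lemma delta_Al:
  "delta n r (single ([Alpha i], i) c) =
    - (\<Sum>h | h \<in> {1..n} \<and> strictly_below r h i. single (Vp True h i) c)"
  by (simp add: delta_lin_ext path_mult_sum_left path_mult_single scale_sum)

lemma delta_V_False:
  "delta n r (single (Vp False i j) c) =
    (\<Sum>k | k \<in> {1..n} \<and> strictly_below r i k \<and> strictly_below r k j.
      single (Vp False i k) c \<cdot>\<^sub>T V False k j)"
  by (simp add: delta_lin_ext path_mult_sum_left path_mult_single scale_sum)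

lemma delta_V_True:
  "delta n r (single (Vp True i j) c) =
    - (\<Sum>h | h \<in> {1..n} \<and> strictly_below r h i. single (Vp True h i) c \<cdot>\<^sub>T V False i j) +
    (\<Sum>k | k \<in> {1..n} \<and> strictly_below r i k \<and> strictly_below r k j.
      single (Vp True i k) c \<cdot>\<^sub>T V False k j)"
  by (simp add: delta_lin_ext path_mult_sum_left path_mult_sum_right path_mult_single scale_sum scale_diff)

lemma delta_A_in_V: "a \<in> A_alg n r \<Longrightarrow> delta n r a \<in> V_bimod n r"
proof (induction a rule: T_deg_induct)
  case (single p c)
  then show ?case
  proof (cases rule: A_path_cases)
    case (a i)
    then show ?thesis
      unfolding a(2) delta_Al by (intro T_deg_closed T_deg_sum V_in_V) auto
  qed (simp add: T_deg_closed)
qed (auto simp: delta_add intro: T_deg_closed)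

lemma delta_leibniz_A:
  assumes "a \<in> A_alg n r" "b \<in> A_alg n r"
  shows "delta n r (a \<cdot>\<^sub>T b) = delta n r a \<cdot>\<^sub>T b + a \<cdot>\<^sub>T delta n r b"
  using assms(1)
proof (induction a rule: T_deg_induct)
  case (single p c)
  note p = single
  from assms(2) show ?case
  proof (induction b rule: T_deg_induct)
    case (single q d)
    from p show ?case
    proof (cases rule: A_path_cases)
      case (e i)
      note p = this
      from single show ?thesis
      proof (cases rule: A_path_cases)
        case (e k)
        then show ?thesis using p by (simp add: path_mult_single)
      next
        case (a k)
        then show ?thesis using p
          by (auto simp: path_mult_single delta_Al path_mult_sum_right intro!: sum.cong)
      qed
    next
      case (a i)
      note p = this
      from single show ?thesis
      proof (cases rule: A_path_cases)
        case (e k)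
        then show ?thesis using p
          by (auto simp: path_mult_single delta_Al path_mult_sum_left intro!: sum.cong)
      next
        case (a k)
        then show ?thesis using p
          by (auto simp: path_mult_single delta_Al path_mult_sum_left path_mult_sum_right)
      qed
    qed
  qed (simp_all add: path_mult_add_right delta_add)
qed (simp_all add: path_mult_add_left delta_add)

section \<open>The left Burt-Butler algebra\<close>

text \<open>
  The bimodule \<open>V\<close> is the component of degree \<open>1\<close>; rewriting \<open>1\<close> to a successor would hide it from
  the rules about it.
\<close>

declare One_nat_def [simp del]

lemma U_bimodI [intro]: "b \<in> A_alg n r \<Longrightarrow> v \<in> V_bimod n r \<Longrightarrow> (b, v) \<in> U_bimod n r"
  by (simp add: U_bimod_def)

lemma U_bimodE:
  assumes "u \<in> U_bimod n r"
  obtains b v where "u = (b, v)" "b \<in> A_alg n r" "v \<in> V_bimod n r"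
  using assms by (auto simp: U_bimod_def)

lemma A_mult_closed: "a \<in> A_alg n r \<Longrightarrow> b \<in> T_deg n r d \<Longrightarrow> a \<cdot>\<^sub>T b \<in> T_deg n r d"
  using T_deg_mult[of a n r 0 b d] by simp

lemma mult_A_closed: "a \<in> T_deg n r d \<Longrightarrow> b \<in> A_alg n r \<Longrightarrow> a \<cdot>\<^sub>T b \<in> T_deg n r d"
  using T_deg_mult[of a n r d b 0] by simp

lemma U_closed:
  "a \<in> A_alg n r \<Longrightarrow> u \<in> U_bimod n r \<Longrightarrow> U_left n r a u \<in> U_bimod n r"
  "a \<in> A_alg n r \<Longrightarrow> u \<in> U_bimod n r \<Longrightarrow> U_right u a \<in> U_bimod n r"
  "u \<in> U_bimod n r \<Longrightarrow> w \<in> U_bimod n r \<Longrightarrow> U_add u w \<in> U_bimod n r"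
  "(0, 0) \<in> U_bimod n r" "omega n \<in> U_bimod n r"
  by (auto simp: U_bimod_def omega_def path_one_in_A
      intro!: T_deg_closed intro: A_mult_closed mult_A_closed[OF delta_A_in_V] mult_A_closed)

lemma U_left_mult:
  assumes "a \<in> A_alg n r" "a' \<in> A_alg n r" "u \<in> U_bimod n r"
  shows "U_left n r (a \<cdot>\<^sub>T a') u = U_left n r a (U_left n r a' u)"
  using assms by (cases u) (simp add: delta_leibniz_A path_mult_add_left path_mult_add_right
      path_mult_assoc add.assoc)

lemma U_left_add:
  "U_left n r a (U_add u w) = U_add (U_left n r a u) (U_left n r a w)"
  "U_left n r (a + b) u = U_add (U_left n r a u) (U_left n r b u)"
  by (cases u; cases w; simp add: path_mult_add_left path_mult_add_right delta_add add_ac)+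

lemma U_left_zero [simp]: "U_left n r 0 u = (0, 0)" "U_left n r a (0, 0) = (0, 0)"
  by (cases u) simp_all

lemma burt_butlerD:
  assumes "\<phi> \<in> burt_butler_carrier n r"
  shows "u \<in> U_bimod n r \<Longrightarrow> \<phi> u \<in> A_alg n r"
    "u \<in> U_bimod n r \<Longrightarrow> w \<in> U_bimod n r \<Longrightarrow> \<phi> (U_add u w) = \<phi> u + \<phi> w"
    "u \<in> U_bimod n r \<Longrightarrow> a \<in> A_alg n r \<Longrightarrow> \<phi> (U_right u a) = \<phi> u \<cdot>\<^sub>T a"
    "\<phi> \<in> extensional (U_bimod n r)"
  using assms unfolding burt_butler_carrier_def by (auto simp: PiE_iff)

lemma bb_zero: "\<phi> \<in> burt_butler_carrier n r \<Longrightarrow> \<phi> (0, 0) = 0"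
  using burt_butlerD(2)[of \<phi> n r "(0, 0)" "(0, 0)"] U_closed(4) by fastforce

text \<open>
  The sum defining the product of the left Burt-Butler algebra, for a representative \<open>ts\<close> of an
  element of \<open>U \<otimes>\<^sub>A U\<close>.
\<close>

definition tensor_value ::
  "nat \<Rightarrow> nat rel \<Rightarrow> ('k::field bocs_elem \<Rightarrow> 'k path_alg) \<Rightarrow> ('k bocs_elem \<Rightarrow> 'k path_alg) \<Rightarrow>
   ('k bocs_elem \<times> 'k bocs_elem) list \<Rightarrow> 'k path_alg" where
  "tensor_value n r \<psi> \<phi> ts = (\<Sum>(u1, u2)\<leftarrow>ts. \<psi> (U_left n r (\<phi> u1) u2))"

text \<open>
  Each generating relation of \<open>U \<otimes>\<^sub>A U\<close> is respected: \<open>\<phi>\<close> and \<open>\<psi>\<close> are additive, and \<open>\<phi>\<close> is right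
  linear, which is the balanced relation, because \<open>U\<close> is a left module. The latter is the Leibniz
  rule on \<open>A\<close>.
\<close>

lemma tensor_value_cong:
  assumes \<phi>: "\<phi> \<in> burt_butler_carrier n r" and \<psi>: "\<psi> \<in> burt_butler_carrier n r"
    and "tensor_eq n r ts us"
  shows "tensor_value n r \<psi> \<phi> ts = tensor_value n r \<psi> \<phi> us"
  using assms(3)
proof induction
  case (add_left u u' w)
  then show ?case
    by (simp add: tensor_value_def burt_butlerD(2)[OF \<phi>] U_left_add burt_butlerD(2)[OF \<psi>] U_closed burt_butlerD(1)[OF \<phi>])
next
  case (add_right u w w')
  then show ?case
    by (simp add: tensor_value_def U_left_add burt_butlerD(2)[OF \<psi>] U_closed burt_butlerD(1)[OF \<phi>])
next
  case (balanced u a w)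
  then show ?case
    by (simp add: tensor_value_def burt_butlerD(3)[OF \<phi>] U_left_mult burt_butlerD(1)[OF \<phi>])
qed (simp_all add: tensor_value_def bb_zero[OF \<phi>] bb_zero[OF \<psi>] add.commute)

text \<open>
  No path of \<open>V\<close> starts at \<open>0\<close>, so the arrows \<open>\<alpha>\<^sub>i\<close> of \<open>A\<close>, which end at \<open>0\<close>, annihilate \<open>V\<close> from the
  right. A right linear map on \<open>V\<close> is a linear map that respects the sources of paths.
\<close>

lemma V_source:
  assumes "is_path n r p" "path_degree p = 1"
  shows "snd p \<in> {1..n}" "single p c \<cdot>\<^sub>T E (snd p) = single p c"
  using assms by (cases rule: V_path_cases, auto simp: path_mult_single)+

definition on_V :: "('k::field bocs_elem \<Rightarrow> 'k path_alg) \<Rightarrow> 'k path_alg \<Rightarrow> 'k path_alg" where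
  "on_V \<phi> v = \<phi> (0, v)"

context
  fixes n r and \<phi> :: "'k::field bocs_elem \<Rightarrow> 'k path_alg"
  assumes \<phi>: "\<phi> \<in> burt_butler_carrier n r"
begin

lemma on_V_closed: "v \<in> V_bimod n r \<Longrightarrow> on_V \<phi> v \<in> A_alg n r"
  unfolding on_V_def using burt_butlerD(1)[OF \<phi>] by (auto intro: T_deg_closed)

lemma on_V_add: "v \<in> V_bimod n r \<Longrightarrow> w \<in> V_bimod n r \<Longrightarrow> on_V \<phi> (v + w) = on_V \<phi> v + on_V \<phi> w"
  unfolding on_V_def using burt_butlerD(2)[OF \<phi>, of "(0, v)" "(0, w)"] by (auto intro: T_deg_closed)

lemma on_V_mult: "v \<in> V_bimod n r \<Longrightarrow> a \<in> A_alg n r \<Longrightarrow> on_V \<phi> (v \<cdot>\<^sub>T a) = on_V \<phi> v \<cdot>\<^sub>T a"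
  unfolding on_V_def using burt_butlerD(3)[OF \<phi>, of "(0, v)" a] by (auto intro: T_deg_closed)

lemma on_V_zero [simp]: "on_V \<phi> 0 = 0"
  unfolding on_V_def by (rule bb_zero[OF \<phi>])

lemma on_V_scale:
  assumes "v \<in> V_bimod n r"
  shows "on_V \<phi> (scale c v) = scale c (on_V \<phi> v)"
proof -
  have "scale c v = v \<cdot>\<^sub>T scale c (path_one n)" using assms by (simp add: path_one_mult)
  also have "on_V \<phi> \<dots> = on_V \<phi> v \<cdot>\<^sub>T scale c (path_one n)"
    by (rule on_V_mult) (auto intro: assms T_deg_closed path_one_in_A)
  also have "\<dots> = scale c (on_V \<phi> v)" using on_V_closed[OF assms] by (simp add: path_one_mult)
  finally show ?thesis .
qed

lemma on_V_uminus: "v \<in> V_bimod n r \<Longrightarrow> on_V \<phi> (- v) = - on_V \<phi> v"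
  using on_V_add[of v "- v"] by (simp add: T_deg_closed eq_neg_iff_add_eq_0 add.commute)

lemma on_V_sum: "(\<And>i. i \<in> S \<Longrightarrow> f i \<in> V_bimod n r) \<Longrightarrow> on_V \<phi> (sum f S) = (\<Sum>i\<in>S. on_V \<phi> (f i))"
  by (induction S rule: infinite_finite_induct) (simp_all add: on_V_add T_deg_sum)

lemma on_V_single:
  "is_path n r p \<Longrightarrow> path_degree p = 1 \<Longrightarrow> on_V \<phi> (single p c) = scale c (on_V \<phi> (single p 1))"
  using on_V_scale[of "single p 1" c] by (simp add: T_deg_closed)

lemma on_V_mult_E:
  assumes "v \<in> V_bimod n r" "v \<cdot>\<^sub>T E j = v" "j \<le> n"
  shows "on_V \<phi> v \<cdot>\<^sub>T E j = on_V \<phi> v"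
  using on_V_mult[OF assms(1) E_in_A[OF assms(3), of 1]] assms(2) by simp

text \<open>
  \<open>U = \<omega> A \<oplus> V\<close> as a right module.
\<close>

lemma bb_eq:
  assumes "b \<in> A_alg n r" "v \<in> V_bimod n r"
  shows "\<phi> (b, v) = \<phi> (omega n) \<cdot>\<^sub>T b + on_V \<phi> v"
proof -
  have "(b, v) = U_add (U_right (omega n) b) (0, v)"
    using assms by (simp add: omega_def path_one_mult)
  then show ?thesis
    unfolding on_V_def using assms
    by (simp only: burt_butlerD(2)[OF \<phi> U_closed(2)[OF _ U_closed(5)] U_bimodI] burt_butlerD(3)[OF \<phi> U_closed(5)]
      T_deg_closed)
qed

lemma on_V_single_E:
  assumes "is_path n r p" "path_degree p = 1"
  shows "on_V \<phi> (single p c) \<cdot>\<^sub>T E (snd p) = on_V \<phi> (single p c)"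
  using V_source[OF assms] assms by (intro on_V_mult_E) (auto intro: T_deg_closed)

end

text \<open>
  The map \<open>x y \<mapsto> \<psi> (\<phi> (x) y)\<close> on \<open>T\<^sub>2 = V \<otimes>\<^sub>A V\<close>, given on paths by splitting off the arrow that is
  traversed first. The tensor decomposition of \<open>\<delta> v\<close> in the comultiplication is arbitrary, and this
  map shows that the choice does not matter.
\<close>

definition two_step ::
  "('k::field bocs_elem \<Rightarrow> 'k path_alg) \<Rightarrow> ('k bocs_elem \<Rightarrow> 'k path_alg) \<Rightarrow> 'k path_alg \<Rightarrow> 'k path_alg" where
  "two_step \<psi> \<phi> = lin_ext (\<lambda>p. on_V \<psi>
     (on_V \<phi> (single (butlast (fst p), arrow_target (last (fst p))) 1) \<cdot>\<^sub>T single ([last (fst p)], snd p) 1))"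

text \<open>
  By bilinearity, \<open>x\<close> and \<open>y\<close> are paths. If they do not compose, then \<open>\<phi> (x) y = \<phi> (x) e\<^sub>j y = 0\<close> for
  the source \<open>j\<close> of \<open>x\<close>. If they do, then \<open>y\<close> ends at a vertex different from \<open>0\<close>, hence is a single
  arrow.
\<close>

lemma two_step_mult:
  assumes \<phi>: "\<phi> \<in> burt_butler_carrier n r" and \<psi>: "\<psi> \<in> burt_butler_carrier n r"
    and x: "x \<in> V_bimod n r" and y: "y \<in> V_bimod n r"
  shows "two_step \<psi> \<phi> (x \<cdot>\<^sub>T y) = on_V \<psi> (on_V \<phi> x \<cdot>\<^sub>T y)"
  using x
proof (induction x rule: T_deg_induct)
  case (single p c)
  note p = single
  from y show ?case
  proof (induction y rule: T_deg_induct)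
    case (single q d)
    note q = single
    have vp: "on_V \<phi> (single p c) \<in> A_alg n r" "on_V \<phi> (single p 1) \<in> A_alg n r"
      using p by (auto intro!: on_V_closed[OF \<phi>] T_deg_closed)
    show ?case
    proof (cases "snd p = path_target q")
      case False
      have "on_V \<phi> (single p c) \<cdot>\<^sub>T single q d = on_V \<phi> (single p c) \<cdot>\<^sub>T E (snd p) \<cdot>\<^sub>T single q d"
        using on_V_single_E[OF \<phi> p] by simp
      also have "\<dots> = 0" using False by (simp add: path_mult_assoc path_mult_single)
      finally show ?thesis using False by (simp add: path_mult_single two_step_def on_V_zero[OF \<psi>])
    next
      case True
      have "snd p \<noteq> 0" using V_source(1)[OF p] by auto
      then have "path_target q \<noteq> 0" using True by simp
      with q obtain i j where q_eq: "q = ([Vee i j], j)"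
        by (elim V_path_cases) (auto split: if_splits)
      then obtain as where p_eq: "p = (as, i)" using True by (cases p) auto
      have "on_V \<psi> (on_V \<phi> (single p c) \<cdot>\<^sub>T single q d) =
          on_V \<psi> (scale (c * d) (on_V \<phi> (single p 1) \<cdot>\<^sub>T single q 1))"
        using path_mult_scale_right[of "on_V \<phi> (single p 1)" d "single q 1"]
        unfolding on_V_single[OF \<phi> p, of c] by simp
      also have "\<dots> = scale (c * d) (on_V \<psi> (on_V \<phi> (single p 1) \<cdot>\<^sub>T single q 1))"
        using vp q by (intro on_V_scale[OF \<psi>] A_mult_closed T_deg_closed) auto
      finally show ?thesis
        by (simp add: p_eq q_eq path_mult_single two_step_def)
    qed
  qed (use p in \<open>simp_all add: path_mult_add_right two_step_def lin_ext_add on_V_zero[OF \<psi>]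
      on_V_add[OF \<psi>] A_mult_closed on_V_closed[OF \<phi>] T_deg_closed\<close>)
qed (use y in \<open>simp_all add: path_mult_add_left two_step_def lin_ext_add on_V_zero[OF \<phi>] on_V_zero[OF \<psi>]
      on_V_add[OF \<phi>] on_V_add[OF \<psi>] A_mult_closed on_V_closed[OF \<phi>] T_deg_closed\<close>)

lemma two_step_sum_list:
  assumes \<phi>: "\<phi> \<in> burt_butler_carrier n r" and \<psi>: "\<psi> \<in> burt_butler_carrier n r"
    and "set ds \<subseteq> V_bimod n r \<times> V_bimod n r"
  shows "two_step \<psi> \<phi> (\<Sum>(x, y)\<leftarrow>ds. x \<cdot>\<^sub>T y) = (\<Sum>(x, y)\<leftarrow>ds. on_V \<psi> (on_V \<phi> x \<cdot>\<^sub>T y))"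
  using assms(3)
proof (induction ds)
  case Nil
  then show ?case by (simp add: two_step_def)
next
  case (Cons d ds)
  then show ?case
    using two_step_mult[OF \<phi> \<psi>, of "fst d" "snd d"]
    by (cases d) (auto simp: two_step_def lin_ext_add)
qed

text \<open>
  The sums of products of elements of \<open>V\<close>, that is, the image of \<open>V \<otimes>\<^sub>A V\<close>. As \<open>\<delta> v\<close> is one of them,
  the comultiplication has a representative.
\<close>

definition decomposable :: "nat \<Rightarrow> nat rel \<Rightarrow> 'k::field path_alg \<Rightarrow> bool" where
  "decomposable n r z \<longleftrightarrow>
     (\<exists>ds. set ds \<subseteq> V_bimod n r \<times> V_bimod n r \<and> (\<Sum>(x, y)\<leftarrow>ds. x \<cdot>\<^sub>T y) = z)"

lemma decomposable:
  "decomposable n r 0"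
  "decomposable n r z \<Longrightarrow> decomposable n r w \<Longrightarrow> decomposable n r (z + w)"
  "x \<in> V_bimod n r \<Longrightarrow> y \<in> V_bimod n r \<Longrightarrow> decomposable n r (x \<cdot>\<^sub>T y)"
proof -
  show "decomposable n r 0" unfolding decomposable_def by (intro exI[of _ "[]"]) simp
  show "x \<in> V_bimod n r \<Longrightarrow> y \<in> V_bimod n r \<Longrightarrow> decomposable n r (x \<cdot>\<^sub>T y)"
    unfolding decomposable_def by (intro exI[of _ "[(x, y)]"]) simp
  assume "decomposable n r z" "decomposable n r w"
  then obtain ds ds' where
    "set ds \<subseteq> V_bimod n r \<times> V_bimod n r" "(\<Sum>(x, y)\<leftarrow>ds. x \<cdot>\<^sub>T y) = z"
    "set ds' \<subseteq> V_bimod n r \<times> V_bimod n r" "(\<Sum>(x, y)\<leftarrow>ds'. x \<cdot>\<^sub>T y) = w"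
    unfolding decomposable_def by blast
  then show "decomposable n r (z + w)"
    unfolding decomposable_def by (intro exI[of _ "ds @ ds'"]) auto
qed

lemma decomposable_sum: "(\<And>i. i \<in> S \<Longrightarrow> decomposable n r (f i)) \<Longrightarrow> decomposable n r (sum f S)"
  by (induction S rule: infinite_finite_induct) (auto intro: decomposable)

lemma decomposable_delta:
  assumes "v \<in> V_bimod n r"
  shows "decomposable n r (delta n r v)"
  using assms
proof (induction v rule: T_deg_induct)
  case (single p c)
  then show ?case
  proof (cases rule: V_path_cases)
    case (1 s i j)
    show ?thesis
    proof (cases s)
      case True
      have "delta n r (single (Vp True i j) c) =
        (\<Sum>h | h \<in> {1..n} \<and> strictly_below r h i. single (Vp True h i) (- c) \<cdot>\<^sub>T V False i j) +
        (\<Sum>k | k \<in> {1..n} \<and> strictly_below r i k \<and> strictly_below r k j.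
          single (Vp True i k) c \<cdot>\<^sub>T V False k j)"
        unfolding delta_V_True by (simp add: single_uminus sum_negf)
      also have "decomposable n r \<dots>"
        using 1 by (intro decomposable decomposable_sum V_in_V) auto
      finally show ?thesis using 1 True by simp
    next
      case False
      have "decomposable n r (delta n r (single (Vp False i j) c))"
        unfolding delta_V_False using 1 by (intro decomposable decomposable_sum V_in_V) auto
      then show ?thesis using 1 False by simp
    qed
  qed
qed (auto simp: delta_add intro: decomposable)

text \<open>
  This is \<open>\<psi> (a \<omega>)\<close>, since \<open>a \<omega> = \<omega> a + \<delta> a\<close>.
\<close>

definition omega_left :: "nat \<Rightarrow> nat rel \<Rightarrow> ('k::field bocs_elem \<Rightarrow> 'k path_alg) \<Rightarrow> 'k path_alg \<Rightarrow> 'k path_alg" where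
  "omega_left n r \<psi> a = \<psi> (omega n) \<cdot>\<^sub>T a + on_V \<psi> (delta n r a)"

text \<open>
  The four kinds of summands of \<open>\<mu> (\<omega> b + v)\<close> give the four summands.
\<close>

lemma burt_butler_mult_eq:
  assumes \<phi>: "\<phi> \<in> burt_butler_carrier n r" and \<psi>: "\<psi> \<in> burt_butler_carrier n r"
    and b: "b \<in> A_alg n r" and v: "v \<in> V_bimod n r"
  shows "burt_butler_mult n r \<psi> \<phi> (b, v) = omega_left n r \<psi> (\<phi> (omega n)) \<cdot>\<^sub>T b +
    (two_step \<psi> \<phi> (delta n r v) + on_V \<psi> (\<phi> (omega n) \<cdot>\<^sub>T v) + omega_left n r \<psi> (on_V \<phi> v))"
proof -
  define ts where "ts = (SOME ts. ts \<in> comult n r (b, v))"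
  obtain ds0 where ds0: "set ds0 \<subseteq> V_bimod n r \<times> V_bimod n r" "(\<Sum>(x, y)\<leftarrow>ds0. x \<cdot>\<^sub>T y) = delta n r v"
    using decomposable_delta[OF v] unfolding decomposable_def by blast
  let ?rep = "\<lambda>ds. [(omega n, (b, 0))] @ map (\<lambda>(x, y). ((0, x), (0, y))) ds @
        [(omega n, (0, v)), ((0, v), omega n)]"
  have "set (?rep ds0) \<subseteq> U_bimod n r \<times> U_bimod n r"
    using ds0(1) b v by (auto simp: U_closed T_deg_closed)
  then have "tensor_eq n r (?rep ds0) (?rep ds0)" by (rule tensor_eq.refl)
  then have "?rep ds0 \<in> comult n r (b, v)" unfolding comult.simps using ds0 by blast
  then have "ts \<in> comult n r (b, v)" unfolding ts_def by (rule someI)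
  then obtain ds where ds: "set ds \<subseteq> V_bimod n r \<times> V_bimod n r" "(\<Sum>(x, y)\<leftarrow>ds. x \<cdot>\<^sub>T y) = delta n r v"
    and eq: "tensor_eq n r ts (?rep ds)"
    by auto
  have omA: "\<phi> (omega n) \<in> A_alg n r" "\<psi> (omega n) \<in> A_alg n r"
    by (rule burt_butlerD(1)[OF \<phi> U_closed(5)], rule burt_butlerD(1)[OF \<psi> U_closed(5)])
  have vA: "on_V \<phi> v \<in> A_alg n r" using on_V_closed[OF \<phi> v] .
  have dV: "delta n r (\<phi> (omega n)) \<in> V_bimod n r" "delta n r (on_V \<phi> v) \<in> V_bimod n r"
    using omA vA by (auto intro: delta_A_in_V)
  have 1: "\<psi> (U_left n r (\<phi> (omega n)) (b, 0)) = omega_left n r \<psi> (\<phi> (omega n)) \<cdot>\<^sub>T b"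
    using omA b dV by (simp add: bb_eq[OF \<psi>] A_mult_closed mult_A_closed omega_left_def path_mult_add_left
        path_mult_assoc on_V_mult[OF \<psi>])
  have 2: "(\<Sum>(u1, u2)\<leftarrow>map (\<lambda>(x, y). ((0, x), (0, y))) ds. \<psi> (U_left n r (\<phi> u1) u2)) =
      two_step \<psi> \<phi> (delta n r v)"
  proof -
    have "(\<Sum>(u1, u2)\<leftarrow>map (\<lambda>(x, y). ((0, x), (0, y))) ds. \<psi> (U_left n r (\<phi> u1) u2)) =
        (\<Sum>(x, y)\<leftarrow>ds. on_V \<psi> (on_V \<phi> x \<cdot>\<^sub>T y))"
      by (auto simp: on_V_def o_def case_prod_beta intro!: arg_cong[of _ _ sum_list])
    then show ?thesis using two_step_sum_list[OF \<phi> \<psi> ds(1)] ds(2) by simp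
  qed
  have 3: "\<psi> (U_left n r (\<phi> (omega n)) (0, v)) = on_V \<psi> (\<phi> (omega n) \<cdot>\<^sub>T v)"
    by (simp add: on_V_def)
  have 4: "\<psi> (U_left n r (\<phi> (0, v)) (omega n)) = omega_left n r \<psi> (on_V \<phi> v)"
    using vA dV by (simp add: omega_def on_V_def[symmetric] path_one_mult bb_eq[OF \<psi>] omega_left_def)
  have "burt_butler_mult n r \<psi> \<phi> (b, v) = tensor_value n r \<psi> \<phi> ts"
    using b v by (simp add: burt_butler_mult_def tensor_value_def ts_def U_bimodI)
  also have "\<dots> = tensor_value n r \<psi> \<phi> (?rep ds)"
    by (rule tensor_value_cong[OF \<phi> \<psi> eq])
  finally show ?thesis
    using 1 2 3 4 by (simp add: tensor_value_def add_ac)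
qed

text \<open>
  The element of the left Burt-Butler algebra with prescribed values: \<open>w\<close> at \<open>\<omega>\<close>, and \<open>g p\<close> at the
  paths \<open>p\<close> of \<open>V\<close>.
\<close>

definition bb_elem ::
  "nat \<Rightarrow> nat rel \<Rightarrow> 'k::field path_alg \<Rightarrow> (path \<Rightarrow> 'k path_alg) \<Rightarrow> ('k bocs_elem \<Rightarrow> 'k path_alg)" where
  "bb_elem n r w g = (\<lambda>u\<in>U_bimod n r. w \<cdot>\<^sub>T fst u + lin_ext g (snd u))"

lemma bb_elem:
  assumes w: "w \<in> A_alg n r"
    and g: "\<And>p. is_path n r p \<Longrightarrow> path_degree p = 1 \<Longrightarrow> g p \<in> A_alg n r \<and> g p \<cdot>\<^sub>T E (snd p) = g p"
  shows "bb_elem n r w g \<in> burt_butler_carrier n r"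
    "bb_elem n r w g (omega n) = w"
    "is_path n r p \<Longrightarrow> path_degree p = 1 \<Longrightarrow> on_V (bb_elem n r w g) (single p 1) = g p"
proof -
  have gA: "lin_ext g v \<in> A_alg n r" if "v \<in> V_bimod n r" for v
    using that by (induction v rule: T_deg_induct) (auto simp: lin_ext_add g intro: T_deg_closed)
  have gm: "lin_ext g (v \<cdot>\<^sub>T a) = lin_ext g v \<cdot>\<^sub>T a" if "v \<in> V_bimod n r" "a \<in> A_alg n r" for v a
    using that(1)
  proof (induction v rule: T_deg_induct)
    case (single p c)
    note p = single
    have g0: "g p \<cdot>\<^sub>T single q d = g p \<cdot>\<^sub>T (E (snd p) \<cdot>\<^sub>T single q d)" for q d
      using g[OF p] by (simp add: path_mult_assoc[symmetric])
    from that(2) show ?case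
    proof (induction a rule: T_deg_induct)
      case (single q d)
      have "snd p \<noteq> 0" using p by (cases rule: V_path_cases) auto
      from single show ?case
      proof (cases rule: A_path_cases)
        case (e i)
        have "g p \<cdot>\<^sub>T single q d = scale d (g p \<cdot>\<^sub>T E i)"
          using e path_mult_scale_right[of "g p" d "E i"] by simp
        then show ?thesis using e g[OF p] g0[of q 1]
          by (cases "snd p = i") (auto simp: path_mult_single mult.commute)
      next
        case (a i)
        then show ?thesis using \<open>snd p \<noteq> 0\<close> g0[of q d] by (auto simp: path_mult_single)
      qed
    qed (simp_all add: path_mult_add_right lin_ext_add)
  qed (simp_all add: path_mult_add_left lin_ext_add)
  show "bb_elem n r w g \<in> burt_butler_carrier n r"
    unfolding burt_butler_carrier_def bb_elem_def
    using w gA gm U_closed(2,3)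
    by (auto simp: lin_ext_add path_mult_add_left path_mult_add_right path_mult_assoc elim!: U_bimodE
        intro!: T_deg_closed A_mult_closed mult_A_closed)
  show "bb_elem n r w g (omega n) = w"
    using w by (simp add: bb_elem_def U_closed(5)) (simp add: omega_def path_one_mult)
  show "is_path n r p \<Longrightarrow> path_degree p = 1 \<Longrightarrow> on_V (bb_elem n r w g) (single p 1) = g p"
    by (simp add: on_V_def bb_elem_def U_bimodI T_deg_closed)
qed

lemma bb_eqI:
  fixes \<phi> \<psi> :: "'k::field bocs_elem \<Rightarrow> 'k path_alg"
  assumes \<phi>: "\<phi> \<in> burt_butler_carrier n r" and \<psi>: "\<psi> \<in> burt_butler_carrier n r"
    and "\<phi> (omega n) = \<psi> (omega n)"
    and "\<And>s i j. i \<in> {1..n} \<Longrightarrow> j \<in> {1..n} \<Longrightarrow> strictly_below r i j \<Longrightarrow> on_V \<phi> (V s i j) = on_V \<psi> (V s i j)"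
  shows "\<phi> = \<psi>"
proof (rule extensionalityI[OF burt_butlerD(4)[OF \<phi>] burt_butlerD(4)[OF \<psi>]])
  fix u :: "'k bocs_elem" assume "u \<in> U_bimod n r"
  then obtain b v where u: "u = (b, v)" "b \<in> A_alg n r" "v \<in> V_bimod n r" by (rule U_bimodE)
  have "on_V \<phi> v = on_V \<psi> v" using u(3)
  proof (induction v rule: T_deg_induct)
    case (single p c)
    have "on_V \<phi> (single p 1) = on_V \<psi> (single p 1)"
      using single by (cases rule: V_path_cases) (simp only: assms(4))
    then show ?case
      by (simp only: on_V_single[OF \<phi> single, of c] on_V_single[OF \<psi> single, of c])
  qed (simp_all add: on_V_add[OF \<phi>] on_V_add[OF \<psi>] on_V_zero[OF \<phi>] on_V_zero[OF \<psi>])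
  then show "\<phi> u = \<psi> u" using u assms(3) by (simp add: bb_eq[OF \<phi>] bb_eq[OF \<psi>])
qed

section \<open>The left Burt-Butler algebra as a matrix algebra\<close>

text \<open>
  The coefficient at \<open>e\<^sub>j\<close> for \<open>t = False\<close> and at \<open>\<alpha>\<^sub>j\<close> for \<open>t = True\<close>; for \<open>j \<ge> 1\<close> these two elements
  span \<open>A e\<^sub>j\<close>.
\<close>

definition coord :: "bool \<Rightarrow> nat \<Rightarrow> 'k::field path_alg \<Rightarrow> 'k" where
  "coord t j x = lookup x (if t then ([Alpha j], j) else ([], j))"

lemma coord_simps [simp]:
  "coord t j 0 = 0" "coord t j (x + y) = coord t j x + coord t j y" "coord t j (- x) = - coord t j x"
  "coord t j (x - y) = coord t j x - coord t j y" "coord t j (scale c x) = c * coord t j x"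
  "coord t j (sum f S) = (\<Sum>i\<in>S. coord t j (f i))"
  by (simp_all add: coord_def lookup_add lookup_minus lookup_sum)

context num_poset
begin

lemma sum_over_labels:
  fixes F :: "bool \<Rightarrow> nat \<Rightarrow> 'a::comm_monoid_add"
  shows "(\<Sum>k<n + n. F (n \<le> k) (label n k)) = (\<Sum>k\<in>{1..n}. F False k + F True k)"
proof -
  have shift: "(\<Sum>i<n. G (i + 1)) = sum G {1..n}" for G :: "nat \<Rightarrow> 'a"
    unfolding One_nat_def by (simp add: sum.atLeast1_atMost_eq)
  have "(\<Sum>k<n + n. F (n \<le> k) (label n k)) = (\<Sum>i<n. F False (i + 1)) + (\<Sum>i<n. F True (i + 1))"
    unfolding sum_lessThan_add by (intro arg_cong2[of _ _ _ _ "(+)"] sum.cong) (auto simp: label_def)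
  then show ?thesis unfolding shift by (simp add: sum.distrib)
qed

lemma label_surj: "i \<in> {1..n} \<Longrightarrow> \<exists>b<n + n. (n \<le> b) = s \<and> label n b = i"
  by (rule exI[of _ "if s then n + (i - 1) else i - 1"]) (auto simp: label_def)

lemma strictly_below_r: "strictly_below r i j \<Longrightarrow> (i, j) \<in> r \<and> i \<in> {1..n} \<and> j \<in> {1..n} \<and> i \<noteq> j"
  using r_field by (auto simp: strictly_below_def)

text \<open>
  The diagonal of the right half is determined by the other entries and the eigenvalue, which fixes
  the row sums. So a matrix identity need not be verified there, where the entries of \<open>bb_mat\<close> are
  least explicit.
\<close>

lemma rep_hom_eqI_tail:
  assumes M: "M \<in> rep_hom n r n n" and N: "N \<in> rep_hom n r n n"
    and Mc: "M *\<^sub>v tail_ones n n = c \<cdot>\<^sub>v tail_ones n n" and Nc: "N *\<^sub>v tail_ones n n = c \<cdot>\<^sub>v tail_ones n n"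
    and eq: "\<And>a b. a < n + n \<Longrightarrow> b < n + n \<Longrightarrow> (label n b, label n a) \<in> r \<Longrightarrow> \<not> (n \<le> b \<and> label n b = label n a) \<Longrightarrow>
      M $$ (a, b) = N $$ (a, b)"
  shows "M = N"
proof (rule rep_hom_eqI[OF M N])
  fix a b assume ab: "a < n + n" "b < n + n" "(label n b, label n a) \<in> r"
  show "M $$ (a, b) = N $$ (a, b)"
  proof (cases "n \<le> b \<and> label n b = label n a")
    case True
    define i0 where "i0 = b - n"
    have i0: "b = n + i0" "i0 < n" using True ab by (auto simp: i0_def)
    have other: "M $$ (a, n + i) = N $$ (a, n + i)" if "i < n" "i \<noteq> i0" for i
    proof (cases "(label n (n + i), label n a) \<in> r")
      case r: True
      have "label n (n + i) \<noteq> label n a" using True that i0 by (auto simp: label_def)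
      then show ?thesis using eq[of a "n + i"] ab that r by simp
    next
      case False
      then have "M $$ (a, n + i) = 0" "N $$ (a, n + i) = 0"
        using rep_homD(2)[OF M, of a "n + i"] rep_homD(2)[OF N, of a "n + i"] ab that by auto
      then show ?thesis by simp
    qed
    have "(\<Sum>i<n. M $$ (a, n + i)) = (\<Sum>i<n. N $$ (a, n + i))"
      using mult_tail_ones[OF rep_homD(1)[OF M] ab(1)] mult_tail_ones[OF rep_homD(1)[OF N] ab(1)]
      unfolding Mc Nc by simp
    moreover have "(\<Sum>i\<in>{..<n} - {i0}. M $$ (a, n + i)) = (\<Sum>i\<in>{..<n} - {i0}. N $$ (a, n + i))"
      by (rule sum.cong) (auto intro: other)
    ultimately have "M $$ (a, n + i0) = N $$ (a, n + i0)"
      using i0(2) by (simp add: sum.remove[of "{..<n}" i0])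
    then show ?thesis using i0 by simp
  qed (use eq ab in blast)
qed

text \<open>
  The entry in column \<open>(s, i)\<close> and row \<open>(t, j)\<close> of the matrix of \<open>\<phi>\<close>. For \<open>i\<close> strictly below \<open>j\<close>, the
  column contains the coordinates of \<open>\<phi> (v\<^sub>i\<^sub>j)\<close> or \<open>\<phi> (\<alpha>\<^sub>i v\<^sub>i\<^sub>j)\<close>. The coordinates of \<open>\<phi> (\<omega>)\<close> form
  the diagonal for \<open>s = False\<close>, and its coefficient at \<open>e\<^sub>0\<close> is the eigenvalue. The diagonal for
  \<open>s = True\<close> is the one that this eigenvalue forces; its sum over \<open>h\<close> is that of
  \<open>\<delta> \<alpha>\<^sub>j = - \<Sum>\<^sub>h \<alpha>\<^sub>h v\<^sub>h\<^sub>j\<close>.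
\<close>

definition bb_entry :: "('k::field bocs_elem \<Rightarrow> 'k path_alg) \<Rightarrow> bool \<Rightarrow> nat \<Rightarrow> bool \<Rightarrow> nat \<Rightarrow> 'k" where
  "bb_entry \<phi> s i t j =
     (if i = j then
        if s then (if t then lookup (\<phi> (omega n)) ([], 0) else 0) -
            (\<Sum>h | h \<in> {1..n} \<and> strictly_below r h j. coord t j (on_V \<phi> (V True h j)))
        else coord t j (\<phi> (omega n))
      else if strictly_below r i j then coord t j (on_V \<phi> (V s i j)) else 0)"

definition bb_mat :: "('k::field bocs_elem \<Rightarrow> 'k path_alg) \<Rightarrow> 'k mat" where
  "bb_mat \<phi> = mat (n + n) (n + n) (\<lambda>(a, b). bb_entry \<phi> (n \<le> b) (label n b) (n \<le> a) (label n a))"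

lemma bb_mat_index [simp]:
  "a < n + n \<Longrightarrow> b < n + n \<Longrightarrow> bb_mat \<phi> $$ (a, b) = bb_entry \<phi> (n \<le> b) (label n b) (n \<le> a) (label n a)"
  by (simp add: bb_mat_def)

lemma bb_mat_carrier: "bb_mat \<phi> \<in> carrier_mat (n + n) (n + n)"
  by (simp add: bb_mat_def)

lemma bb_entry_support: "j \<in> {1..n} \<Longrightarrow> bb_entry \<phi> s i t j \<noteq> 0 \<Longrightarrow> (i, j) \<in> r"
  using r_refl by (auto simp: bb_entry_def strictly_below_def split: if_splits)

lemma bb_entry_row_sum:
  assumes j: "j \<in> {1..n}"
  shows "(\<Sum>i\<in>{1..n}. bb_entry \<phi> True i t j) = (if t then lookup (\<phi> (omega n)) ([], 0) else 0)"
proof -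
  have "(\<Sum>i\<in>{1..n}. bb_entry \<phi> True i t j) = bb_entry \<phi> True j t j + (\<Sum>i\<in>{1..n} - {j}. bb_entry \<phi> True i t j)"
    using j by (intro sum.remove) auto
  also have "(\<Sum>i\<in>{1..n} - {j}. bb_entry \<phi> True i t j) =
      (\<Sum>i | i \<in> {1..n} \<and> strictly_below r i j. bb_entry \<phi> True i t j)"
    by (rule sum.mono_neutral_right) (auto simp: bb_entry_def strictly_below_def)
  also have "\<dots> = (\<Sum>i | i \<in> {1..n} \<and> strictly_below r i j. coord t j (on_V \<phi> (V True i j)))"
    by (rule sum.cong) (auto simp: bb_entry_def strictly_below_def)
  finally show ?thesis by (simp add: bb_entry_def)
qed

lemma bb_mat_tail:
  "bb_mat \<phi> *\<^sub>v tail_ones n n = lookup (\<phi> (omega n)) ([], 0) \<cdot>\<^sub>v tail_ones n n"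
proof (rule eq_vecI)
  fix a assume "a < dim_vec (lookup (\<phi> (omega n)) ([], 0) \<cdot>\<^sub>v tail_ones n n)"
  then have a: "a < n + n" by simp
  have p: "label n a \<in> {1..n}" by (rule label_range[OF _ a]) simp
  have "(bb_mat \<phi> *\<^sub>v tail_ones n n) $ a = (\<Sum>i<n. bb_mat \<phi> $$ (a, n + i))"
    by (rule mult_tail_ones[OF bb_mat_carrier a])
  also have "\<dots> = (\<Sum>i<n. bb_entry \<phi> True (i + 1) (n \<le> a) (label n a))"
    by (rule sum.cong) (use a in \<open>auto simp: label_def[of n "n + _"]\<close>)
  also have "\<dots> = (\<Sum>i\<in>{1..n}. bb_entry \<phi> True i (n \<le> a) (label n a))"
    unfolding One_nat_def by (simp add: sum.atLeast1_atMost_eq)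
  finally show "(bb_mat \<phi> *\<^sub>v tail_ones n n) $ a = (lookup (\<phi> (omega n)) ([], 0) \<cdot>\<^sub>v tail_ones n n) $ a"
    using a by (auto simp: bb_entry_row_sum[OF p])
qed (simp add: bb_mat_def)

lemma bb_mat_in: "bb_mat \<phi> \<in> rep_hom n r n n"
proof (rule rep_homI[OF bb_mat_carrier _ bb_mat_tail])
  fix a b assume ab: "a < n + n" "b < n + n" "bb_mat \<phi> $$ (a, b) \<noteq> 0"
  then show "(label n b, label n a) \<in> r"
    using bb_entry_support[OF label_range[of n a]] by simp
qed

lemma V_in_V': "strictly_below r i j \<Longrightarrow> single (Vp s i j) c \<in> V_bimod n r"
  using strictly_below_r by (intro V_in_V) auto

lemmas V_True_in_V = V_in_V'[of _ _ True, simplified]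
lemmas V_False_in_V = V_in_V'[of _ _ False, simplified]

lemma on_V_V_closed:
  assumes "\<phi> \<in> burt_butler_carrier n r" "strictly_below r i j"
  shows "on_V \<phi> (V s i j) \<in> A_alg n r"
  using strictly_below_r[OF assms(2)] assms by (intro on_V_closed[OF assms(1)] V_in_V) auto

lemma on_V_Vp_single:
  assumes "\<phi> \<in> burt_butler_carrier n r" "strictly_below r i j"
  shows "on_V \<phi> (single (Vp s i j) c) = scale c (on_V \<phi> (V s i j))"
  using strictly_below_r[OF assms(2)] V_is_path[of i n j r s] assms
  by (intro on_V_single[OF assms(1)]) auto

lemma lookup_on_V:
  assumes "\<phi> \<in> burt_butler_carrier n r" "strictly_below r i j" "snd p \<noteq> j"
  shows "lookup (on_V \<phi> (V s i j)) p = 0"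
proof -
  have "on_V \<phi> (V s i j) \<cdot>\<^sub>T E j = on_V \<phi> (V s i j)"
    using strictly_below_r[OF assms(2)] assms
    by (intro on_V_mult_E[OF assms(1)] V_in_V) (auto simp: path_mult_single)
  then show ?thesis using mult_E_lookup[of "on_V \<phi> (V s i j)" j p] assms(3) by simp
qed

lemma coord_on_V:
  assumes "\<phi> \<in> burt_butler_carrier n r" "strictly_below r i j" "k \<noteq> j"
  shows "coord t k (on_V \<phi> (V s i j)) = 0"
  using assms unfolding coord_def by (intro lookup_on_V) auto

lemma omega_left_add:
  assumes "\<psi> \<in> burt_butler_carrier n r" "x \<in> A_alg n r" "y \<in> A_alg n r"
  shows "omega_left n r \<psi> (x + y) = omega_left n r \<psi> x + omega_left n r \<psi> y"
  using assms by (simp add: omega_left_def path_mult_add_right delta_add on_V_add delta_A_in_V)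

lemma omega_left_Al:
  assumes \<psi>: "\<psi> \<in> burt_butler_carrier n r" and i: "i \<in> {1..n}"
  shows "omega_left n r \<psi> (single ([Alpha i], i) c) = single ([Alpha i], i) (lookup (\<psi> (omega n)) ([], 0) * c) -
    (\<Sum>h | h \<in> {1..n} \<and> strictly_below r h i. scale c (on_V \<psi> (V True h i)))"
proof -
  have om: "\<psi> (omega n) \<in> A_alg n r" by (rule burt_butlerD(1)[OF \<psi> U_closed(5)])
  have "on_V \<psi> (delta n r (single ([Alpha i], i) c)) =
      - on_V \<psi> (\<Sum>h | h \<in> {1..n} \<and> strictly_below r h i. single (Vp True h i) c)"
    unfolding delta_Al by (rule on_V_uminus[OF \<psi>]) (auto intro!: T_deg_sum V_True_in_V)
  also have "\<dots> = - (\<Sum>h | h \<in> {1..n} \<and> strictly_below r h i. on_V \<psi> (single (Vp True h i) c))"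
    by (subst on_V_sum[OF \<psi>]) (auto intro!: V_True_in_V)
  also have "\<dots> = - (\<Sum>h | h \<in> {1..n} \<and> strictly_below r h i. scale c (on_V \<psi> (V True h i)))"
    by (intro arg_cong[of _ _ uminus] sum.cong refl on_V_Vp_single[OF \<psi>]) auto
  finally have d: "on_V \<psi> (delta n r (single ([Alpha i], i) c)) = \<dots>" .
  have "\<psi> (omega n) \<cdot>\<^sub>T single ([Alpha i], i) c = scale c (\<psi> (omega n) \<cdot>\<^sub>T Al i)"
    using path_mult_scale_right[of "\<psi> (omega n)" c "Al i"] by simp
  also have "\<dots> = single ([Alpha i], i) (lookup (\<psi> (omega n)) ([], 0) * c)"
    by (simp add: lookup_A_mult_Al[OF om] mult.commute)
  finally show ?thesis unfolding omega_left_def d by simp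
qed

lemma omega_left_E: "omega_left n r \<psi> (single ([], i) c) = scale c (\<psi> (omega n) \<cdot>\<^sub>T E i) + on_V \<psi> 0"
  using path_mult_scale_right[of "\<psi> (omega n)" c "E i"] by (simp add: omega_left_def)

text \<open>
  On coordinate pairs, \<open>x \<mapsto> \<psi> (x \<omega>)\<close> acts by the diagonal \<open>2 \<times> 2\<close> block of \<open>\<psi>\<close> at \<open>j\<close>: \<open>e\<^sub>j \<omega>\<close> gives
  the coordinates of \<open>\<psi> (\<omega>)\<close>, and \<open>\<alpha>\<^sub>j \<omega> = \<omega> \<alpha>\<^sub>j + \<delta> \<alpha>\<^sub>j\<close> gives the forced diagonal.
\<close>

lemma coord_omega_left:
  assumes \<psi>: "\<psi> \<in> burt_butler_carrier n r" and x: "x \<in> A_alg n r" and j: "j \<in> {1..n}"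
  shows "coord t j (omega_left n r \<psi> x) = coord False j x * bb_entry \<psi> False j t j + coord True j x * bb_entry \<psi> True j t j"
  using x
proof (induction x rule: T_deg_induct)
  case zero
  then show ?case by (simp add: omega_left_def on_V_zero[OF \<psi>])
next
  case (single p c)
  then show ?case
  proof (cases rule: A_path_cases)
    case (e i)
    then show ?thesis
      by (auto simp: omega_left_E on_V_zero[OF \<psi>] bb_entry_def coord_def mult_E_lookup lookup_single when_def)
  next
    case (a i)
    show ?thesis
    proof (cases "i = j")
      case True
      then show ?thesis
        unfolding a(2) omega_left_Al[OF \<psi> a(1)]
        by (simp add: bb_entry_def sum_distrib_left[symmetric] right_diff_distrib mult.commute)
          (simp add: coord_def lookup_single when_def)
    next
      case False
      have "(\<Sum>h | h \<in> {1..n} \<and> strictly_below r h i. c * coord t j (on_V \<psi> (V True h i))) = 0"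
        using False coord_on_V[OF \<psi>, where s = True] by (intro sum.neutral) auto
      then show ?thesis
        unfolding a(2) omega_left_Al[OF \<psi> a(1)] using False
        by simp (simp add: coord_def lookup_single when_def)
    qed
  qed
next
  case (add x y)
  then show ?case by (simp add: omega_left_add[OF \<psi>] algebra_simps)
qed

lemma lookup_omega_left_0:
  assumes \<psi>: "\<psi> \<in> burt_butler_carrier n r" and x: "x \<in> A_alg n r"
  shows "lookup (omega_left n r \<psi> x) ([], 0) = lookup (\<psi> (omega n)) ([], 0) * lookup x ([], 0)"
  using x
proof (induction x rule: T_deg_induct)
  case zero
  then show ?case by (simp add: omega_left_def on_V_zero[OF \<psi>])
next
  case (single p c)
  then show ?case
  proof (cases rule: A_path_cases)
    case (e i)
    then show ?thesis
      by (auto simp: omega_left_E on_V_zero[OF \<psi>] mult_E_lookup lookup_single when_def)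
  next
    case (a i)
    have "(\<Sum>h | h \<in> {1..n} \<and> strictly_below r h i. c * lookup (on_V \<psi> (V True h i)) ([], 0)) = 0"
      using lookup_on_V[OF \<psi>, where s = True] a by (intro sum.neutral) auto
    then show ?thesis
      unfolding a(2) omega_left_Al[OF \<psi> a(1)]
      using a(1) by (simp add: lookup_minus lookup_sum lookup_single when_def)
  qed
next
  case (add x y)
  then show ?case by (simp add: omega_left_add[OF \<psi>] lookup_add algebra_simps)
qed

text \<open>
  On coordinate pairs, \<open>x \<mapsto> \<psi> (x v\<^sub>k\<^sub>j)\<close> acts by the \<open>2 \<times> 2\<close> block of \<open>\<psi>\<close> at \<open>k, j\<close>, because
  \<open>e\<^sub>k v\<^sub>k\<^sub>j = v\<^sub>k\<^sub>j\<close> and \<open>\<alpha>\<^sub>k v\<^sub>k\<^sub>j\<close> are the basis elements that give its rows.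
\<close>

lemma coord_on_V_A_mult:
  assumes \<psi>: "\<psi> \<in> burt_butler_carrier n r" and x: "x \<in> A_alg n r" and kj: "strictly_below r k j"
  shows "coord t j (on_V \<psi> (x \<cdot>\<^sub>T V False k j)) = coord False k x * bb_entry \<psi> False k t j + coord True k x * bb_entry \<psi> True k t j"
    "coord t j (on_V \<psi> (x \<cdot>\<^sub>T V True k j)) = lookup x ([], 0) * bb_entry \<psi> True k t j"
proof -
  note k = strictly_below_r[OF kj]
  have inV: "single (Vp s k j) c \<in> V_bimod n r" for s c by (rule V_in_V) (use k kj in auto)
  have 1: "on_V \<psi> (x \<cdot>\<^sub>T V False k j) = scale (lookup x ([], k)) (on_V \<psi> (V False k j)) +
      scale (lookup x ([Alpha k], k)) (on_V \<psi> (V True k j))"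
    unfolding A_mult_V(1)[OF x conjunct1[OF conjunct2[OF k]]] on_V_add[OF \<psi> inV inV]
      on_V_Vp_single[OF \<psi> kj, of False "lookup x ([], k)"]
      on_V_Vp_single[OF \<psi> kj, of True "lookup x ([Alpha k], k)"] ..
  show "coord t j (on_V \<psi> (x \<cdot>\<^sub>T V False k j)) =
      coord False k x * bb_entry \<psi> False k t j + coord True k x * bb_entry \<psi> True k t j"
    unfolding 1 using k kj by (simp add: bb_entry_def coord_def[of _ k])
  have 2: "on_V \<psi> (x \<cdot>\<^sub>T V True k j) = scale (lookup x ([], 0)) (on_V \<psi> (V True k j))"
    unfolding A_mult_V(2)[OF x conjunct1[OF conjunct2[OF k]]]
      on_V_Vp_single[OF \<psi> kj, of True "lookup x ([], 0)"] ..
  show "coord t j (on_V \<psi> (x \<cdot>\<^sub>T V True k j)) = lookup x ([], 0) * bb_entry \<psi> True k t j"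
    unfolding 2 using k kj by (simp add: bb_entry_def)
qed

context
  fixes \<phi> \<psi> :: "'k::field bocs_elem \<Rightarrow> 'k path_alg"
  assumes \<phi>: "\<phi> \<in> burt_butler_carrier n r" and \<psi>: "\<psi> \<in> burt_butler_carrier n r"
begin

lemma omega_left_zero: "omega_left n r \<psi> 0 = 0"
  by (simp add: omega_left_def on_V_zero[OF \<psi>])

lemma mult_omega: "burt_butler_mult n r \<psi> \<phi> (omega n) = omega_left n r \<psi> (\<phi> (omega n))"
proof -
  have om: "\<phi> (omega n) \<in> A_alg n r" by (rule burt_butlerD(1)[OF \<phi> U_closed(5)])
  have twA: "omega_left n r \<psi> (\<phi> (omega n)) \<in> A_alg n r"
    unfolding omega_left_def
    by (intro T_deg_closed A_mult_closed burt_butlerD(1)[OF \<psi> U_closed(5)] om on_V_closed[OF \<psi>] delta_A_in_V)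
  have "burt_butler_mult n r \<psi> \<phi> (path_one n, 0) = omega_left n r \<psi> (\<phi> (omega n)) \<cdot>\<^sub>T path_one n"
    by (subst burt_butler_mult_eq[OF \<phi> \<psi>])
      (simp_all add: path_one_in_A T_deg_closed on_V_zero[OF \<psi>] on_V_zero[OF \<phi>] omega_left_zero two_step_def)
  then show ?thesis using twA by (simp add: path_one_mult omega_def)
qed

lemma mult_on_V:
  assumes "v \<in> V_bimod n r"
  shows "on_V (burt_butler_mult n r \<psi> \<phi>) v =
    two_step \<psi> \<phi> (delta n r v) + on_V \<psi> (\<phi> (omega n) \<cdot>\<^sub>T v) + omega_left n r \<psi> (on_V \<phi> v)"
  unfolding on_V_def[of "burt_butler_mult n r \<psi> \<phi>"]
  by (subst burt_butler_mult_eq[OF \<phi> \<psi>]) (simp_all add: T_deg_closed assms)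

lemma two_step_delta:
  assumes ij: "strictly_below r i j"
  shows "two_step \<psi> \<phi> (delta n r (V s i j)) =
    (\<Sum>k | k \<in> {1..n} \<and> strictly_below r i k \<and> strictly_below r k j.
       on_V \<psi> (on_V \<phi> (V s i k) \<cdot>\<^sub>T V False k j)) -
    (if s then \<Sum>h | h \<in> {1..n} \<and> strictly_below r h i.
       on_V \<psi> (on_V \<phi> (V True h i) \<cdot>\<^sub>T V False i j) else 0)"
proof -
  note ij' = strictly_below_r[OF ij]
  have t: "two_step \<psi> \<phi> (V s i k \<cdot>\<^sub>T V False k j) = on_V \<psi> (on_V \<phi> (V s i k) \<cdot>\<^sub>T V False k j)"
    if "strictly_below r i k" "strictly_below r k j" for s i k
    using strictly_below_r[OF that(1)] strictly_below_r[OF that(2)] that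
    by (intro two_step_mult[OF \<phi> \<psi>] V_in_V) auto
  have sum1: "two_step \<psi> \<phi> (\<Sum>k | k \<in> {1..n} \<and> strictly_below r i k \<and> strictly_below r k j.
      V s i k \<cdot>\<^sub>T V False k j) =
    (\<Sum>k | k \<in> {1..n} \<and> strictly_below r i k \<and> strictly_below r k j.
       on_V \<psi> (on_V \<phi> (V s i k) \<cdot>\<^sub>T V False k j))" for s
    unfolding two_step_def[of \<psi> \<phi>] lin_ext_sum
    unfolding two_step_def[of \<psi> \<phi>, symmetric] by (rule sum.cong[OF HOL.refl], rule t) auto
  have sum2: "two_step \<psi> \<phi> (\<Sum>h | h \<in> {1..n} \<and> strictly_below r h i. V True h i \<cdot>\<^sub>T V False i j) =
    (\<Sum>h | h \<in> {1..n} \<and> strictly_below r h i. on_V \<psi> (on_V \<phi> (V True h i) \<cdot>\<^sub>T V False i j))"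
    unfolding two_step_def[of \<psi> \<phi>] lin_ext_sum
    unfolding two_step_def[of \<psi> \<phi>, symmetric] by (rule sum.cong[OF HOL.refl], rule t[OF _ ij]) auto
  show ?thesis
  proof (cases s)
    case True
    have "two_step \<psi> \<phi> (delta n r (single (Vp True i j) 1)) =
      - two_step \<psi> \<phi> (\<Sum>h | h \<in> {1..n} \<and> strictly_below r h i. V True h i \<cdot>\<^sub>T V False i j) +
      two_step \<psi> \<phi> (\<Sum>k | k \<in> {1..n} \<and> strictly_below r i k \<and> strictly_below r k j.
        V True i k \<cdot>\<^sub>T V False k j)"
      unfolding delta_V_True by (simp only: two_step_def lin_ext_add lin_ext_uminus)
    then show ?thesis using True unfolding sum1 sum2 by simp
  next
    case False
    have "two_step \<psi> \<phi> (delta n r (single (Vp False i j) 1)) =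
      two_step \<psi> \<phi> (\<Sum>k | k \<in> {1..n} \<and> strictly_below r i k \<and> strictly_below r k j.
        V False i k \<cdot>\<^sub>T V False k j)"
      unfolding delta_V_False ..
    then show ?thesis using False unfolding sum1 by simp
  qed
qed

text \<open>
  The summand \<open>k = i\<close> comes from the value of \<open>\<phi>\<close> at \<open>\<omega>\<close>, \<open>k = j\<close> from \<open>v \<otimes> \<omega>\<close>, and the \<open>k\<close> in
  between from \<open>\<delta> v\<^sub>i\<^sub>j = \<Sum>\<^sub>k v\<^sub>i\<^sub>k v\<^sub>k\<^sub>j\<close>. For \<open>\<alpha>\<^sub>i v\<^sub>i\<^sub>j\<close>, the further summand \<open>(\<delta> \<alpha>\<^sub>i) v\<^sub>i\<^sub>j\<close> accounts for
  the diagonal entries of \<open>\<phi>\<close> at \<open>k = i\<close>.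
\<close>

lemma bb_entry_mult:
  assumes i: "i \<in> {1..n}" and j: "j \<in> {1..n}" and ij: "(i, j) \<in> r" and ns: "\<not> (s \<and> i = j)"
  shows "bb_entry (burt_butler_mult n r \<psi> \<phi>) s i t j =
    (\<Sum>k\<in>{1..n}. bb_entry \<phi> s i False k * bb_entry \<psi> False k t j + bb_entry \<phi> s i True k * bb_entry \<psi> True k t j)"
proof -
  define R where "R k = bb_entry \<phi> s i False k * bb_entry \<psi> False k t j + bb_entry \<phi> s i True k * bb_entry \<psi> True k t j" for k
  have R0: "R k = 0" if "k \<in> {1..n}" "\<not> ((i, k) \<in> r \<and> (k, j) \<in> r)" for k
  proof -
    have "bb_entry \<phi> s i u k = 0 \<or> bb_entry \<psi> u k t j = 0" for u
      using bb_entry_support[OF that(1), of \<phi> s i u] bb_entry_support[OF j, of \<psi> u k t] that(2) by blast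
    then show ?thesis unfolding R_def by (metis add_0 mult_zero_left mult_zero_right)
  qed
  have R_below: "(i, k) \<in> r \<and> (k, j) \<in> r" if "k \<in> {1..n}" "R k \<noteq> 0" for k
    using R0 that by blast
  have om: "\<phi> (omega n) \<in> A_alg n r" by (rule burt_butlerD(1)[OF \<phi> U_closed(5)])
  show ?thesis
  proof (cases "i = j")
    case True
    have "(\<Sum>k\<in>{1..n}. R k) = R j + (\<Sum>k\<in>{1..n} - {j}. R k)"
      using j by (intro sum.remove) auto
    also have "(\<Sum>k\<in>{1..n} - {j}. R k) = 0"
      using R_below True antisymD[OF r_antisym] by (intro sum.neutral) blast
    finally have "(\<Sum>k\<in>{1..n}. R k) = R j" by simp
    moreover have "bb_entry (burt_butler_mult n r \<psi> \<phi>) s i t j = coord t j (omega_left n r \<psi> (\<phi> (omega n)))"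
      using True ns by (simp add: bb_entry_def mult_omega)
    moreover have "\<dots> = R j"
      unfolding coord_omega_left[OF \<psi> om j] R_def using True ns by (simp add: bb_entry_def[of \<phi>])
    ultimately show ?thesis unfolding R_def by simp
  next
    case False
    then have sb: "strictly_below r i j" using ij by (simp add: strictly_below_def)
    let ?B = "{k. k \<in> {1..n} \<and> strictly_below r i k \<and> strictly_below r k j}"
    have "(\<Sum>k\<in>{1..n}. R k) = (\<Sum>k\<in>insert i (insert j ?B). R k)"
      by (rule sum.mono_neutral_right) (use i j R_below in \<open>auto simp: strictly_below_def\<close>)
    also have "\<dots> = R i + (R j + (\<Sum>k\<in>?B. R k))"
      using False by (subst sum.insert; (subst sum.insert)?) (auto simp: strictly_below_def)
    finally have split: "(\<Sum>k\<in>{1..n}. R k) = R i + (R j + (\<Sum>k\<in>?B. R k))" .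
    have Rj: "R j = coord t j (omega_left n r \<psi> (on_V \<phi> (V s i j)))"
      unfolding coord_omega_left[OF \<psi> on_V_V_closed[OF \<phi> sb] j] R_def using False sb by (simp add: bb_entry_def[of \<phi>])
    have RB: "R k = coord t j (on_V \<psi> (on_V \<phi> (V s i k) \<cdot>\<^sub>T V False k j))" if "k \<in> ?B" for k
    proof -
      have k: "strictly_below r i k" "strictly_below r k j" using that by auto
      then show ?thesis
        unfolding coord_on_V_A_mult(1)[OF \<psi> on_V_V_closed[OF \<phi> k(1)] k(2)] R_def
        using strictly_below_r[OF k(1)] by (simp add: bb_entry_def[of \<phi>])
    qed
    have Ri: "R i = coord t j (on_V \<psi> (\<phi> (omega n) \<cdot>\<^sub>T V s i j)) -
      (if s then \<Sum>h | h \<in> {1..n} \<and> strictly_below r h i.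
         coord t j (on_V \<psi> (on_V \<phi> (V True h i) \<cdot>\<^sub>T V False i j)) else 0)"
    proof (cases s)
      case True
      have "(\<Sum>h | h \<in> {1..n} \<and> strictly_below r h i.
          coord t j (on_V \<psi> (on_V \<phi> (V True h i) \<cdot>\<^sub>T V False i j))) =
        (\<Sum>h | h \<in> {1..n} \<and> strictly_below r h i. coord False i (on_V \<phi> (V True h i)) * bb_entry \<psi> False i t j +
          coord True i (on_V \<phi> (V True h i)) * bb_entry \<psi> True i t j)"
        by (rule sum.cong[OF HOL.refl], rule coord_on_V_A_mult(1)[OF \<psi> on_V_V_closed[OF \<phi>] sb]) auto
      also have "\<dots> = (\<Sum>h | h \<in> {1..n} \<and> strictly_below r h i. coord False i (on_V \<phi> (V True h i))) * bb_entry \<psi> False i t j +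
          (\<Sum>h | h \<in> {1..n} \<and> strictly_below r h i. coord True i (on_V \<phi> (V True h i))) * bb_entry \<psi> True i t j"
        by (simp add: sum.distrib sum_distrib_right)
      finally show ?thesis
        using True coord_on_V_A_mult(2)[OF \<psi> om sb, of t]
        by (simp add: R_def bb_entry_def[of \<phi>] algebra_simps)
    next
      case s: False
      then show ?thesis
        using coord_on_V_A_mult(1)[OF \<psi> om sb, of t] by (simp add: R_def bb_entry_def[of \<phi>] coord_def[of _ i])
    qed
    have "bb_entry (burt_butler_mult n r \<psi> \<phi>) s i t j = coord t j (on_V (burt_butler_mult n r \<psi> \<phi>) (V s i j))"
      using False sb by (simp add: bb_entry_def)
    then have "bb_entry (burt_butler_mult n r \<psi> \<phi>) s i t j =
      coord t j (two_step \<psi> \<phi> (delta n r (V s i j))) + coord t j (on_V \<psi> (\<phi> (omega n) \<cdot>\<^sub>T V s i j)) +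
      coord t j (omega_left n r \<psi> (on_V \<phi> (V s i j)))"
      unfolding mult_on_V[OF V_in_V'[OF sb]] coord_simps .
    also have "\<dots> = R i + (R j + (\<Sum>k\<in>?B. R k))"
      unfolding two_step_delta[OF sb] Ri Rj using RB by simp
    finally show ?thesis using split unfolding R_def by simp
  qed
qed

lemma two_step_add: "two_step \<psi> \<phi> (x + y) = two_step \<psi> \<phi> x + two_step \<psi> \<phi> y"
  by (simp add: two_step_def lin_ext_add)

text \<open>
  Right linearity of a product reduces to sources: its values at a path of \<open>V\<close> that starts at \<open>j\<close>
  lie in \<open>A e\<^sub>j\<close>, by the explicit formula for \<open>\<delta>\<close> on paths.
\<close>

lemma mult_closed: "burt_butler_mult n r \<psi> \<phi> \<in> burt_butler_carrier n r"
proof -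
  let ?m = "burt_butler_mult n r \<psi> \<phi>"
  have om: "\<phi> (omega n) \<in> A_alg n r" by (rule burt_butlerD(1)[OF \<phi> U_closed(5)])
  have twA: "omega_left n r \<psi> x \<in> A_alg n r" if "x \<in> A_alg n r" for x
    unfolding omega_left_def using that
    by (intro T_deg_closed A_mult_closed burt_butlerD(1)[OF \<psi> U_closed(5)] om on_V_closed[OF \<psi>] delta_A_in_V)
  have vE: "on_V \<psi> (x \<cdot>\<^sub>T single p 1) \<in> A_alg n r \<and>
      on_V \<psi> (x \<cdot>\<^sub>T single p 1) \<cdot>\<^sub>T E (snd p) = on_V \<psi> (x \<cdot>\<^sub>T single p 1)"
    if "x \<in> A_alg n r" "is_path n r p" "path_degree p = 1" for x p
  proof -
    have V: "x \<cdot>\<^sub>T single p 1 \<in> V_bimod n r"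
      using that by (intro A_mult_closed T_deg_closed) auto
    have "x \<cdot>\<^sub>T single p 1 \<cdot>\<^sub>T E (snd p) = x \<cdot>\<^sub>T single p 1"
      using V_source(2)[OF that(2,3), where c = "1::'k"] by (simp add: path_mult_assoc)
    then show ?thesis
      using on_V_mult_E[OF \<psi> V _ path_source_range[OF that(2)]] on_V_closed[OF \<psi> V] by blast
  qed
  let ?g = "\<lambda>p. on_V ?m (single p 1)"
  have g: "?g p \<in> A_alg n r \<and> ?g p \<cdot>\<^sub>T E (snd p) = ?g p" if p: "is_path n r p" "path_degree p = 1" for p
  proof -
    obtain s i j where sij: "strictly_below r i j" "p = Vp s i j"
      using p by (rule V_path_cases) blast
    have pV: "single p 1 \<in> V_bimod n r" using p by (rule T_deg_closed)
    define vp where "vp = on_V \<phi> (single p 1)"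
    have vp: "vp \<in> A_alg n r" "vp \<cdot>\<^sub>T E (snd p) = vp"
      unfolding vp_def using on_V_closed[OF \<phi> pV] on_V_single_E[OF \<phi> p] by auto
    have omega_left: "omega_left n r \<psi> vp \<cdot>\<^sub>T E (snd p) = omega_left n r \<psi> vp"
    proof -
      have "(E (snd p) :: 'k path_alg) \<in> A_alg n r" using path_source_range[OF p(1)] by (rule E_in_A)
      then have "delta n r vp \<cdot>\<^sub>T E (snd p) = delta n r (vp \<cdot>\<^sub>T E (snd p))"
        using vp(1) by (simp add: delta_leibniz_A)
      then have "delta n r vp \<cdot>\<^sub>T E (snd p) = delta n r vp" using vp(2) by simp
      then have "on_V \<psi> (delta n r vp) \<cdot>\<^sub>T E (snd p) = on_V \<psi> (delta n r vp)"
        by (rule on_V_mult_E[OF \<psi> delta_A_in_V[OF vp(1)] _ path_source_range[OF p(1)]])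
      then show ?thesis using vp(2) by (simp add: omega_left_def path_mult_add_left path_mult_assoc)
    qed
    have V1: "on_V \<psi> (on_V \<phi> (V s' i' k) \<cdot>\<^sub>T V False k j) \<in> A_alg n r \<and>
      on_V \<psi> (on_V \<phi> (V s' i' k) \<cdot>\<^sub>T V False k j) \<cdot>\<^sub>T E j = on_V \<psi> (on_V \<phi> (V s' i' k) \<cdot>\<^sub>T V False k j)"
      if "strictly_below r i' k" "strictly_below r k j" for s' i' k
      using vE[OF on_V_V_closed[OF \<phi> that(1), of s'], of "Vp False k j"] strictly_below_r[OF that(2)] that
        V_is_path[of k n j r False] by auto
    have snd: "snd p = j" using sij by simp
    define S1 where "S1 = (\<Sum>k | k \<in> {1..n} \<and> strictly_below r i k \<and> strictly_below r k j.
       on_V \<psi> (on_V \<phi> (V s i k) \<cdot>\<^sub>T V False k j))"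
    define S2 where "S2 = (\<Sum>h | h \<in> {1..n} \<and> strictly_below r h i.
       on_V \<psi> (on_V \<phi> (V True h i) \<cdot>\<^sub>T V False i j))"
    have SA: "S1 \<in> A_alg n r" "S2 \<in> A_alg n r"
      unfolding S1_def S2_def by (rule T_deg_sum, rule V1[THEN conjunct1]; use sij(1) in blast)+
    have "S1 \<cdot>\<^sub>T E j = S1"
      unfolding S1_def path_mult_sum_left by (rule sum.cong[OF HOL.refl], rule V1[THEN conjunct2]) auto
    moreover have "S2 \<cdot>\<^sub>T E j = S2"
      unfolding S2_def path_mult_sum_left
      by (rule sum.cong[OF HOL.refl], rule V1[THEN conjunct2]) (use sij(1) in auto)
    ultimately have ts: "two_step \<psi> \<phi> (delta n r (V s i j)) \<in> A_alg n r"
      and tsE: "two_step \<psi> \<phi> (delta n r (V s i j)) \<cdot>\<^sub>T E j = two_step \<psi> \<phi> (delta n r (V s i j))"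
      unfolding two_step_delta[OF sij(1)] S1_def[symmetric] S2_def[symmetric] diff_conv_add_uminus
      using SA by (auto simp del: add_uminus_conv_diff simp: path_mult_add_left intro!: T_deg_closed)
    have eq: "?g p = two_step \<psi> \<phi> (delta n r (single p 1)) + on_V \<psi> (\<phi> (omega n) \<cdot>\<^sub>T single p 1) + omega_left n r \<psi> vp"
      unfolding vp_def by (rule mult_on_V[OF pV])
    show ?thesis
      unfolding eq using ts tsE vE[OF om p] omega_left twA[OF vp(1)] snd sij(2)
      by (auto simp: path_mult_add_left intro!: T_deg_closed)
  qed
  have lin: "on_V ?m v = lin_ext ?g v" if "v \<in> V_bimod n r" for v
    using that
  proof (induction v rule: T_deg_induct)
    case zero
    show ?case by (simp add: mult_on_V T_deg_closed two_step_def on_V_zero[OF \<psi>] on_V_zero[OF \<phi>] omega_left_zero)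
  next
    case (single p c)
    have pV: "single p 1 \<in> V_bimod n r" using single by (rule T_deg_closed)
    have sc: "single p c = scale c (single p 1)" by simp
    have xV: "\<phi> (omega n) \<cdot>\<^sub>T single p 1 \<in> V_bimod n r" by (rule A_mult_closed[OF om pV])
    have tws: "omega_left n r \<psi> (scale c x) = scale c (omega_left n r \<psi> x)" if "x \<in> A_alg n r" for x
      using that by (simp add: omega_left_def delta_scale on_V_scale[OF \<psi>] delta_A_in_V scale_add)
    have "on_V ?m (single p c) = scale c (on_V ?m (single p 1))"
      unfolding sc mult_on_V[OF pV] mult_on_V[OF T_deg_closed(4)[OF pV]]
      by (simp add: delta_scale two_step_def lin_ext_scale on_V_scale[OF \<psi> xV] on_V_scale[OF \<phi> pV]
          tws on_V_closed[OF \<phi> pV] scale_add del: scale_simps(5))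
    then show ?case by simp
  next
    case (add x y)
    have "on_V ?m (x + y) = on_V ?m x + on_V ?m y"
      using add.hyps by (simp add: mult_on_V T_deg_closed delta_add two_step_add add_ac path_mult_add_right
          on_V_add[OF \<psi>] on_V_add[OF \<phi>] A_mult_closed[OF om] omega_left_add[OF \<psi>] on_V_closed[OF \<phi>])
    then show ?case using add by (simp add: lin_ext_add)
  qed
  have "?m = bb_elem n r (omega_left n r \<psi> (\<phi> (omega n))) ?g"
  proof (rule extensionalityI[where A = "U_bimod n r"])
    show "?m \<in> extensional (U_bimod n r)" by (simp add: burt_butler_mult_def)
    show "bb_elem n r (omega_left n r \<psi> (\<phi> (omega n))) ?g \<in> extensional (U_bimod n r)"
      by (simp add: bb_elem_def)
    fix u :: "'k bocs_elem" assume "u \<in> U_bimod n r"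
    then obtain b v where u: "u = (b, v)" "b \<in> A_alg n r" "v \<in> V_bimod n r" by (rule U_bimodE)
    show "?m u = bb_elem n r (omega_left n r \<psi> (\<phi> (omega n))) ?g u"
      using u by (simp add: bb_elem_def U_bimodI lin[symmetric] mult_on_V burt_butler_mult_eq[OF \<phi> \<psi>])
  qed
  moreover have "bb_elem n r (omega_left n r \<psi> (\<phi> (omega n))) ?g \<in> burt_butler_carrier n r"
    by (rule bb_elem(1)[OF twA[OF om] g])
  ultimately show ?thesis by simp
qed

lemma bb_mat_mult: "bb_mat (burt_butler_mult n r \<psi> \<phi>) = bb_mat \<psi> * bb_mat \<phi>"
proof (rule rep_hom_eqI_tail[OF bb_mat_in rep_hom_mult[OF r_trans bb_mat_in bb_mat_in] bb_mat_tail])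
  have om: "\<phi> (omega n) \<in> A_alg n r" by (rule burt_butlerD(1)[OF \<phi> U_closed(5)])
  show "bb_mat \<psi> * bb_mat \<phi> *\<^sub>v tail_ones n n =
      lookup (burt_butler_mult n r \<psi> \<phi> (omega n)) ([], 0) \<cdot>\<^sub>v tail_ones n n"
    by (simp add: assoc_mult_mat_vec[OF bb_mat_carrier bb_mat_carrier] bb_mat_tail
        mult_mat_vec[OF bb_mat_carrier] smult_smult_assoc mult_omega lookup_omega_left_0[OF \<psi> om] mult.commute)
  fix a b assume ab: "a < n + n" "b < n + n" and r: "(label n b, label n a) \<in> r"
    "\<not> (n \<le> b \<and> label n b = label n a)"
  have "(bb_mat \<psi> * bb_mat \<phi>) $$ (a, b) =
      (\<Sum>k<n + n. bb_entry \<psi> (n \<le> k) (label n k) (n \<le> a) (label n a) * bb_entry \<phi> (n \<le> b) (label n b) (n \<le> k) (label n k))"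
    using ab by (subst index_mult_mat_sum[OF bb_mat_carrier bb_mat_carrier ab]) simp
  also have "\<dots> = (\<Sum>k\<in>{1..n}. bb_entry \<psi> False k (n \<le> a) (label n a) * bb_entry \<phi> (n \<le> b) (label n b) False k +
      bb_entry \<psi> True k (n \<le> a) (label n a) * bb_entry \<phi> (n \<le> b) (label n b) True k)"
    by (rule sum_over_labels[of "\<lambda>u k. bb_entry \<psi> u k (n \<le> a) (label n a) * bb_entry \<phi> (n \<le> b) (label n b) u k"])
  also have "\<dots> = bb_mat (burt_butler_mult n r \<psi> \<phi>) $$ (a, b)"
    using bb_entry_mult[OF label_range[of n b] label_range[of n a] r(1,2)] ab by (simp add: mult.commute)
  finally show "bb_mat (burt_butler_mult n r \<psi> \<phi>) $$ (a, b) = (bb_mat \<psi> * bb_mat \<phi>) $$ (a, b)" by simp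
qed

lemma bb_mat_inj:
  assumes eq: "bb_mat \<phi> = bb_mat \<psi>"
  shows "\<phi> = \<psi>"
proof -
  have bb_entry: "bb_entry \<phi> s i t j = bb_entry \<psi> s i t j" if ij: "i \<in> {1..n}" "j \<in> {1..n}" for s i t j
  proof -
    obtain a b where "a < n + n" "(n \<le> a) = t" "label n a = j" "b < n + n" "(n \<le> b) = s" "label n b = i"
      using label_surj[OF ij(1), of s] label_surj[OF ij(2), of t] by blast
    then show ?thesis using arg_cong[OF eq, of "\<lambda>M. M $$ (a, b)"] by simp
  qed
  have "lookup (\<phi> (omega n)) ([], 0) = lookup (\<psi> (omega n)) ([], 0)"
    using bb_entry_row_sum[of 1 \<phi> True] bb_entry_row_sum[of 1 \<psi> True] bb_entry[of _ 1 True True] n_pos by simp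
  moreover have "coord t j (\<phi> (omega n)) = coord t j (\<psi> (omega n))" if "j \<in> {1..n}" for t j
    using bb_entry[OF that that, of False t] by (simp add: bb_entry_def)
  from this[of _ False] this[of _ True]
  have "lookup (\<phi> (omega n)) ([], j) = lookup (\<psi> (omega n)) ([], j)"
    "lookup (\<phi> (omega n)) ([Alpha j], j) = lookup (\<psi> (omega n)) ([Alpha j], j)" if "j \<in> {1..n}" for j
    using that by (auto simp: coord_def)
  ultimately have om: "\<phi> (omega n) = \<psi> (omega n)"
    by (intro A_eqI[OF burt_butlerD(1)[OF \<phi> U_closed(5)] burt_butlerD(1)[OF \<psi> U_closed(5)]])
      (metis atLeastAtMost_iff less_one not_le, blast)
  show ?thesis
  proof (rule bb_eqI[OF \<phi> \<psi> om])
    fix s i j assume ij: "i \<in> {1..n}" "j \<in> {1..n}" "strictly_below r i j"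
    then have coord: "coord t j (on_V \<phi> (V s i j)) = coord t j (on_V \<psi> (V s i j))" for t
      using bb_entry[OF ij(1,2), of s t] strictly_below_r[OF ij(3)] by (simp add: bb_entry_def)
    have "lookup (on_V \<phi> (V s i j)) p = lookup (on_V \<psi> (V s i j)) p" if "p = ([], k) \<or> p = ([Alpha k], k)" for p k
      using that coord[of False] coord[of True] lookup_on_V[OF \<phi> ij(3), of p s] lookup_on_V[OF \<psi> ij(3), of p s]
      by (cases "k = j") (auto simp: coord_def)
    then show "on_V \<phi> (V s i j) = on_V \<psi> (V s i j)"
      by (intro A_eqI[OF on_V_V_closed[OF \<phi> ij(3)] on_V_V_closed[OF \<psi> ij(3)]]) blast+
  qed
qed

end

lemma bb_mat_surj:
  assumes M: "M \<in> rep_hom n r n n"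
  shows "\<exists>\<phi>\<in>burt_butler_carrier n r. bb_mat \<phi> = (M :: 'k::field mat)"
proof -
  obtain c where c: "M *\<^sub>v tail_ones n n = c \<cdot>\<^sub>v tail_ones n n" using M by (auto simp: rep_hom_def)
  \<comment> \<open>The index with a given label, in the left half for \<open>False\<close> and in the right half for \<open>True\<close>.\<close>
  define ix where "ix s i = (if s then n + (i - 1) else i - 1)" for s and i :: nat
  define m where "m s i t j = M $$ (ix t j, ix s i)" for s i t j
  \<comment> \<open>The coordinates are read off from the columns of \<open>M\<close>.\<close>
  define w where "w = single ([], 0) c +
    (\<Sum>j\<in>{1..n}. single ([], j) (m False j False j) + single ([Alpha j], j) (m False j True j))"
  define g where "g p = (let s = (length (fst p) = 2); i = arrow_target (last (fst p)); j = snd p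
    in single ([], j) (m s i False j) + single ([Alpha j], j) (m s i True j))" for p
  have w: "w \<in> A_alg n r"
    unfolding w_def by (intro T_deg_closed(2) T_deg_sum E_in_A Al_in_A) auto
  have g_Vp: "g (Vp s i j) = single ([], j) (m s i False j) + single ([Alpha j], j) (m s i True j)" for s i j
    by (auto simp: g_def)
  have g: "g p \<in> A_alg n r \<and> g p \<cdot>\<^sub>T E (snd p) = g p" if p: "is_path n r p" "path_degree p = 1" for p
  proof -
    obtain s i j where sij: "j \<in> {1..n}" "p = Vp s i j" using p by (rule V_path_cases) blast
    have snd: "snd p = j" using sij by simp
    show ?thesis
      unfolding snd unfolding sij(2) g_Vp using sij(1)
      by (auto simp: path_mult_add_left path_mult_single intro!: T_deg_closed(2) E_in_A Al_in_A)
  qed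
  define \<phi> where "\<phi> = bb_elem n r w g"
  have \<phi>: "\<phi> \<in> burt_butler_carrier n r" and om: "\<phi> (omega n) = w"
    unfolding \<phi>_def using bb_elem(1,2)[OF w g] by auto
  have on_V: "on_V \<phi> (V s i j) = single ([], j) (m s i False j) + single ([Alpha j], j) (m s i True j)"
    if "strictly_below r i j" for s i j
    unfolding \<phi>_def g_Vp[symmetric] using strictly_below_r[OF that] that V_is_path[of i n j r s]
    by (intro bb_elem(3)[OF w g]) auto
  have w0: "lookup w ([], 0) = c"
    by (simp add: w_def lookup_add lookup_sum lookup_single when_def)
  have wj: "coord t j w = m False j t j" if "j \<in> {1..n}" for t j
  proof -
    have "coord t j w = (\<Sum>k\<in>{1..n}. if k = j then m False j t j else 0)"
      using that by (auto simp: w_def coord_def lookup_add lookup_sum lookup_single when_def intro!: sum.cong)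
    then show ?thesis using that by simp
  qed
  have "bb_mat \<phi> = M"
  proof (rule rep_hom_eqI_tail[OF bb_mat_in M bb_mat_tail])
    show "M *\<^sub>v tail_ones n n = lookup (\<phi> (omega n)) ([], 0) \<cdot>\<^sub>v tail_ones n n"
      by (simp add: om w0 c)
    fix a b assume ab: "a < n + n" "b < n + n" and r: "(label n b, label n a) \<in> r"
      "\<not> (n \<le> b \<and> label n b = label n a)"
    have ix: "ix (n \<le> a) (label n a) = a" "ix (n \<le> b) (label n b) = b"
      using ab by (auto simp: ix_def label_def)
    have pa: "label n a \<in> {1..n}" using ab by (intro label_range) auto
    have "bb_entry \<phi> (n \<le> b) (label n b) (n \<le> a) (label n a) = m (n \<le> b) (label n b) (n \<le> a) (label n a)"
    proof (cases "label n b = label n a")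
      case True
      then show ?thesis using r(2) by (auto simp: bb_entry_def om wj[OF pa])
    next
      case False
      then have "strictly_below r (label n b) (label n a)" using r by (simp add: strictly_below_def)
      then show ?thesis using False
        by (auto simp: bb_entry_def on_V coord_def lookup_add lookup_single when_def)
    qed
    then show "bb_mat \<phi> $$ (a, b) = M $$ (a, b)" using ab by (simp add: m_def ix)
  qed
  then show ?thesis using \<phi> by blast
qed

lemma burt_butler_simps [simp]:
  "carrier (burt_butler_algebra n r) = burt_butler_carrier n r"
  "mult (burt_butler_algebra n r) = burt_butler_mult n r"
  "one (burt_butler_algebra n r) = (\<lambda>u\<in>U_bimod n r. fst u)"
  "zero (burt_butler_algebra n r) = (\<lambda>u\<in>U_bimod n r. 0)"
  "add (burt_butler_algebra n r) = (\<lambda>\<phi> \<psi>. \<lambda>u\<in>U_bimod n r. \<phi> u + \<psi> u)"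
  "smult (burt_butler_algebra n r) = (\<lambda>c \<phi>. \<lambda>u\<in>U_bimod n r. scale c (\<phi> u))"
  by (simp_all add: burt_butler_algebra_def)

lemma bb_closed:
  assumes "\<phi> \<in> burt_butler_carrier n r" "\<psi> \<in> burt_butler_carrier n r"
  shows "(\<lambda>u\<in>U_bimod n r. \<phi> u + \<psi> u) \<in> burt_butler_carrier n r"
    "(\<lambda>u\<in>U_bimod n r. scale c (\<phi> u)) \<in> burt_butler_carrier n r"
proof -
  note D = burt_butlerD[OF assms(1)] burt_butlerD[OF assms(2)]
  show "(\<lambda>u\<in>U_bimod n r. \<phi> u + \<psi> u) \<in> burt_butler_carrier n r"
    unfolding burt_butler_carrier_def
    by (auto simp: D U_closed path_mult_add_left add_ac intro!: T_deg_closed(2))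
  show "(\<lambda>u\<in>U_bimod n r. scale c (\<phi> u)) \<in> burt_butler_carrier n r"
    unfolding burt_butler_carrier_def
    by (auto simp: D U_closed scale_add intro!: T_deg_closed(4))
qed

lemma bb_zero_closed: "(\<lambda>u\<in>U_bimod n r. 0) \<in> burt_butler_carrier n r"
  unfolding burt_butler_carrier_def
  by (intro CollectI conjI ballI) (simp_all add: U_closed T_deg_closed(1))

lemma bb_one_closed: "(\<lambda>u\<in>U_bimod n r. fst u) \<in> burt_butler_carrier n r"
  unfolding burt_butler_carrier_def using U_closed(2,3)
  by (auto simp: U_bimod_def intro: T_deg_closed mult_A_closed)

lemma bb_mat_eqI:
  assumes "M \<in> carrier_mat (n + n) (n + n)"
    and "\<And>a b. a < n + n \<Longrightarrow> b < n + n \<Longrightarrow> bb_entry \<phi> (n \<le> b) (label n b) (n \<le> a) (label n a) = M $$ (a, b)"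
  shows "bb_mat \<phi> = M"
  by (rule eq_matI) (use assms in \<open>auto simp: bb_mat_def\<close>)

lemmas bb_entry_restrict_simps = bb_entry_def on_V_def U_closed U_bimodI V_True_in_V V_False_in_V T_deg_closed(1)

lemma bb_mat_add: "bb_mat (\<lambda>u\<in>U_bimod n r. \<phi> u + \<psi> u) = bb_mat \<phi> + bb_mat \<psi>"
proof -
  have "bb_entry (\<lambda>u\<in>U_bimod n r. \<phi> u + \<psi> u) s i t j = bb_entry \<phi> s i t j + bb_entry \<psi> s i t j" for s i t j
    by (auto simp: bb_entry_restrict_simps lookup_add sum.distrib cong: sum.cong_simp)
  then show ?thesis by (intro bb_mat_eqI) (auto intro: add_carrier_mat simp: bb_mat_carrier bb_mat_def)
qed

lemma bb_mat_smult: "bb_mat (\<lambda>u\<in>U_bimod n r. scale c (\<phi> u)) = c \<cdot>\<^sub>m bb_mat \<phi>"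
proof -
  have "bb_entry (\<lambda>u\<in>U_bimod n r. scale c (\<phi> u)) s i t j = c * bb_entry \<phi> s i t j" for s i t j
    by (auto simp: bb_entry_restrict_simps sum_distrib_left right_diff_distrib cong: sum.cong_simp)
  then show ?thesis by (intro bb_mat_eqI) (auto simp: bb_mat_def)
qed

lemma bb_mat_zero: "bb_mat (\<lambda>u\<in>U_bimod n r. 0) = 0\<^sub>m (n + n) (n + n)"
proof -
  have "bb_entry (\<lambda>u\<in>U_bimod n r. 0) s i t j = 0" for s i t j
    by (auto simp: bb_entry_restrict_simps cong: sum.cong_simp)
  then show ?thesis by (intro bb_mat_eqI) auto
qed

lemma bb_mat_one: "bb_mat (\<lambda>u\<in>U_bimod n r. fst u) = (1\<^sub>m (n + n) :: 'k::field mat)"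
proof -
  let ?id = "\<lambda>u\<in>U_bimod n r. fst (u :: 'k bocs_elem)"
  have om: "fst (omega n) = path_one n" by (simp add: omega_def)
  have lk: "lookup (path_one n) p = (if fst p = [] \<and> snd p \<le> n then 1 else 0 :: 'k)" for p
  proof -
    have "lookup (path_one n) p = (\<Sum>i=0..n. if i = snd p then if fst p = [] then 1 else 0 else 0 :: 'k)"
      by (cases p) (auto simp: path_one_def lookup_sum lookup_single when_def intro!: sum.cong)
    then show ?thesis by simp
  qed
  have e: "bb_entry ?id s i t j = (if i = j \<and> s = t then 1 else 0)" if "j \<in> {1..n}" for s i t j
    using that by (auto simp: bb_entry_restrict_simps om lk coord_def[of _ _ "path_one n"] cong: sum.cong_simp)
  show ?thesis
  proof (rule bb_mat_eqI)
    fix a b assume ab: "a < n + n" "b < n + n"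
    have pa: "label n a \<in> {1..n}" by (rule label_range[OF _ ab(1)]) simp
    have "label n b = label n a \<and> (n \<le> b) = (n \<le> a) \<longleftrightarrow> a = b" by (auto simp: label_def)
    then show "bb_entry ?id (n \<le> b) (label n b) (n \<le> a) (label n a) = (1\<^sub>m (n + n) :: 'k mat) $$ (a, b)"
      unfolding e[OF pa] using ab by auto
  qed simp
qed

lemma alg_iso_bb_mat:
  "alg_iso (burt_butler_algebra n r) (rep_alg n r n :: ('k::field, 'k mat) module) bb_mat"
proof -
  have "bij_betw bb_mat (burt_butler_carrier n r) (rep_hom n r n n :: 'k mat set)"
    unfolding bij_betw_def inj_on_def using bb_mat_inj bb_mat_in bb_mat_surj by blast
  then show ?thesis
    unfolding alg_iso_def
    by (simp add: bb_closed bb_zero_closed bb_one_closed mult_closed bb_mat_mult bb_mat_add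
        bb_mat_smult bb_mat_zero bb_mat_one)
qed

end

section \<open>Morita equivalence of the two algebras\<close>

theorem mainTheorem6:
  fixes n :: nat and r :: "nat rel"
  assumes "n \<ge> 1"
    and "partial_order_on {1..n} r"
    and "\<And>i j. (i, j) \<in> r \<Longrightarrow> i \<le> j"
    and "min_elems n r = {1..num_min n r}"
    and "infinite (UNIV :: 'm set)"
  shows "basic_algebra (L'_algebra n r :: ('k::field, 'k mat) module) \<and>
    morita_equivalent TYPE('m) (L'_algebra n r :: ('k, 'k mat) module)
      (burt_butler_algebra n r :: ('k, 'k bocs_elem \<Rightarrow> 'k path_alg) module)"
proof -
  interpret num_poset n r
    using assms(1-4) by unfold_locales
  let ?D = "rep_alg n r n :: ('k, 'k mat) module"
  let ?C = "burt_butler_algebra n r :: ('k, 'k bocs_elem \<Rightarrow> 'k path_alg) module"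
  have D: "k_algebra ?D" by (rule k_algebra_rep_alg) simp
  have C: "k_algebra ?C" by (rule k_algebra_alg_iso[OF alg_iso_bb_mat D])
  have "morita_equivalent TYPE('m) (rep_alg n r nm :: ('k, 'k mat) module) ?C"
    by (rule full_corner.morita_equivalent_corner[OF full_corner_alg_iso[OF full_corner_rep_alg
          alg_iso_inv[OF alg_iso_bb_mat D] C] assms(5)])
  then show ?thesis
    unfolding L'_algebra_eq using basic_rep_alg by blast
qed

end
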